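(* Let $(\mathcal{C},\mathcal{E})$ be a strong exact IT-context. Then, for any $\mathcal{E}$-exact sequence $A\rightarrowtail B\twoheadrightarrow C$ such that $\mathrm{pd}_{\mathcal{E}}(C)<\infty$, we have $$\mathrm{pd}_{\mathcal{E}}(C)\leq \Psi_{\mathcal{E}}(A\oplus B)+1.$$
   Context: Exact categories: $(\mathcal{C},\mathcal{E})$ is an exact category in the sense of Quillen: $\mathcal{C}$ is additive and $\mathcal{E}$ is a class of kernel-cokernel pairs (short $\mathcal{E}$-exact sequences) $A'\rightarrowtail A\twoheadrightarrow A''$ satisfying the usual axioms; the second maps are the admissible epics. An object $P$ is $\mathcal{E}$-projective if $\mathrm{Hom}_{\mathcal{C}}(P,-)$ takes short $\mathcal{E}$-exact sequences to short exact sequences of abelian groups; $\mathcal{P}(\mathcal{E})$ is the class of these. There are enough $\mathcal{E}$-projectives if every $C$ admits an admissible epic $P\twoheadrightarrow C$ with $P\in\mathcal{P}(\mathcal{E})$. In that case $\mathrm{Ext}^n_{\mathcal{E}}(C,B)$ is the $n$-th cohomology of $\mathrm{Hom}_{\mathcal{C}}(P_\bullet(C),B)$, with $P_\bullet(C)$ an $\mathcal{E}$-projective resolution of $C$ (a resolution by $\mathcal{E}$-projectives spliced from short $\mathcal{E}$-exact sequences), and $\mathrm{pd}_{\mathcal{E}}(C)=\min\{n\in\mathbb{N}: \mathrm{Ext}^j_{\mathcal{E}}(C,Z)=0\ \forall j>n,\ \forall Z\in\mathcal{C}\}$ ($\infty$ if there is no such $n$). For a class $\mathcal{Y}$ of objects,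 $\mathrm{fpd}_{\mathcal{E}}(\mathcal{Y})=\sup\{\mathrm{pd}_{\mathcal{E}}(Y): Y\in\mathcal{Y},\ \mathrm{pd}_{\mathcal{E}}(Y)<\infty\}$. IT-contexts: an exact IT-context is a skeletally small exact category $(\mathcal{C},\mathcal{E})$ with enough $\mathcal{E}$-projectives which is Krull-Schmidt (each object is a finite direct sum of objects with local endomorphism ring). It is strong if $\mathcal{C}$ satisfies Fitting's property: for any $X\in\mathcal{C}$ and $f\in\mathrm{End}_{\mathcal{C}}(X)$ there is a decomposition $X=Y\oplus Z$ with respect to which $f=\begin{pmatrix}\theta&0\\0&\alpha\end{pmatrix}$, where $\theta:Y\to Y$ is an automorphism and $\alpha:Z\to Z$ is nilpotent. Igusa-Todorov functions: the stable category $\underline{\mathcal{C}}$ has the objects of $\mathcal{C}$, and its morphisms are those of $\mathcal{C}$ modulo morphisms factoring through an object of $\mathcal{P}(\mathcal{E})$. An $\mathcal{E}$-syzygy $\Omega_{\mathcal{E}}(M)$ is an object $K$ in a short $\mathcal{E}$-exact sequence $K\rightarrowtail P\twoheadrightarrow M$ with $P\in\mathcal{P}(\mathcal{E})$; it is unique up to isomorphism in $\underline{\mathcal{C}}$ and $\Omega_{\mathcal{E}}$ is an additive endofunctor of $\underline{\mathcal{C}}$; $\Omega^n_{\mathcal{E}}$ denotes its iterates ($\Omega^0_{\mathcal{E}}(M)=M$). $K_{\mathcal{E}}(\mathcal{C})$ is the free abelian group on isoclasses $[M]$ of objects of $\mathcal{C}$ modulo $[N]-[S]-[T]$ when $N\cong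 S\oplus T$, and $[P]$ for $P\in\mathcal{P}(\mathcal{E})$. $\Omega_{\mathcal{E}}$ induces the endomorphism $[M]\mapsto[\Omega_{\mathcal{E}}(M)]$ of $K_{\mathcal{E}}(\mathcal{C})$. $\langle M\rangle$ is the subgroup of $K_{\mathcal{E}}(\mathcal{C})$ generated by the classes of the indecomposable direct summands of $M$ in $\underline{\mathcal{C}}$. Then $\Phi_{\mathcal{E}}(M)=\min\{k\in\mathbb{N}:\ \Omega_{\mathcal{E}}$ restricts to an isomorphism $\Omega^m_{\mathcal{E}}(\langle M\rangle)\to\Omega^{m+1}_{\mathcal{E}}(\langle M\rangle)$ for all $m\ge k\}$ (this exists), and $\Psi_{\mathcal{E}}(M)=\Phi_{\mathcal{E}}(M)+\mathrm{fpd}_{\mathcal{E}}(\mathrm{add}(\Omega_{\mathcal{E}}^{\Phi_{\mathcal{E}}(M)}(M)))$, where $\mathrm{add}(X)$ is the class of direct summands of finite direct sums of copies of $X$. *)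

theory Defs
  imports
    "HOL-Algebra.Ring"
    "HOL-Algebra.Exact_Sequence"
    "HOL-Algebra.Free_Abelian_Groups"
    "HOL-Library.Extended_Nat"
begin

section \<open>Additive categories\<close>

text \<open>
  A category with sets of objects and arrows (every arrow carries its source and target),
  together with a partial addition of parallel arrows and a zero arrow for each pair of objects.
  Since the objects form a set, skeletal smallness is automatic.
\<close>

record ('o, 'm) acat =
  Obj :: "'o set"
  Mor :: "'m set"
  Src :: "'m \<Rightarrow> 'o"
  Tgt :: "'m \<Rightarrow> 'o"
  Idn :: "'o \<Rightarrow> 'm"
  Cmp :: "'m \<Rightarrow> 'm \<Rightarrow> 'm" (infixl \<open>\<bullet>\<index>\<close> 70)
  Add :: "'m \<Rightarrow> 'm \<Rightarrow> 'm" (infixl \<open>\<boxplus>\<index>\<close> 65)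
  Nul :: "'o \<Rightarrow> 'o \<Rightarrow> 'm"

definition Hom :: "('o, 'm) acat \<Rightarrow> 'o \<Rightarrow> 'o \<Rightarrow> 'm set" where
  "Hom \<C> X Y = {f \<in> Mor \<C>. Src \<C> f = X \<and> Tgt \<C> f = Y}"

definition hom_group :: "('o, 'm) acat \<Rightarrow> 'o \<Rightarrow> 'o \<Rightarrow> 'm monoid" where
  "hom_group \<C> X Y = \<lparr>carrier = Hom \<C> X Y, monoid.mult = Add \<C>, one = Nul \<C> X Y\<rparr>"

definition end_ring :: "('o, 'm) acat \<Rightarrow> 'o \<Rightarrow> 'm ring" where
  "end_ring \<C> X = \<lparr>carrier = Hom \<C> X X, monoid.mult = Cmp \<C>, one = Idn \<C> X,
                    ring.zero = Nul \<C> X X, ring.add = Add \<C>\<rparr>"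

locale category =
  fixes \<C> :: "('o, 'm) acat" (structure)
  assumes src_in: "f \<in> Mor \<C> \<Longrightarrow> Src \<C> f \<in> Obj \<C>"
    and tgt_in: "f \<in> Mor \<C> \<Longrightarrow> Tgt \<C> f \<in> Obj \<C>"
    and idn_in: "X \<in> Obj \<C> \<Longrightarrow> Idn \<C> X \<in> Hom \<C> X X"
    and cmp_in: "f \<in> Hom \<C> X Y \<Longrightarrow> g \<in> Hom \<C> Y Z \<Longrightarrow> g \<bullet> f \<in> Hom \<C> X Z"
    and idn_left: "f \<in> Hom \<C> X Y \<Longrightarrow> Idn \<C> Y \<bullet> f = f"
    and idn_right: "f \<in> Hom \<C> X Y \<Longrightarrow> f \<bullet> Idn \<C> X = f"
    and cmp_assoc: "f \<in> Hom \<C> W X \<Longrightarrow> g \<in> Hom \<C> X Y \<Longrightarrow> h \<in> Hom \<C> Y Z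
                      \<Longrightarrow> (h \<bullet> g) \<bullet> f = h \<bullet> (g \<bullet> f)"

definition iso_arrow :: "('o, 'm) acat \<Rightarrow> 'm \<Rightarrow> bool" where
  "iso_arrow \<C> f \<longleftrightarrow> f \<in> Mor \<C> \<and>
     (\<exists>g \<in> Hom \<C> (Tgt \<C> f) (Src \<C> f).
        Cmp \<C> g f = Idn \<C> (Src \<C> f) \<and> Cmp \<C> f g = Idn \<C> (Tgt \<C> f))"

definition isoclass :: "('o, 'm) acat \<Rightarrow> 'o \<Rightarrow> 'o set" where
  "isoclass \<C> X = {Y \<in> Obj \<C>. \<exists>f \<in> Hom \<C> X Y. iso_arrow \<C> f}"

definition zero_object :: "('o, 'm) acat \<Rightarrow> 'o \<Rightarrow> bool" where
  "zero_object \<C> Z \<longleftrightarrow> Z \<in> Obj \<C> \<and>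
     (\<forall>X \<in> Obj \<C>. (\<exists>!f. f \<in> Hom \<C> X Z) \<and> (\<exists>!f. f \<in> Hom \<C> Z X))"

definition biproduct ::
    "('o, 'm) acat \<Rightarrow> 'o \<Rightarrow> 'o \<Rightarrow> 'o \<Rightarrow> 'm \<Rightarrow> 'm \<Rightarrow> 'm \<Rightarrow> 'm \<Rightarrow> bool" where
  "biproduct \<C> X Y S i1 i2 p1 p2 \<longleftrightarrow>
     X \<in> Obj \<C> \<and> Y \<in> Obj \<C> \<and> S \<in> Obj \<C> \<and>
     i1 \<in> Hom \<C> X S \<and> i2 \<in> Hom \<C> Y S \<and> p1 \<in> Hom \<C> S X \<and> p2 \<in> Hom \<C> S Y \<and>
     Cmp \<C> p1 i1 = Idn \<C> X \<and> Cmp \<C> p2 i2 = Idn \<C> Y \<and>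
     Cmp \<C> p2 i1 = Nul \<C> X Y \<and> Cmp \<C> p1 i2 = Nul \<C> Y X \<and>
     Add \<C> (Cmp \<C> i1 p1) (Cmp \<C> i2 p2) = Idn \<C> S"

text \<open>\<open>S\<close> is isomorphic to the direct sum of \<open>X\<close> and \<open>Y\<close>.\<close>

definition is_dsum :: "('o, 'm) acat \<Rightarrow> 'o \<Rightarrow> 'o \<Rightarrow> 'o \<Rightarrow> bool" where
  "is_dsum \<C> X Y S \<longleftrightarrow> (\<exists>i1 i2 p1 p2. biproduct \<C> X Y S i1 i2 p1 p2)"

text \<open>\<open>S\<close> is isomorphic to the direct sum of \<open>X 0, \<dots>, X (n - 1)\<close>; for \<open>n = 0\<close> it is a zero object.\<close>

definition is_finite_dsum :: "('o, 'm) acat \<Rightarrow> nat \<Rightarrow> (nat \<Rightarrow> 'o) \<Rightarrow> 'o \<Rightarrow> bool" where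
  "is_finite_dsum \<C> n X S \<longleftrightarrow> S \<in> Obj \<C> \<and> (\<forall>k<n. X k \<in> Obj \<C>) \<and>
     (\<exists>i p. (\<forall>k<n. i k \<in> Hom \<C> (X k) S \<and> p k \<in> Hom \<C> S (X k)) \<and>
        (\<forall>k<n. \<forall>l<n. Cmp \<C> (p l) (i k) = (if k = l then Idn \<C> (X k) else Nul \<C> (X k) (X l))) \<and>
        finprod (hom_group \<C> S S) (\<lambda>k. Cmp \<C> (i k) (p k)) {..<n} = Idn \<C> S)"

definition direct_summand :: "('o, 'm) acat \<Rightarrow> 'o \<Rightarrow> 'o \<Rightarrow> bool" where
  "direct_summand \<C> X S \<longleftrightarrow> (\<exists>Y. is_dsum \<C> X Y S)"

definition indecomposable :: "('o, 'm) acat \<Rightarrow> 'o \<Rightarrow> bool" where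
  "indecomposable \<C> X \<longleftrightarrow> X \<in> Obj \<C> \<and> \<not> zero_object \<C> X \<and>
     (\<forall>S T. is_dsum \<C> S T X \<longrightarrow> zero_object \<C> S \<or> zero_object \<C> T)"

definition add_closure :: "('o, 'm) acat \<Rightarrow> 'o \<Rightarrow> 'o set" where
  "add_closure \<C> X = {Y. \<exists>n S. is_finite_dsum \<C> n (\<lambda>_. X) S \<and> direct_summand \<C> Y S}"

locale additive_category = category +
  assumes hom_comm_group: "X \<in> Obj \<C> \<Longrightarrow> Y \<in> Obj \<C> \<Longrightarrow> comm_group (hom_group \<C> X Y)"
    and cmp_add_left: "f \<in> Hom \<C> X Y \<Longrightarrow> g \<in> Hom \<C> Y Z \<Longrightarrow> g' \<in> Hom \<C> Y Z
                        \<Longrightarrow> (g \<boxplus> g') \<bullet> f = g \<bullet> f \<boxplus> g' \<bullet> f"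
    and cmp_add_right: "f \<in> Hom \<C> X Y \<Longrightarrow> f' \<in> Hom \<C> X Y \<Longrightarrow> g \<in> Hom \<C> Y Z
                        \<Longrightarrow> g \<bullet> (f \<boxplus> f') = g \<bullet> f \<boxplus> g \<bullet> f'"
    and ex_zero_object: "\<exists>Z. zero_object \<C> Z"
    and ex_dsum: "X \<in> Obj \<C> \<Longrightarrow> Y \<in> Obj \<C> \<Longrightarrow> \<exists>S. is_dsum \<C> X Y S"


section \<open>Exact categories\<close>

definition is_kernel :: "('o, 'm) acat \<Rightarrow> 'm \<Rightarrow> 'm \<Rightarrow> bool" where
  "is_kernel \<C> f g \<longleftrightarrow> f \<in> Mor \<C> \<and> g \<in> Mor \<C> \<and> Tgt \<C> f = Src \<C> g \<and>
     Cmp \<C> g f = Nul \<C> (Src \<C> f) (Tgt \<C> g) \<and>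
     (\<forall>h \<in> Mor \<C>. Tgt \<C> h = Src \<C> g \<and> Cmp \<C> g h = Nul \<C> (Src \<C> h) (Tgt \<C> g) \<longrightarrow>
        (\<exists>!u. u \<in> Hom \<C> (Src \<C> h) (Src \<C> f) \<and> Cmp \<C> f u = h))"

definition is_cokernel :: "('o, 'm) acat \<Rightarrow> 'm \<Rightarrow> 'm \<Rightarrow> bool" where
  "is_cokernel \<C> g f \<longleftrightarrow> f \<in> Mor \<C> \<and> g \<in> Mor \<C> \<and> Tgt \<C> f = Src \<C> g \<and>
     Cmp \<C> g f = Nul \<C> (Src \<C> f) (Tgt \<C> g) \<and>
     (\<forall>h \<in> Mor \<C>. Src \<C> h = Tgt \<C> f \<and> Cmp \<C> h f = Nul \<C> (Src \<C> f) (Tgt \<C> h) \<longrightarrow>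
        (\<exists>!u. u \<in> Hom \<C> (Tgt \<C> g) (Tgt \<C> h) \<and> Cmp \<C> u g = h))"

text \<open>
  Commutative square \<open>b f = f' a\<close> with \<open>f : A \<rightarrow> B\<close>, \<open>a : A \<rightarrow> A'\<close>, \<open>b : B \<rightarrow> B'\<close>, \<open>f' : A' \<rightarrow> B'\<close>.
\<close>

definition comm_square :: "('o, 'm) acat \<Rightarrow> 'm \<Rightarrow> 'm \<Rightarrow> 'm \<Rightarrow> 'm \<Rightarrow> bool" where
  "comm_square \<C> f a b f' \<longleftrightarrow>
     f \<in> Mor \<C> \<and> a \<in> Mor \<C> \<and> b \<in> Mor \<C> \<and> f' \<in> Mor \<C> \<and>
     Src \<C> f = Src \<C> a \<and> Tgt \<C> f = Src \<C> b \<and> Tgt \<C> a = Src \<C> f' \<and> Tgt \<C> b = Tgt \<C> f' \<and>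
     Cmp \<C> b f = Cmp \<C> f' a"

definition is_pushout :: "('o, 'm) acat \<Rightarrow> 'm \<Rightarrow> 'm \<Rightarrow> 'm \<Rightarrow> 'm \<Rightarrow> bool" where
  "is_pushout \<C> f a b f' \<longleftrightarrow> comm_square \<C> f a b f' \<and>
     (\<forall>u v. comm_square \<C> f a u v \<longrightarrow>
        (\<exists>!w. w \<in> Hom \<C> (Tgt \<C> b) (Tgt \<C> u) \<and> Cmp \<C> w b = u \<and> Cmp \<C> w f' = v))"

definition is_pullback :: "('o, 'm) acat \<Rightarrow> 'm \<Rightarrow> 'm \<Rightarrow> 'm \<Rightarrow> 'm \<Rightarrow> bool" where
  "is_pullback \<C> f a b f' \<longleftrightarrow> comm_square \<C> f a b f' \<and>
     (\<forall>u v. comm_square \<C> u v b f' \<longrightarrow>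
        (\<exists>!w. w \<in> Hom \<C> (Src \<C> u) (Src \<C> f) \<and> Cmp \<C> f w = u \<and> Cmp \<C> a w = v))"

definition admissible_monic :: "('m \<times> 'm) set \<Rightarrow> 'm \<Rightarrow> bool" where
  "admissible_monic \<E> f \<longleftrightarrow> (\<exists>g. (f, g) \<in> \<E>)"

definition admissible_epic :: "('m \<times> 'm) set \<Rightarrow> 'm \<Rightarrow> bool" where
  "admissible_epic \<E> g \<longleftrightarrow> (\<exists>f. (f, g) \<in> \<E>)"

text \<open>Quillen's axioms, in the self-dual form due to Keller and Buehler.\<close>

locale exact_category = additive_category +
  fixes \<E> :: "('b \<times> 'b) set"
  assumes kernel_cokernel: "(f, g) \<in> \<E> \<Longrightarrow> is_kernel \<C> f g \<and> is_cokernel \<C> g f"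
    and iso_closed: "(f, g) \<in> \<E> \<Longrightarrow> comm_square \<C> f a b f' \<Longrightarrow> comm_square \<C> g b c g'
          \<Longrightarrow> iso_arrow \<C> a \<Longrightarrow> iso_arrow \<C> b \<Longrightarrow> iso_arrow \<C> c \<Longrightarrow> (f', g') \<in> \<E>"
    and idn_monic: "X \<in> Obj \<C> \<Longrightarrow> admissible_monic \<E> (Idn \<C> X)"
    and idn_epic: "X \<in> Obj \<C> \<Longrightarrow> admissible_epic \<E> (Idn \<C> X)"
    and cmp_monic: "admissible_monic \<E> f \<Longrightarrow> admissible_monic \<E> g \<Longrightarrow> Tgt \<C> f = Src \<C> g
          \<Longrightarrow> admissible_monic \<E> (g \<bullet> f)"
    and cmp_epic: "admissible_epic \<E> f \<Longrightarrow> admissible_epic \<E> g \<Longrightarrow> Tgt \<C> f = Src \<C> g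
          \<Longrightarrow> admissible_epic \<E> (g \<bullet> f)"
    and pushout_monic: "admissible_monic \<E> f \<Longrightarrow> a \<in> Mor \<C> \<Longrightarrow> Src \<C> a = Src \<C> f
          \<Longrightarrow> \<exists>b f'. is_pushout \<C> f a b f' \<and> admissible_monic \<E> f'"
    and pullback_epic: "admissible_epic \<E> g \<Longrightarrow> c \<in> Mor \<C> \<Longrightarrow> Tgt \<C> c = Tgt \<C> g
          \<Longrightarrow> \<exists>b g'. is_pullback \<C> g' b c g \<and> admissible_epic \<E> g'"

definition projective :: "('o, 'm) acat \<Rightarrow> ('m \<times> 'm) set \<Rightarrow> 'o \<Rightarrow> bool" where
  "projective \<C> \<E> P \<longleftrightarrow> P \<in> Obj \<C> \<and>
     (\<forall>(f, g) \<in> \<E>. short_exact_sequence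
        (hom_group \<C> P (Tgt \<C> g)) (hom_group \<C> P (Src \<C> g)) (hom_group \<C> P (Src \<C> f))
        (\<lambda>h. Cmp \<C> g h) (\<lambda>h. Cmp \<C> f h))"


section \<open>Ext and projective dimension\<close>

text \<open>
  A resolution \<open>\<dots> \<rightarrow> P 1 \<rightarrow> P 0 \<rightarrow> X\<close> spliced from short exact sequences
  \<open>K (n + 1) \<rightarrow> P n \<rightarrow> K n\<close> (with maps \<open>\<mu> n\<close> and \<open>\<epsilon> n\<close>) where \<open>K 0 = X\<close>;
  the differential is \<open>d n : P (n + 1) \<rightarrow> P n\<close>.
\<close>

definition proj_resolution ::
    "('o, 'm) acat \<Rightarrow> ('m \<times> 'm) set \<Rightarrow> 'o \<Rightarrow> (nat \<Rightarrow> 'o) \<Rightarrow> (nat \<Rightarrow> 'm) \<Rightarrow> bool" where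
  "proj_resolution \<C> \<E> X P d \<longleftrightarrow> (\<forall>n. projective \<C> \<E> (P n)) \<and>
     (\<exists>K \<mu> \<epsilon>. K 0 = X \<and>
        (\<forall>n. (\<mu> n, \<epsilon> n) \<in> \<E> \<and> \<mu> n \<in> Hom \<C> (K (Suc n)) (P n) \<and> \<epsilon> n \<in> Hom \<C> (P n) (K n)) \<and>
        (\<forall>n. d n = Cmp \<C> (\<mu> n) (\<epsilon> (Suc n))))"

definition cocycles ::
    "('o, 'm) acat \<Rightarrow> (nat \<Rightarrow> 'o) \<Rightarrow> (nat \<Rightarrow> 'm) \<Rightarrow> nat \<Rightarrow> 'o \<Rightarrow> 'm set" where
  "cocycles \<C> P d n B =
     kernel (hom_group \<C> (P n) B) (hom_group \<C> (P (Suc n)) B) (\<lambda>h. Cmp \<C> h (d n))"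

fun coboundaries ::
    "('o, 'm) acat \<Rightarrow> (nat \<Rightarrow> 'o) \<Rightarrow> (nat \<Rightarrow> 'm) \<Rightarrow> nat \<Rightarrow> 'o \<Rightarrow> 'm set" where
  "coboundaries \<C> P d 0 B = {Nul \<C> (P 0) B}"
| "coboundaries \<C> P d (Suc n) B = (\<lambda>h. Cmp \<C> h (d n)) ` Hom \<C> (P n) B"

definition cohomology ::
    "('o, 'm) acat \<Rightarrow> (nat \<Rightarrow> 'o) \<Rightarrow> (nat \<Rightarrow> 'm) \<Rightarrow> nat \<Rightarrow> 'o \<Rightarrow> 'm set monoid" where
  "cohomology \<C> P d n B =
     (hom_group \<C> (P n) B)\<lparr>carrier := cocycles \<C> P d n B\<rparr> Mod coboundaries \<C> P d n B"

text \<open>Ext is computed from a chosen resolution; up to isomorphism the choice is irrelevant.\<close>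

definition Ext ::
    "('o, 'm) acat \<Rightarrow> ('m \<times> 'm) set \<Rightarrow> nat \<Rightarrow> 'o \<Rightarrow> 'o \<Rightarrow> 'm set monoid" where
  "Ext \<C> \<E> n X B = (case (SOME (P, d). proj_resolution \<C> \<E> X P d) of (P, d) \<Rightarrow> cohomology \<C> P d n B)"

definition pd :: "('o, 'm) acat \<Rightarrow> ('m \<times> 'm) set \<Rightarrow> 'o \<Rightarrow> enat" where
  "pd \<C> \<E> X = (INF n \<in> {n. \<forall>j>n. \<forall>Z \<in> Obj \<C>. trivial_group (Ext \<C> \<E> j X Z)}. enat n)"

definition fpd :: "('o, 'm) acat \<Rightarrow> ('m \<times> 'm) set \<Rightarrow> 'o set \<Rightarrow> enat" where
  "fpd \<C> \<E> \<D> = (SUP Y \<in> {Y \<in> \<D>. pd \<C> \<E> Y < \<infinity>}. pd \<C> \<E> Y)"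


section \<open>Igusa--Todorov contexts\<close>

text \<open>Local (noncommutative) ring: nonzero, and the non-units are closed under addition.\<close>

definition local_ring :: "('a, 'b) ring_scheme \<Rightarrow> bool" where
  "local_ring R \<longleftrightarrow> ring R \<and> \<one>\<^bsub>R\<^esub> \<noteq> \<zero>\<^bsub>R\<^esub> \<and>
     (\<forall>a \<in> carrier R - Units R. \<forall>b \<in> carrier R - Units R. a \<oplus>\<^bsub>R\<^esub> b \<notin> Units R)"

locale exact_IT_context = exact_category +
  assumes enough_projectives:
      "X \<in> Obj \<C> \<Longrightarrow> \<exists>P g. projective \<C> \<E> P \<and> g \<in> Hom \<C> P X \<and> admissible_epic \<E> g"
    and krull_schmidt:
      "X \<in> Obj \<C> \<Longrightarrow> \<exists>n Y. is_finite_dsum \<C> n Y X \<and> (\<forall>k<n. local_ring (end_ring \<C> (Y k)))"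

locale strong_exact_IT_context = exact_IT_context +
  assumes fitting:
    "f \<in> Hom \<C> X X \<Longrightarrow> \<exists>Y Z i1 i2 p1 p2 \<theta> \<alpha>. biproduct \<C> Y Z X i1 i2 p1 p2 \<and>
       \<theta> \<in> Hom \<C> Y Y \<and> iso_arrow \<C> \<theta> \<and>
       \<alpha> \<in> Hom \<C> Z Z \<and> (\<exists>n::nat. \<alpha> [^]\<^bsub>end_ring \<C> Z\<^esub> n = Nul \<C> Z Z) \<and>
       f = i1 \<bullet> \<theta> \<bullet> p1 \<boxplus> i2 \<bullet> \<alpha> \<bullet> p2"


section \<open>The stable category\<close>

definition proj_maps :: "('o, 'm) acat \<Rightarrow> ('m \<times> 'm) set \<Rightarrow> 'o \<Rightarrow> 'o \<Rightarrow> 'm set" where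
  "proj_maps \<C> \<E> X Y =
     {Cmp \<C> v u | u v P. projective \<C> \<E> P \<and> u \<in> Hom \<C> X P \<and> v \<in> Hom \<C> P Y}"

definition stable_class :: "('o, 'm) acat \<Rightarrow> ('m \<times> 'm) set \<Rightarrow> 'm \<Rightarrow> 'm set" where
  "stable_class \<C> \<E> f =
     proj_maps \<C> \<E> (Src \<C> f) (Tgt \<C> f) #>\<^bsub>hom_group \<C> (Src \<C> f) (Tgt \<C> f)\<^esub> f"

text \<open>Arrows of the stable category are residue classes, composed and added via representatives.\<close>

definition rep :: "'m set \<Rightarrow> 'm" where
  "rep c = (SOME f. f \<in> c)"

definition stable_cat :: "('o, 'm) acat \<Rightarrow> ('m \<times> 'm) set \<Rightarrow> ('o, 'm set) acat" where
  "stable_cat \<C> \<E> =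
     \<lparr>Obj = Obj \<C>,
      Mor = (\<Union>X \<in> Obj \<C>. \<Union>Y \<in> Obj \<C>. carrier (hom_group \<C> X Y Mod proj_maps \<C> \<E> X Y)),
      Src = (\<lambda>c. Src \<C> (rep c)),
      Tgt = (\<lambda>c. Tgt \<C> (rep c)),
      Idn = (\<lambda>X. stable_class \<C> \<E> (Idn \<C> X)),
      Cmp = (\<lambda>c d. stable_class \<C> \<E> (Cmp \<C> (rep c) (rep d))),
      Add = (\<lambda>c d. stable_class \<C> \<E> (Add \<C> (rep c) (rep d))),
      Nul = (\<lambda>X Y. proj_maps \<C> \<E> X Y)\<rparr>"


section \<open>Igusa--Todorov functions\<close>

definition is_syzygy :: "('o, 'm) acat \<Rightarrow> ('m \<times> 'm) set \<Rightarrow> 'o \<Rightarrow> 'o \<Rightarrow> bool" where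
  "is_syzygy \<C> \<E> M K \<longleftrightarrow>
     (\<exists>P f g. projective \<C> \<E> P \<and> (f, g) \<in> \<E> \<and> f \<in> Hom \<C> K P \<and> g \<in> Hom \<C> P M)"

definition syzygy :: "('o, 'm) acat \<Rightarrow> ('m \<times> 'm) set \<Rightarrow> 'o \<Rightarrow> 'o" where
  "syzygy \<C> \<E> M = (SOME K. is_syzygy \<C> \<E> M K)"

definition isoclass_group :: "('o, 'm) acat \<Rightarrow> ('o set \<Rightarrow>\<^sub>0 int) monoid" where
  "isoclass_group \<C> = free_Abelian_group (isoclass \<C> ` Obj \<C>)"

definition K_relations :: "('o, 'm) acat \<Rightarrow> ('m \<times> 'm) set \<Rightarrow> ('o set \<Rightarrow>\<^sub>0 int) set" where
  "K_relations \<C> \<E> =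
     {frag_of (isoclass \<C> N) - frag_of (isoclass \<C> S) - frag_of (isoclass \<C> T) | N S T. is_dsum \<C> S T N}
     \<union> {frag_of (isoclass \<C> P) | P. projective \<C> \<E> P}"

definition K_subgroup :: "('o, 'm) acat \<Rightarrow> ('m \<times> 'm) set \<Rightarrow> ('o set \<Rightarrow>\<^sub>0 int) set" where
  "K_subgroup \<C> \<E> = generate (isoclass_group \<C>) (K_relations \<C> \<E>)"

definition K_group :: "('o, 'm) acat \<Rightarrow> ('m \<times> 'm) set \<Rightarrow> ('o set \<Rightarrow>\<^sub>0 int) set monoid" where
  "K_group \<C> \<E> = isoclass_group \<C> Mod K_subgroup \<C> \<E>"

definition K_class :: "('o, 'm) acat \<Rightarrow> ('m \<times> 'm) set \<Rightarrow> 'o \<Rightarrow> ('o set \<Rightarrow>\<^sub>0 int) set" where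
  "K_class \<C> \<E> M = K_subgroup \<C> \<E> #>\<^bsub>isoclass_group \<C>\<^esub> frag_of (isoclass \<C> M)"

text \<open>
  The endomorphism of the group induced by the syzygy functor. It is determined on the carrier,
  because the classes \<open>K_class \<C> \<E> M\<close> generate.
\<close>

definition K_syzygy ::
    "('o, 'm) acat \<Rightarrow> ('m \<times> 'm) set \<Rightarrow> ('o set \<Rightarrow>\<^sub>0 int) set \<Rightarrow> ('o set \<Rightarrow>\<^sub>0 int) set" where
  "K_syzygy \<C> \<E> = (SOME h. h \<in> hom (K_group \<C> \<E>) (K_group \<C> \<E>) \<and>
     (\<forall>M \<in> Obj \<C>. h (K_class \<C> \<E> M) = K_class \<C> \<E> (syzygy \<C> \<E> M)))"

definition K_span :: "('o, 'm) acat \<Rightarrow> ('m \<times> 'm) set \<Rightarrow> 'o \<Rightarrow> ('o set \<Rightarrow>\<^sub>0 int) set set" where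
  "K_span \<C> \<E> M = generate (K_group \<C> \<E>)
     {K_class \<C> \<E> N | N. indecomposable (stable_cat \<C> \<E>) N \<and> direct_summand (stable_cat \<C> \<E>) N M}"

definition IT_Phi :: "('o, 'm) acat \<Rightarrow> ('m \<times> 'm) set \<Rightarrow> 'o \<Rightarrow> nat" where
  "IT_Phi \<C> \<E> M = (LEAST k. \<forall>m\<ge>k. K_syzygy \<C> \<E> \<in>
     iso ((K_group \<C> \<E>)\<lparr>carrier := (K_syzygy \<C> \<E> ^^ m) ` K_span \<C> \<E> M\<rparr>)
         ((K_group \<C> \<E>)\<lparr>carrier := (K_syzygy \<C> \<E> ^^ Suc m) ` K_span \<C> \<E> M\<rparr>))"

definition IT_Psi :: "('o, 'm) acat \<Rightarrow> ('m \<times> 'm) set \<Rightarrow> 'o \<Rightarrow> enat" where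
  "IT_Psi \<C> \<E> M = enat (IT_Phi \<C> \<E> M) +
     fpd \<C> \<E> (add_closure \<C> ((syzygy \<C> \<E> ^^ IT_Phi \<C> \<E> M) M))"

end

theory Submission
  imports Defs "HOL-Library.Multiset"
begin

text \<open>
  Let \<open>A \<rightarrow> B \<rightarrow> C\<close> be exact with \<open>pd C\<close> finite, let \<open>S = A \<oplus> B\<close> and \<open>n = \<Phi>(S)\<close>. The horseshoe lemma provides
  exact sequences \<open>A\<^sub>m \<rightarrow> B\<^sub>m \<rightarrow> C\<^sub>m\<close> of \<open>m\<close>-th syzygies. For large \<open>m\<close> the object \<open>C\<^sub>m\<close> is projective, the
  sequence splits, and \<open>[A\<^sub>m] = [B\<^sub>m]\<close> in the group of stable isomorphism classes. The classes of \<open>A\<close> and \<open>B\<close> lie in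
  \<open>\<langle>S\<rangle>\<close>, and beyond \<open>n\<close> the syzygy endomorphism is injective on the images of \<open>\<langle>S\<rangle>\<close>; so already \<open>[A\<^sub>n] = [B\<^sub>n]\<close>
  (\<open>IT_Phi_K_class_eq\<close>), that is, \<open>A\<^sub>n \<oplus> P \<cong> B\<^sub>n \<oplus> Q\<close> with \<open>P\<close> and \<open>Q\<close> projective
  (\<open>K_class_eq_iff\<close>, which rests on the cancellation law \<open>dsum_cancel\<close>).

  With \<open>X = A\<^sub>n \<oplus> P\<close> there is therefore an exact sequence \<open>X \<oplus> Q \<rightarrow> X \<oplus> P \<rightarrow> C\<^sub>n\<close>. Fitting's property splits \<open>X\<close>
  into \<open>Y \<oplus> Z\<close> such that the component \<open>X \<rightarrow> X\<close> is invertible on \<open>Y\<close> and nilpotent on \<open>Z\<close>, and Gaussian elimination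
  (\<open>exact_gauss\<close>) removes \<open>Y\<close>: there is an exact sequence \<open>Z \<oplus> Q \<rightarrow> Z \<oplus> P \<rightarrow> C\<^sub>n\<close> whose component \<open>\<alpha> : Z \<rightarrow> Z\<close> is
  nilpotent. It follows that \<open>pd C\<^sub>n \<le> pd Z + 1\<close>, hence \<open>pd C \<le> n + pd Z + 1\<close>. Since \<open>pd C\<^sub>n\<close> is finite, nilpotency forces \<open>pd Z\<close> to be finite
  (\<open>proj_dim_le_nilpotent\<close>). As \<open>Z\<close> is a summand of the sum of \<open>\<Omega>\<^sup>n S\<close> and a projective object, its local summands are
  projective or belong to \<open>add (\<Omega>\<^sup>n S)\<close>, so \<open>pd Z\<close> is bounded by the \<open>fpd\<close> in the definition of \<open>\<Psi>\<close>
  (\<open>proj_dim_le_fpd\<close>).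

  Projective dimensions are handled through syzygies: \<open>pd X \<le> n\<close> holds if and only if the \<open>n\<close>-th syzygies of \<open>X\<close> are
  projective (\<open>pd_le_iff\<close>), and the closure properties of this condition follow from Schanuel's lemma and the horseshoe
  lemma. For the finiteness of \<open>pd Z\<close>, successive pushouts yield admissible monics \<open>Z \<rightarrow> T\<^sub>k\<close> with component \<open>\<alpha>\<^sup>k\<close> on \<open>Z\<close>
  and cokernels of bounded projective dimension; once \<open>\<alpha>\<^sup>k = 0\<close>, \<open>Z\<close> is a retract of such a cokernel.

  The numbers \<open>\<Phi>\<close> are well defined because \<open>\<langle>S\<rangle>\<close> is contained in a finitely generated group, so that the kernels of the powers
  of the syzygy endomorphism on it stop growing (\<open>IT_Phi_iso\<close>).
\<close>

section \<open>Arithmetic of arrows\<close>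

text \<open>
  Sources and targets are functions, so conditions on them are decided by rewriting. Hence all rules below
  speak of \<open>Mor\<close>, \<open>Src\<close> and \<open>Tgt\<close> instead of \<open>Hom\<close>: as conditional rewrite rules they let the simplifier
  compute in the category.
\<close>

lemma Hom_iff: "f \<in> Hom \<C> X Y \<longleftrightarrow> f \<in> Mor \<C> \<and> Src \<C> f = X \<and> Tgt \<C> f = Y"
  by (simp add: Hom_def)

context category
begin

lemma src_obj [simp]: "f \<in> Mor \<C> \<Longrightarrow> Src \<C> f \<in> Obj \<C>"
  and tgt_obj [simp]: "f \<in> Mor \<C> \<Longrightarrow> Tgt \<C> f \<in> Obj \<C>"
  by (simp_all add: src_in tgt_in)

lemma hom_obj: "f \<in> Hom \<C> X Y \<Longrightarrow> X \<in> Obj \<C> \<and> Y \<in> Obj \<C>"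
  by (auto simp: Hom_iff)

lemma idn_arr [simp]:
  assumes "X \<in> Obj \<C>"
  shows "Idn \<C> X \<in> Mor \<C>" "Src \<C> (Idn \<C> X) = X" "Tgt \<C> (Idn \<C> X) = X"
  using idn_in[OF assms] by (simp_all add: Hom_iff)

lemma cmp_arr [simp]:
  assumes "f \<in> Mor \<C>" "g \<in> Mor \<C>" "Tgt \<C> f = Src \<C> g"
  shows "g \<bullet> f \<in> Mor \<C>" "Src \<C> (g \<bullet> f) = Src \<C> f" "Tgt \<C> (g \<bullet> f) = Tgt \<C> g"
  using cmp_in[of f "Src \<C> f" "Tgt \<C> f" g "Tgt \<C> g"] assms by (simp_all add: Hom_iff)

lemma cmp_idn_left [simp]: "f \<in> Mor \<C> \<Longrightarrow> Tgt \<C> f = Y \<Longrightarrow> Idn \<C> Y \<bullet> f = f"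
  using idn_left by (auto simp: Hom_iff)

lemma cmp_idn_right [simp]: "f \<in> Mor \<C> \<Longrightarrow> Src \<C> f = X \<Longrightarrow> f \<bullet> Idn \<C> X = f"
  using idn_right by (auto simp: Hom_iff)

lemma assoc [simp]:
  "f \<in> Mor \<C> \<Longrightarrow> g \<in> Mor \<C> \<Longrightarrow> h \<in> Mor \<C> \<Longrightarrow> Tgt \<C> f = Src \<C> g \<Longrightarrow> Tgt \<C> g = Src \<C> h
    \<Longrightarrow> (h \<bullet> g) \<bullet> f = h \<bullet> (g \<bullet> f)"
  using cmp_assoc by (auto simp: Hom_iff)

text \<open>Lets an equation between composites act inside a longer right-nested composite.\<close>

lemma cmp_eq_assoc:
  "h \<bullet> g = k \<Longrightarrow> g \<in> Mor \<C> \<Longrightarrow> h \<in> Mor \<C> \<Longrightarrow> Tgt \<C> g = Src \<C> h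
    \<Longrightarrow> \<forall>f. f \<in> Mor \<C> \<longrightarrow> Tgt \<C> f = Src \<C> g \<longrightarrow> h \<bullet> (g \<bullet> f) = k \<bullet> f"
  using assoc by metis

definition inverse_arrows where
  "inverse_arrows f g \<longleftrightarrow> f \<in> Mor \<C> \<and> g \<in> Hom \<C> (Tgt \<C> f) (Src \<C> f) \<and>
     g \<bullet> f = Idn \<C> (Src \<C> f) \<and> f \<bullet> g = Idn \<C> (Tgt \<C> f)"

lemma iso_arrow_iff: "iso_arrow \<C> f \<longleftrightarrow> (\<exists>g. inverse_arrows f g)"
  by (auto simp: iso_arrow_def inverse_arrows_def)

lemma inverse_arrowsD:
  assumes "inverse_arrows f g"
  shows "f \<in> Mor \<C>" "g \<in> Mor \<C>" "Src \<C> g = Tgt \<C> f" "Tgt \<C> g = Src \<C> f"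
    "g \<bullet> f = Idn \<C> (Src \<C> f)" "f \<bullet> g = Idn \<C> (Tgt \<C> f)"
    "\<forall>h. h \<in> Mor \<C> \<longrightarrow> Tgt \<C> h = Src \<C> f \<longrightarrow> g \<bullet> (f \<bullet> h) = h"
    "\<forall>h. h \<in> Mor \<C> \<longrightarrow> Tgt \<C> h = Tgt \<C> f \<longrightarrow> f \<bullet> (g \<bullet> h) = h"
proof -
  show *: "f \<in> Mor \<C>" "g \<in> Mor \<C>" "Src \<C> g = Tgt \<C> f" "Tgt \<C> g = Src \<C> f"
    "g \<bullet> f = Idn \<C> (Src \<C> f)" "f \<bullet> g = Idn \<C> (Tgt \<C> f)"
    using assms by (auto simp: inverse_arrows_def Hom_iff)
  show "\<forall>h. h \<in> Mor \<C> \<longrightarrow> Tgt \<C> h = Src \<C> f \<longrightarrow> g \<bullet> (f \<bullet> h) = h"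
    "\<forall>h. h \<in> Mor \<C> \<longrightarrow> Tgt \<C> h = Tgt \<C> f \<longrightarrow> f \<bullet> (g \<bullet> h) = h"
    using cmp_eq_assoc[OF *(5)] cmp_eq_assoc[OF *(6)] * by simp_all
qed

lemma inverse_arrows_sym: "inverse_arrows f g \<Longrightarrow> inverse_arrows g f"
  by (auto simp: inverse_arrows_def Hom_iff)

lemma iso_arrow_idn [simp]: "X \<in> Obj \<C> \<Longrightarrow> iso_arrow \<C> (Idn \<C> X)"
  unfolding iso_arrow_iff inverse_arrows_def by (intro exI[of _ "Idn \<C> X"]) (simp add: Hom_iff)

lemma iso_arrow_cmp:
  assumes "iso_arrow \<C> f" "iso_arrow \<C> g" "Tgt \<C> f = Src \<C> g"
  shows "iso_arrow \<C> (g \<bullet> f)"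
proof -
  obtain f' g' where *: "inverse_arrows f f'" "inverse_arrows g g'"
    using assms by (auto simp: iso_arrow_iff)
  have "inverse_arrows (g \<bullet> f) (f' \<bullet> g')"
    unfolding inverse_arrows_def
    using assms(3) by (simp add: inverse_arrowsD[OF *(1)] inverse_arrowsD[OF *(2)] Hom_iff)
  then show ?thesis by (auto simp: iso_arrow_iff)
qed

definition isomorphic where
  "isomorphic X Y \<longleftrightarrow> (\<exists>f \<in> Hom \<C> X Y. iso_arrow \<C> f)"

lemma isomorphicE:
  assumes "isomorphic X Y"
  obtains f g where "inverse_arrows f g" "Src \<C> f = X" "Tgt \<C> f = Y"
  using assms by (auto simp: isomorphic_def iso_arrow_iff Hom_iff)

lemma isomorphicI: "inverse_arrows f g \<Longrightarrow> Src \<C> f = X \<Longrightarrow> Tgt \<C> f = Y \<Longrightarrow> isomorphic X Y"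
  by (auto simp: isomorphic_def iso_arrow_iff Hom_iff inverse_arrows_def)

lemma isomorphic_refl: "X \<in> Obj \<C> \<Longrightarrow> isomorphic X X"
  using iso_arrow_idn idn_in unfolding isomorphic_def by blast

lemma isomorphic_sym: "isomorphic X Y \<Longrightarrow> isomorphic Y X"
  by (elim isomorphicE, rule isomorphicI[OF inverse_arrows_sym]) (auto dest: inverse_arrowsD)

lemma isomorphic_trans: "isomorphic X Y \<Longrightarrow> isomorphic Y Z \<Longrightarrow> isomorphic X Z"
  unfolding isomorphic_def using iso_arrow_cmp cmp_in by (metis Hom_iff)

lemma isomorphic_obj: "isomorphic X Y \<Longrightarrow> X \<in> Obj \<C> \<and> Y \<in> Obj \<C>"
  unfolding isomorphic_def using hom_obj by blast

lemma mem_isoclass: "Y \<in> isoclass \<C> X \<longleftrightarrow> isomorphic X Y"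
  using isomorphic_obj by (auto simp: isoclass_def isomorphic_def)

lemma isoclass_eq: "X \<in> Obj \<C> \<Longrightarrow> isoclass \<C> X = isoclass \<C> Y \<longleftrightarrow> isomorphic X Y"
  unfolding set_eq_iff mem_isoclass
  using isomorphic_refl isomorphic_sym isomorphic_trans by blast

lemma self_mem_isoclass: "X \<in> Obj \<C> \<Longrightarrow> X \<in> isoclass \<C> X"
  by (simp add: mem_isoclass isomorphic_refl)

end

context additive_category
begin

definition neg where
  "neg f = inv\<^bsub>hom_group \<C> (Src \<C> f) (Tgt \<C> f)\<^esub> f"

lemma hom_group_simps [simp]:
  "carrier (hom_group \<C> X Y) = Hom \<C> X Y" "one (hom_group \<C> X Y) = Nul \<C> X Y"
  "monoid.mult (hom_group \<C> X Y) f g = f \<boxplus> g"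
  by (simp_all add: hom_group_def)

lemma nul_arr [simp]:
  assumes "X \<in> Obj \<C>" "Y \<in> Obj \<C>"
  shows "Nul \<C> X Y \<in> Mor \<C>" "Src \<C> (Nul \<C> X Y) = X" "Tgt \<C> (Nul \<C> X Y) = Y"
proof -
  interpret comm_group "hom_group \<C> X Y" using hom_comm_group assms .
  show "Nul \<C> X Y \<in> Mor \<C>" "Src \<C> (Nul \<C> X Y) = X" "Tgt \<C> (Nul \<C> X Y) = Y"
    using one_closed by (simp_all add: Hom_iff)
qed

lemma add_arr [simp]:
  assumes "f \<in> Mor \<C>" "g \<in> Mor \<C>" "Src \<C> f = Src \<C> g" "Tgt \<C> f = Tgt \<C> g"
  shows "f \<boxplus> g \<in> Mor \<C>" "Src \<C> (f \<boxplus> g) = Src \<C> g" "Tgt \<C> (f \<boxplus> g) = Tgt \<C> g"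
proof -
  interpret comm_group "hom_group \<C> (Src \<C> g) (Tgt \<C> g)" using hom_comm_group assms by simp
  show "f \<boxplus> g \<in> Mor \<C>" "Src \<C> (f \<boxplus> g) = Src \<C> g" "Tgt \<C> (f \<boxplus> g) = Tgt \<C> g"
    using m_closed[of f g] assms by (simp_all add: Hom_iff)
qed

lemma neg_arr [simp]:
  assumes "f \<in> Mor \<C>"
  shows "neg f \<in> Mor \<C>" "Src \<C> (neg f) = Src \<C> f" "Tgt \<C> (neg f) = Tgt \<C> f"
proof -
  interpret comm_group "hom_group \<C> (Src \<C> f) (Tgt \<C> f)" using hom_comm_group assms by simp
  show "neg f \<in> Mor \<C>" "Src \<C> (neg f) = Src \<C> f" "Tgt \<C> (neg f) = Tgt \<C> f"
    using inv_closed[of f] assms by (simp_all add: neg_def Hom_iff)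
qed

lemma add_neg [simp]:
  assumes "f \<in> Mor \<C>"
  shows "f \<boxplus> neg f = Nul \<C> (Src \<C> f) (Tgt \<C> f)" "neg f \<boxplus> f = Nul \<C> (Src \<C> f) (Tgt \<C> f)"
proof -
  interpret comm_group "hom_group \<C> (Src \<C> f) (Tgt \<C> f)" using hom_comm_group assms by simp
  show "f \<boxplus> neg f = Nul \<C> (Src \<C> f) (Tgt \<C> f)" "neg f \<boxplus> f = Nul \<C> (Src \<C> f) (Tgt \<C> f)"
    using r_inv[of f] l_inv[of f] assms by (simp_all add: neg_def Hom_iff)
qed

lemma add_comm:
  assumes "f \<in> Mor \<C>" "g \<in> Mor \<C>" "Src \<C> f = Src \<C> g" "Tgt \<C> f = Tgt \<C> g"
  shows "f \<boxplus> g = g \<boxplus> f"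
proof -
  interpret comm_group "hom_group \<C> (Src \<C> g) (Tgt \<C> g)" using hom_comm_group assms by simp
  show ?thesis using m_comm[of f g] assms by (simp add: Hom_iff)
qed

lemma add_assoc [simp]:
  assumes "f \<in> Mor \<C>" "g \<in> Mor \<C>" "h \<in> Mor \<C>" "Src \<C> f = Src \<C> g" "Tgt \<C> f = Tgt \<C> g"
    "Src \<C> h = Src \<C> g" "Tgt \<C> h = Tgt \<C> g"
  shows "f \<boxplus> g \<boxplus> h = f \<boxplus> (g \<boxplus> h)"
proof -
  interpret comm_group "hom_group \<C> (Src \<C> g) (Tgt \<C> g)" using hom_comm_group assms by simp
  show ?thesis using m_assoc[of f g h] assms by (simp add: Hom_iff)
qed

lemma add_left_comm:
  assumes "f \<in> Mor \<C>" "g \<in> Mor \<C>" "h \<in> Mor \<C>" "Src \<C> f = Src \<C> g" "Tgt \<C> f = Tgt \<C> g"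
    "Src \<C> h = Src \<C> g" "Tgt \<C> h = Tgt \<C> g"
  shows "f \<boxplus> (g \<boxplus> h) = g \<boxplus> (f \<boxplus> h)"
  using assms add_assoc[of f g h] add_assoc[of g f h] add_comm[of f g] by simp

lemma add_nul [simp]:
  assumes "f \<in> Mor \<C>" "X = Src \<C> f" "Y = Tgt \<C> f"
  shows "f \<boxplus> Nul \<C> X Y = f" "Nul \<C> X Y \<boxplus> f = f"
proof -
  interpret comm_group "hom_group \<C> (Src \<C> f) (Tgt \<C> f)" using hom_comm_group assms by simp
  show "f \<boxplus> Nul \<C> X Y = f" "Nul \<C> X Y \<boxplus> f = f"
    using r_one[of f] l_one[of f] assms by (simp_all add: Hom_iff)
qed

lemma add_neg_assoc [simp]:
  assumes "f \<in> Mor \<C>" "h \<in> Mor \<C>" "Src \<C> h = Src \<C> f" "Tgt \<C> h = Tgt \<C> f"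
  shows "f \<boxplus> (neg f \<boxplus> h) = h" "neg f \<boxplus> (f \<boxplus> h) = h"
  using assms add_assoc[of f "neg f" h] add_assoc[of "neg f" f h] by (simp_all del: add_assoc)

lemma add_left_cancel:
  assumes "f \<in> Mor \<C>" "g \<in> Mor \<C>" "h \<in> Mor \<C>" "Src \<C> f = Src \<C> g" "Tgt \<C> f = Tgt \<C> g"
    "Src \<C> h = Src \<C> g" "Tgt \<C> h = Tgt \<C> g" "f \<boxplus> g = f \<boxplus> h"
  shows "g = h"
proof -
  have "g = neg f \<boxplus> (f \<boxplus> g)" using assms(1-5) by simp
  also have "\<dots> = neg f \<boxplus> (f \<boxplus> h)" using assms(8) by simp
  also have "\<dots> = h" using assms(1-7) by simp
  finally show ?thesis .
qed

lemma neg_unique: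
  assumes "f \<in> Mor \<C>" "g \<in> Mor \<C>" "Src \<C> f = Src \<C> g" "Tgt \<C> f = Tgt \<C> g"
    "f \<boxplus> g = Nul \<C> (Src \<C> g) (Tgt \<C> g)"
  shows "g = neg f"
  by (rule add_left_cancel[of f]) (use assms in simp_all)

lemma cmp_add [simp]:
  assumes "f \<in> Mor \<C>" "g \<in> Mor \<C>" "h \<in> Mor \<C>" "Src \<C> f = Src \<C> g" "Tgt \<C> f = Tgt \<C> g"
  shows "Src \<C> h = Tgt \<C> g \<Longrightarrow> h \<bullet> (f \<boxplus> g) = h \<bullet> f \<boxplus> h \<bullet> g"
    and "Tgt \<C> h = Src \<C> g \<Longrightarrow> (f \<boxplus> g) \<bullet> h = f \<bullet> h \<boxplus> g \<bullet> h"
  using assms cmp_add_right[of f "Src \<C> g" "Tgt \<C> g" g h "Tgt \<C> h"]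
    cmp_add_left[of h "Src \<C> h" "Src \<C> g" f "Tgt \<C> g" g] by (auto simp: Hom_iff)

lemma add_self_nul:
  assumes "f \<in> Mor \<C>" "f \<boxplus> f = f"
  shows "f = Nul \<C> (Src \<C> f) (Tgt \<C> f)"
  by (rule add_left_cancel[of f]) (use assms in simp_all)

lemma cmp_nul_right [simp]:
  assumes "g \<in> Mor \<C>" "X \<in> Obj \<C>" "Src \<C> g = Y"
  shows "g \<bullet> Nul \<C> X Y = Nul \<C> X (Tgt \<C> g)"
proof -
  have Y: "Y \<in> Obj \<C>" using assms by auto
  have "g \<bullet> (Nul \<C> X Y \<boxplus> Nul \<C> X Y) = g \<bullet> Nul \<C> X Y" using assms Y by (subst add_nul) simp_all
  then have "g \<bullet> Nul \<C> X Y \<boxplus> g \<bullet> Nul \<C> X Y = g \<bullet> Nul \<C> X Y" using assms Y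
    by (subst (asm) cmp_add) simp_all
  from add_self_nul[OF _ this] show ?thesis using assms Y by simp
qed

lemma cmp_nul_left [simp]:
  assumes "f \<in> Mor \<C>" "Z \<in> Obj \<C>" "Tgt \<C> f = Y"
  shows "Nul \<C> Y Z \<bullet> f = Nul \<C> (Src \<C> f) Z"
proof -
  have Y: "Y \<in> Obj \<C>" using assms by auto
  have "(Nul \<C> Y Z \<boxplus> Nul \<C> Y Z) \<bullet> f = Nul \<C> Y Z \<bullet> f" using assms Y by (subst add_nul) simp_all
  then have "Nul \<C> Y Z \<bullet> f \<boxplus> Nul \<C> Y Z \<bullet> f = Nul \<C> Y Z \<bullet> f" using assms Y
    by (subst (asm) cmp_add) simp_all
  from add_self_nul[OF _ this] show ?thesis using assms Y by simp
qed

lemma cmp_neg [simp]: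
  assumes "f \<in> Mor \<C>" "g \<in> Mor \<C>" "Tgt \<C> f = Src \<C> g"
  shows "g \<bullet> neg f = neg (g \<bullet> f)" "neg g \<bullet> f = neg (g \<bullet> f)"
proof -
  have "g \<bullet> (f \<boxplus> neg f) = Nul \<C> (Src \<C> f) (Tgt \<C> g)" using assms by (subst add_neg) simp_all
  then show "g \<bullet> neg f = neg (g \<bullet> f)" using assms by (intro neg_unique) (simp_all del: add_neg)
  have "(g \<boxplus> neg g) \<bullet> f = Nul \<C> (Src \<C> f) (Tgt \<C> g)" using assms by (subst add_neg) simp_all
  then show "neg g \<bullet> f = neg (g \<bullet> f)" using assms by (intro neg_unique) (simp_all del: add_neg)
qed

lemma neg_neg [simp]: "f \<in> Mor \<C> \<Longrightarrow> neg (neg f) = f"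
  by (rule neg_unique[symmetric]) simp_all

lemma neg_nul [simp]: "X \<in> Obj \<C> \<Longrightarrow> Y \<in> Obj \<C> \<Longrightarrow> neg (Nul \<C> X Y) = Nul \<C> X Y"
  by (rule neg_unique[symmetric]) simp_all

lemma neg_add [simp]:
  assumes "f \<in> Mor \<C>" "g \<in> Mor \<C>" "Src \<C> f = Src \<C> g" "Tgt \<C> f = Tgt \<C> g"
  shows "neg (f \<boxplus> g) = neg f \<boxplus> neg g"
  by (rule neg_unique[symmetric]) (use assms in \<open>simp_all add: add_left_comm[of g]\<close>)

lemma zero_object_iff: "zero_object \<C> Z \<longleftrightarrow> Z \<in> Obj \<C> \<and> Idn \<C> Z = Nul \<C> Z Z"
proof
  assume Z: "zero_object \<C> Z"
  then have "Z \<in> Obj \<C>" by (simp add: zero_object_def)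
  with Z have "\<exists>!f. f \<in> Hom \<C> Z Z" by (auto simp: zero_object_def)
  then show "Z \<in> Obj \<C> \<and> Idn \<C> Z = Nul \<C> Z Z" using \<open>Z \<in> Obj \<C>\<close> by (auto simp: Hom_iff)
next
  assume Z: "Z \<in> Obj \<C> \<and> Idn \<C> Z = Nul \<C> Z Z"
  have 1: "f = Nul \<C> X Z" if "f \<in> Hom \<C> X Z" for f X
  proof -
    have "f = Idn \<C> Z \<bullet> f" using that by (simp add: Hom_iff)
    also have "\<dots> = Nul \<C> X Z" unfolding Z[THEN conjunct2] using that Z by (simp add: Hom_iff)
    finally show ?thesis .
  qed
  have 2: "f = Nul \<C> Z X" if "f \<in> Hom \<C> Z X" for f X
  proof -
    have "f = f \<bullet> Idn \<C> Z" using that by (simp add: Hom_iff)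
    also have "\<dots> = Nul \<C> Z X" unfolding Z[THEN conjunct2] using that Z by (auto simp add: Hom_iff)
    finally show ?thesis .
  qed
  show "zero_object \<C> Z"
    unfolding zero_object_def
  proof (intro conjI ballI ex1I)
    show "Z \<in> Obj \<C>" using Z by simp
    fix X assume "X \<in> Obj \<C>"
    then show "Nul \<C> X Z \<in> Hom \<C> X Z" "Nul \<C> Z X \<in> Hom \<C> Z X" using Z by (simp_all add: Hom_iff)
  qed (use 1 2 in blast)+
qed

lemma zero_object_arrow:
  assumes "zero_object \<C> Z" "f \<in> Mor \<C>"
  shows "Src \<C> f = Z \<Longrightarrow> f = Nul \<C> Z (Tgt \<C> f)" "Tgt \<C> f = Z \<Longrightarrow> f = Nul \<C> (Src \<C> f) Z"
proof -
  have Z: "Z \<in> Obj \<C>" using assms by (simp add: zero_object_def)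
  show "Src \<C> f = Z \<Longrightarrow> f = Nul \<C> Z (Tgt \<C> f)"
    using assms(1)[unfolded zero_object_def, THEN conjunct2, rule_format, of "Tgt \<C> f"] assms(2) Z
      nul_arr[of Z "Tgt \<C> f"] by (auto simp: Hom_iff)
  show "Tgt \<C> f = Z \<Longrightarrow> f = Nul \<C> (Src \<C> f) Z"
    using assms(1)[unfolded zero_object_def, THEN conjunct2, rule_format, of "Src \<C> f"] assms(2) Z
      nul_arr[of "Src \<C> f" Z] by (auto simp: Hom_iff)
qed

end

section \<open>Direct sums\<close>

context additive_category
begin

lemma biprodD:
  assumes "biproduct \<C> X Y S i1 i2 p1 p2"
  shows "X \<in> Obj \<C>" "Y \<in> Obj \<C>" "S \<in> Obj \<C>"
    "i1 \<in> Mor \<C>" "Src \<C> i1 = X" "Tgt \<C> i1 = S" "i2 \<in> Mor \<C>" "Src \<C> i2 = Y" "Tgt \<C> i2 = S"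
    "p1 \<in> Mor \<C>" "Src \<C> p1 = S" "Tgt \<C> p1 = X" "p2 \<in> Mor \<C>" "Src \<C> p2 = S" "Tgt \<C> p2 = Y"
    "p1 \<bullet> i1 = Idn \<C> X" "p2 \<bullet> i2 = Idn \<C> Y" "p2 \<bullet> i1 = Nul \<C> X Y" "p1 \<bullet> i2 = Nul \<C> Y X"
    "i1 \<bullet> p1 \<boxplus> i2 \<bullet> p2 = Idn \<C> S"
    "\<forall>f. f \<in> Mor \<C> \<longrightarrow> Tgt \<C> f = X \<longrightarrow> p1 \<bullet> (i1 \<bullet> f) = f"
    "\<forall>f. f \<in> Mor \<C> \<longrightarrow> Tgt \<C> f = Y \<longrightarrow> p2 \<bullet> (i2 \<bullet> f) = f"
    "\<forall>f. f \<in> Mor \<C> \<longrightarrow> Tgt \<C> f = X \<longrightarrow> p2 \<bullet> (i1 \<bullet> f) = Nul \<C> (Src \<C> f) Y"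
    "\<forall>f. f \<in> Mor \<C> \<longrightarrow> Tgt \<C> f = Y \<longrightarrow> p1 \<bullet> (i2 \<bullet> f) = Nul \<C> (Src \<C> f) X"
proof -
  show *: "X \<in> Obj \<C>" "Y \<in> Obj \<C>" "S \<in> Obj \<C>"
    "i1 \<in> Mor \<C>" "Src \<C> i1 = X" "Tgt \<C> i1 = S" "i2 \<in> Mor \<C>" "Src \<C> i2 = Y" "Tgt \<C> i2 = S"
    "p1 \<in> Mor \<C>" "Src \<C> p1 = S" "Tgt \<C> p1 = X" "p2 \<in> Mor \<C>" "Src \<C> p2 = S" "Tgt \<C> p2 = Y"
    "p1 \<bullet> i1 = Idn \<C> X" "p2 \<bullet> i2 = Idn \<C> Y" "p2 \<bullet> i1 = Nul \<C> X Y" "p1 \<bullet> i2 = Nul \<C> Y X"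
    "i1 \<bullet> p1 \<boxplus> i2 \<bullet> p2 = Idn \<C> S"
    using assms by (simp_all add: biproduct_def Hom_iff)
  show "\<forall>f. f \<in> Mor \<C> \<longrightarrow> Tgt \<C> f = X \<longrightarrow> p1 \<bullet> (i1 \<bullet> f) = f"
    "\<forall>f. f \<in> Mor \<C> \<longrightarrow> Tgt \<C> f = Y \<longrightarrow> p2 \<bullet> (i2 \<bullet> f) = f"
    "\<forall>f. f \<in> Mor \<C> \<longrightarrow> Tgt \<C> f = X \<longrightarrow> p2 \<bullet> (i1 \<bullet> f) = Nul \<C> (Src \<C> f) Y"
    "\<forall>f. f \<in> Mor \<C> \<longrightarrow> Tgt \<C> f = Y \<longrightarrow> p1 \<bullet> (i2 \<bullet> f) = Nul \<C> (Src \<C> f) X"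
    using cmp_eq_assoc[OF *(16)] cmp_eq_assoc[OF *(17)] cmp_eq_assoc[OF *(18)] cmp_eq_assoc[OF *(19)] *
    by simp_all
qed

lemma biproductI:
  assumes "X \<in> Obj \<C>" "Y \<in> Obj \<C>" "S \<in> Obj \<C>"
    "i1 \<in> Mor \<C>" "Src \<C> i1 = X" "Tgt \<C> i1 = S" "i2 \<in> Mor \<C>" "Src \<C> i2 = Y" "Tgt \<C> i2 = S"
    "p1 \<in> Mor \<C>" "Src \<C> p1 = S" "Tgt \<C> p1 = X" "p2 \<in> Mor \<C>" "Src \<C> p2 = S" "Tgt \<C> p2 = Y"
    "p1 \<bullet> i1 = Idn \<C> X" "p2 \<bullet> i2 = Idn \<C> Y" "p2 \<bullet> i1 = Nul \<C> X Y" "p1 \<bullet> i2 = Nul \<C> Y X"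
    "i1 \<bullet> p1 \<boxplus> i2 \<bullet> p2 = Idn \<C> S"
  shows "biproduct \<C> X Y S i1 i2 p1 p2"
  using assms by (simp add: biproduct_def Hom_iff)

lemma biprod_into_eqI:
  assumes "biproduct \<C> X Y S i1 i2 p1 p2" "f \<in> Mor \<C>" "g \<in> Mor \<C>" "Src \<C> f = Src \<C> g"
    "Tgt \<C> f = S" "Tgt \<C> g = S" "p1 \<bullet> f = p1 \<bullet> g" "p2 \<bullet> f = p2 \<bullet> g"
  shows "f = g"
proof -
  note B = biprodD[OF assms(1)]
  have "f = (i1 \<bullet> p1 \<boxplus> i2 \<bullet> p2) \<bullet> f" unfolding B using assms by simp
  also have "\<dots> = i1 \<bullet> (p1 \<bullet> f) \<boxplus> i2 \<bullet> (p2 \<bullet> f)" using assms by (simp add: B del: B(20))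
  also have "\<dots> = i1 \<bullet> (p1 \<bullet> g) \<boxplus> i2 \<bullet> (p2 \<bullet> g)" by (simp only: assms(7,8))
  also have "\<dots> = (i1 \<bullet> p1 \<boxplus> i2 \<bullet> p2) \<bullet> g" using assms by (simp add: B del: B(20))
  also have "\<dots> = g" unfolding B using assms by simp
  finally show ?thesis .
qed

lemma biprod_from_eqI:
  assumes "biproduct \<C> X Y S i1 i2 p1 p2" "f \<in> Mor \<C>" "g \<in> Mor \<C>" "Tgt \<C> f = Tgt \<C> g"
    "Src \<C> f = S" "Src \<C> g = S" "f \<bullet> i1 = g \<bullet> i1" "f \<bullet> i2 = g \<bullet> i2"
  shows "f = g"
proof -
  note B = biprodD[OF assms(1)]
  have "f = f \<bullet> (i1 \<bullet> p1 \<boxplus> i2 \<bullet> p2)" unfolding B using assms by simp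
  also have "\<dots> = (f \<bullet> i1) \<bullet> p1 \<boxplus> (f \<bullet> i2) \<bullet> p2" using assms(1-6) by (simp add: B del: B(20))
  also have "\<dots> = (g \<bullet> i1) \<bullet> p1 \<boxplus> (g \<bullet> i2) \<bullet> p2" by (simp only: assms(7,8))
  also have "\<dots> = g \<bullet> (i1 \<bullet> p1 \<boxplus> i2 \<bullet> p2)" using assms(1-6) by (simp add: B del: B(20))
  also have "\<dots> = g" unfolding B using assms by simp
  finally show ?thesis .
qed

lemma biproduct_swap:
  assumes "biproduct \<C> X Y S i1 i2 p1 p2"
  shows "biproduct \<C> Y X S i2 i1 p2 p1"
proof -
  note B = biprodD[OF assms]
  show ?thesis by (rule biproductI) (simp_all add: B add_comm[of "i2 \<bullet> p2"])
qed

lemma biproduct_zero: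
  assumes "zero_object \<C> Z" "X \<in> Obj \<C>"
  shows "biproduct \<C> X Z X (Idn \<C> X) (Nul \<C> Z X) (Idn \<C> X) (Nul \<C> X Z)"
  using assms by (intro biproductI) (simp_all add: zero_object_iff)

lemma biproduct_iso:
  assumes "biproduct \<C> X Y S i1 i2 p1 p2" "inverse_arrows a a'" "Src \<C> a = S"
  shows "biproduct \<C> X Y (Tgt \<C> a) (a \<bullet> i1) (a \<bullet> i2) (p1 \<bullet> a') (p2 \<bullet> a')"
proof -
  note B = biprodD[OF assms(1)] inverse_arrowsD[OF assms(2)] assms(3)
  have "a \<bullet> (i1 \<bullet> p1 \<boxplus> i2 \<bullet> p2) \<bullet> a' = Idn \<C> (Tgt \<C> a)" unfolding B by (simp add: B)
  then show ?thesis by (intro biproductI) (simp_all add: B del: B(20))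
qed

lemma biproduct_iso_left:
  assumes "biproduct \<C> X Y S i1 i2 p1 p2" "inverse_arrows a a'" "Src \<C> a = X"
  shows "biproduct \<C> (Tgt \<C> a) Y S (i1 \<bullet> a') i2 (a \<bullet> p1) p2"
proof -
  note B = biprodD[OF assms(1)] inverse_arrowsD[OF assms(2)] assms(3)
  show ?thesis by (intro biproductI) (simp_all add: B)
qed

lemma biproduct_unique:
  assumes "biproduct \<C> X Y S i1 i2 p1 p2" "biproduct \<C> X Y S' j1 j2 q1 q2"
  shows "inverse_arrows (j1 \<bullet> p1 \<boxplus> j2 \<bullet> p2) (i1 \<bullet> q1 \<boxplus> i2 \<bullet> q2)"
proof -
  note B = biprodD[OF assms(1)] biprodD[OF assms(2)]
  show ?thesis unfolding inverse_arrows_def by (simp add: B Hom_iff)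
qed

text \<open>The isomorphism \<open>(Y \<oplus> Z) \<oplus> Q \<cong> Y \<oplus> (Z \<oplus> Q)\<close>, with its matrices.\<close>

lemma biproduct_assoc:
  assumes "biproduct \<C> S Q V i1 i2 p1 p2" "biproduct \<C> Y Z S j1 j2 q1 q2"
    "biproduct \<C> Z Q W k1 k2 r1 r2"
  shows "biproduct \<C> Y W V (i1 \<bullet> j1) (i1 \<bullet> j2 \<bullet> r1 \<boxplus> i2 \<bullet> r2) (q1 \<bullet> p1) (k1 \<bullet> q2 \<bullet> p1 \<boxplus> k2 \<bullet> p2)"
proof -
  note B = biprodD[OF assms(1)] biprodD[OF assms(2)] biprodD[OF assms(3)]
  have *: "i1 \<bullet> (j1 \<bullet> q1) \<boxplus> i1 \<bullet> (j2 \<bullet> q2) = i1"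
    by (rule biprod_from_eqI[OF assms(2)]) (simp_all add: B)
  have "i1 \<bullet> j1 \<bullet> (q1 \<bullet> p1) \<boxplus> (i1 \<bullet> j2 \<bullet> r1 \<boxplus> i2 \<bullet> r2) \<bullet> (k1 \<bullet> q2 \<bullet> p1 \<boxplus> k2 \<bullet> p2) = Idn \<C> V"
    by (rule biprod_from_eqI[OF assms(1)]) (simp_all add: B *)
  then show ?thesis by (intro biproductI) (simp_all add: B)
qed

text \<open>
  One step of Gaussian elimination: if the component \<open>\<pi> h\<close> of an arrow \<open>h : M \<rightarrow> S = M \<oplus> Y\<close>
  is invertible, then \<open>h\<close> may replace the first inclusion, and \<open>Y\<close> remains a complement.
\<close>

lemma biproduct_gauss:
  assumes "biproduct \<C> M Y S j1 j2 q1 q2" "h \<in> Hom \<C> M' S" "inverse_arrows (q1 \<bullet> h) a"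
  shows "biproduct \<C> M' Y S h j2 (a \<bullet> q1) (q2 \<boxplus> neg (q2 \<bullet> h \<bullet> a \<bullet> q1))"
proof -
  note B = biprodD[OF assms(1)] inverse_arrowsD[OF assms(3)]
  have h: "h \<in> Mor \<C>" "Src \<C> h = M'" "Tgt \<C> h = S" "M' \<in> Obj \<C>"
    using assms(2) hom_obj[OF assms(2)] by (simp_all add: Hom_iff)
  have a: "a \<in> Mor \<C>" "Src \<C> a = M" "Tgt \<C> a = M'" "a \<bullet> (q1 \<bullet> h) = Idn \<C> M'" "q1 \<bullet> (h \<bullet> a) = Idn \<C> M"
    using B(25-30) h by (simp_all add: B(1-24))
  have a': "q1 \<bullet> (h \<bullet> (a \<bullet> f)) = f" if "f \<in> Mor \<C>" "Tgt \<C> f = M" for f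
    using arg_cong[OF a(5), of "\<lambda>x. x \<bullet> f"] that by (simp add: B(1-24) h a(1-3))
  have "h \<bullet> (a \<bullet> q1) \<boxplus> j2 \<bullet> (q2 \<boxplus> neg (q2 \<bullet> h \<bullet> a \<bullet> q1)) = Idn \<C> S"
    by (rule biprod_into_eqI[OF assms(1)]) (simp_all add: B(1-19,21-24) h a(1-3) a' add_left_comm)
  then show ?thesis
    by (intro biproductI) (simp_all add: B(1-19,21-24) h a)
qed

text \<open>
  Both \<open>X\<close> and \<open>Y\<close> are a cokernel of the common inclusion of \<open>M\<close>.
\<close>

lemma biproduct_complement_unique:
  assumes "biproduct \<C> M X S i1 i2 p1 p2" "biproduct \<C> M Y S i1 j2 q1 q2"
  shows "isomorphic X Y"
proof (rule isomorphicI)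
  note B = biprodD[OF assms(1)] biprodD[OF assms(2)]
  have 1: "p2 \<bullet> (j2 \<bullet> q2) = p2"
    by (rule biprod_from_eqI[OF assms(2)]) (simp_all add: B)
  have 2: "q2 \<bullet> (i2 \<bullet> p2) = q2"
    by (rule biprod_from_eqI[OF assms(1)]) (simp_all add: B)
  have "p2 \<bullet> (j2 \<bullet> (q2 \<bullet> i2)) = Idn \<C> X" "q2 \<bullet> (i2 \<bullet> (p2 \<bullet> j2)) = Idn \<C> Y"
    using arg_cong[OF 1, of "\<lambda>x. x \<bullet> i2"] arg_cong[OF 2, of "\<lambda>x. x \<bullet> j2"] by (simp_all add: B)
  then show "inverse_arrows (q2 \<bullet> i2) (p2 \<bullet> j2)"
    by (simp add: inverse_arrows_def Hom_iff B)
qed (use biprodD[OF assms(1)] biprodD[OF assms(2)] in simp_all)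

lemma is_dsumI: "biproduct \<C> X Y S i1 i2 p1 p2 \<Longrightarrow> is_dsum \<C> X Y S"
  by (auto simp: is_dsum_def)

lemma is_dsumE:
  assumes "is_dsum \<C> X Y S"
  obtains i1 i2 p1 p2 where "biproduct \<C> X Y S i1 i2 p1 p2"
  using assms by (auto simp: is_dsum_def)

lemma is_dsum_obj: "is_dsum \<C> X Y S \<Longrightarrow> X \<in> Obj \<C> \<and> Y \<in> Obj \<C> \<and> S \<in> Obj \<C>"
  by (auto simp: is_dsum_def biproduct_def)

text \<open>
  The direct sum as an operation on sets of objects. It is total, commutative and associative,
  and on isomorphism classes it is addition of classes.
\<close>

definition dsum_set (infixl \<open>\<star>\<close> 65) where
  "c \<star> d = {S. \<exists>X\<in>c. \<exists>Y\<in>d. is_dsum \<C> X Y S}"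

lemma is_dsum_comm: "is_dsum \<C> X Y S \<Longrightarrow> is_dsum \<C> Y X S"
  by (elim is_dsumE) (rule is_dsumI, rule biproduct_swap)

lemma dsum_set_comm: "c \<star> d = d \<star> c"
  unfolding dsum_set_def using is_dsum_comm by blast

lemma dsum_set_assoc_subset: "c \<star> d \<star> e \<subseteq> c \<star> (d \<star> e)"
proof
  fix V assume "V \<in> c \<star> d \<star> e"
  then obtain Y Z Q S where *: "Y \<in> c" "Z \<in> d" "Q \<in> e" "is_dsum \<C> Y Z S" "is_dsum \<C> S Q V"
    by (auto simp: dsum_set_def)
  then obtain W where W: "is_dsum \<C> Z Q W" using ex_dsum is_dsum_obj by blast
  with *(4,5) have "is_dsum \<C> Y W V"
    by (elim is_dsumE) (rule is_dsumI, rule biproduct_assoc)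
  with * W show "V \<in> c \<star> (d \<star> e)" by (auto simp: dsum_set_def)
qed

lemma dsum_set_assoc: "c \<star> d \<star> e = c \<star> (d \<star> e)"
proof
  have "c \<star> (d \<star> e) = e \<star> d \<star> c" by (simp only: dsum_set_comm)
  also have "\<dots> \<subseteq> e \<star> (d \<star> c)" by (rule dsum_set_assoc_subset)
  also have "\<dots> = c \<star> d \<star> e" by (simp only: dsum_set_comm)
  finally show "c \<star> (d \<star> e) \<subseteq> c \<star> d \<star> e" .
qed (rule dsum_set_assoc_subset)

lemma dsum_set_left_comm: "c \<star> (d \<star> e) = d \<star> (c \<star> e)"
  by (simp only: dsum_set_assoc[symmetric] dsum_set_comm[of c d])

lemmas dsum_set_ac = dsum_set_assoc dsum_set_comm dsum_set_left_comm

lemma is_dsum_iso: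
  assumes "is_dsum \<C> X Y S" "isomorphic S T"
  shows "is_dsum \<C> X Y T"
proof -
  obtain i1 i2 p1 p2 where "biproduct \<C> X Y S i1 i2 p1 p2" using assms(1) by (rule is_dsumE)
  moreover obtain f g where "inverse_arrows f g" "Src \<C> f = S" "Tgt \<C> f = T"
    using assms(2) by (rule isomorphicE)
  ultimately show ?thesis using is_dsumI[OF biproduct_iso] by blast
qed

lemma is_dsum_iso_left:
  assumes "is_dsum \<C> X Y S" "isomorphic X X'"
  shows "is_dsum \<C> X' Y S"
proof -
  obtain i1 i2 p1 p2 where "biproduct \<C> X Y S i1 i2 p1 p2" using assms(1) by (rule is_dsumE)
  moreover obtain f g where "inverse_arrows f g" "Src \<C> f = X" "Tgt \<C> f = X'"
    using assms(2) by (rule isomorphicE)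
  ultimately show ?thesis using is_dsumI[OF biproduct_iso_left] by blast
qed

lemma is_dsum_unique:
  assumes "is_dsum \<C> X Y S" "is_dsum \<C> X Y T"
  shows "isomorphic S T"
proof -
  obtain i1 i2 p1 p2 j1 j2 q1 q2
    where *: "biproduct \<C> X Y S i1 i2 p1 p2" "biproduct \<C> X Y T j1 j2 q1 q2"
    using assms by (auto simp: is_dsum_def)
  from biproduct_unique[OF *] show ?thesis
    by (rule isomorphicI) (simp_all add: biprodD[OF *(1)] biprodD[OF *(2)])
qed

lemma isoclass_dsum:
  assumes "is_dsum \<C> X Y S"
  shows "isoclass \<C> X \<star> isoclass \<C> Y = isoclass \<C> S"
proof (intro equalityI subsetI)
  fix T assume "T \<in> isoclass \<C> X \<star> isoclass \<C> Y"
  then obtain X' Y' where *: "isomorphic X X'" "isomorphic Y Y'" "is_dsum \<C> X' Y' T"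
    by (auto simp: dsum_set_def mem_isoclass)
  then have "is_dsum \<C> X Y T"
    by (meson is_dsum_comm is_dsum_iso_left isomorphic_sym)
  with assms show "T \<in> isoclass \<C> S" using is_dsum_unique by (simp add: mem_isoclass)
next
  fix T assume "T \<in> isoclass \<C> S"
  then have "is_dsum \<C> X Y T" using assms is_dsum_iso by (simp add: mem_isoclass)
  moreover have "X \<in> isoclass \<C> X" "Y \<in> isoclass \<C> Y"
    using assms is_dsum_obj self_mem_isoclass by blast+
  ultimately show "T \<in> isoclass \<C> X \<star> isoclass \<C> Y" unfolding dsum_set_def by blast
qed

lemma is_dsum_iff:
  assumes "X \<in> Obj \<C>" "Y \<in> Obj \<C>"
  shows "is_dsum \<C> X Y S \<longleftrightarrow> S \<in> Obj \<C> \<and> isoclass \<C> S = isoclass \<C> X \<star> isoclass \<C> Y"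
proof
  assume "is_dsum \<C> X Y S"
  then show "S \<in> Obj \<C> \<and> isoclass \<C> S = isoclass \<C> X \<star> isoclass \<C> Y"
    using isoclass_dsum is_dsum_obj by simp
next
  assume S: "S \<in> Obj \<C> \<and> isoclass \<C> S = isoclass \<C> X \<star> isoclass \<C> Y"
  obtain T where T: "is_dsum \<C> X Y T" using assms ex_dsum by blast
  then have "isoclass \<C> S = isoclass \<C> T" using S isoclass_dsum by simp
  with S have "isomorphic T S" using isoclass_eq isomorphic_sym by blast
  with T show "is_dsum \<C> X Y S" using is_dsum_iso by blast
qed

lemma is_dsum_zero: "zero_object \<C> Z \<Longrightarrow> X \<in> Obj \<C> \<Longrightarrow> is_dsum \<C> X Z X"
  by (rule is_dsumI[OF biproduct_zero])

lemma isoclass_zero: "zero_object \<C> Z \<Longrightarrow> X \<in> Obj \<C> \<Longrightarrow> isoclass \<C> X \<star> isoclass \<C> Z = isoclass \<C> X"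
  using is_dsum_zero isoclass_dsum by blast

definition retract where
  "retract Y X \<longleftrightarrow> (\<exists>i \<in> Hom \<C> Y X. \<exists>p \<in> Hom \<C> X Y. p \<bullet> i = Idn \<C> Y)"

lemma retractI:
  "i \<in> Mor \<C> \<Longrightarrow> p \<in> Mor \<C> \<Longrightarrow> Src \<C> i = Y \<Longrightarrow> Tgt \<C> i = X \<Longrightarrow> Src \<C> p = X \<Longrightarrow> Tgt \<C> p = Y
    \<Longrightarrow> p \<bullet> i = Idn \<C> Y \<Longrightarrow> retract Y X"
  unfolding retract_def by (rule bexI[of _ i], rule bexI[of _ p]) (simp_all add: Hom_iff)

lemma retractE:
  assumes "retract Y X"
  obtains i p where "i \<in> Mor \<C>" "p \<in> Mor \<C>" "Src \<C> i = Y" "Tgt \<C> i = X" "Src \<C> p = X" "Tgt \<C> p = Y"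
    "p \<bullet> i = Idn \<C> Y" "\<forall>f. f \<in> Mor \<C> \<longrightarrow> Tgt \<C> f = Y \<longrightarrow> p \<bullet> (i \<bullet> f) = f" "X \<in> Obj \<C>" "Y \<in> Obj \<C>"
proof -
  obtain i p where *: "i \<in> Hom \<C> Y X" "p \<in> Hom \<C> X Y" "p \<bullet> i = Idn \<C> Y"
    using assms by (auto simp: retract_def)
  note * = *(1,2)[unfolded Hom_iff] *(3) hom_obj[OF *(1)]
  show ?thesis by (rule that[of i p]) (use * cmp_eq_assoc[OF *(3)] in simp_all)
qed

lemma retract_trans: "retract Z Y \<Longrightarrow> retract Y X \<Longrightarrow> retract Z X"
proof (elim retractE)
  fix i p j q
  assume *: "i \<in> Mor \<C>" "p \<in> Mor \<C>" "Src \<C> i = Z" "Tgt \<C> i = Y" "Src \<C> p = Y" "Tgt \<C> p = Z"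
    "p \<bullet> i = Idn \<C> Z" "j \<in> Mor \<C>" "q \<in> Mor \<C>" "Src \<C> j = Y" "Tgt \<C> j = X" "Src \<C> q = X" "Tgt \<C> q = Y"
    "\<forall>f. f \<in> Mor \<C> \<longrightarrow> Tgt \<C> f = Y \<longrightarrow> q \<bullet> (j \<bullet> f) = f"
  show "retract Z X" by (rule retractI[of "j \<bullet> i" "p \<bullet> q"]) (simp_all add: *)
qed

lemma dsum_retract:
  assumes "is_dsum \<C> X Y S"
  shows "retract X S" "retract Y S"
proof -
  obtain i1 i2 p1 p2 where "biproduct \<C> X Y S i1 i2 p1 p2" using assms by (rule is_dsumE)
  note B = biprodD[OF this]
  show "retract X S" by (rule retractI[of i1 p1]) (simp_all add: B)
  show "retract Y S" by (rule retractI[of i2 p2]) (simp_all add: B)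
qed


end

section \<open>Exact sequences\<close>

context additive_category
begin

lemma is_kernelD:
  assumes "is_kernel \<C> f g"
  shows "f \<in> Mor \<C>" "g \<in> Mor \<C>" "Tgt \<C> f = Src \<C> g" "g \<bullet> f = Nul \<C> (Src \<C> f) (Tgt \<C> g)"
    "\<forall>h. h \<in> Mor \<C> \<longrightarrow> Tgt \<C> h = Src \<C> f \<longrightarrow> g \<bullet> (f \<bullet> h) = Nul \<C> (Src \<C> h) (Tgt \<C> g)"
proof -
  show *: "f \<in> Mor \<C>" "g \<in> Mor \<C>" "Tgt \<C> f = Src \<C> g" "g \<bullet> f = Nul \<C> (Src \<C> f) (Tgt \<C> g)"
    using assms by (simp_all add: is_kernel_def)
  show "\<forall>h. h \<in> Mor \<C> \<longrightarrow> Tgt \<C> h = Src \<C> f \<longrightarrow> g \<bullet> (f \<bullet> h) = Nul \<C> (Src \<C> h) (Tgt \<C> g)"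
    using cmp_eq_assoc[OF *(4)] * by simp
qed

lemma kernel_lift:
  assumes "is_kernel \<C> f g" "h \<in> Mor \<C>" "Tgt \<C> h = Src \<C> g" "g \<bullet> h = Nul \<C> (Src \<C> h) (Tgt \<C> g)"
  obtains u where "u \<in> Mor \<C>" "Src \<C> u = Src \<C> h" "Tgt \<C> u = Src \<C> f" "f \<bullet> u = h"
  using assms unfolding is_kernel_def Hom_iff by blast

lemma kernel_monic:
  assumes "is_kernel \<C> f g" "u \<in> Mor \<C>" "v \<in> Mor \<C>" "Src \<C> u = Src \<C> v" "Tgt \<C> u = Src \<C> f"
    "Tgt \<C> v = Src \<C> f" "f \<bullet> u = f \<bullet> v"
  shows "u = v"
proof -
  note K = is_kernelD[OF assms(1)]
  have "f \<bullet> v \<in> Mor \<C>" "Tgt \<C> (f \<bullet> v) = Src \<C> g" "g \<bullet> (f \<bullet> v) = Nul \<C> (Src \<C> (f \<bullet> v)) (Tgt \<C> g)"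
    "Src \<C> (f \<bullet> v) = Src \<C> v"
    using assms(2-6) K by simp_all
  then have "\<exists>!w. w \<in> Hom \<C> (Src \<C> v) (Src \<C> f) \<and> f \<bullet> w = f \<bullet> v"
    using assms(1) unfolding is_kernel_def by metis
  then show ?thesis using assms(2-) unfolding Hom_iff by blast
qed

lemma is_kernelI:
  assumes "f \<in> Mor \<C>" "g \<in> Mor \<C>" "Tgt \<C> f = Src \<C> g" "g \<bullet> f = Nul \<C> (Src \<C> f) (Tgt \<C> g)"
    and "\<And>h. h \<in> Mor \<C> \<Longrightarrow> Tgt \<C> h = Src \<C> g \<Longrightarrow> g \<bullet> h = Nul \<C> (Src \<C> h) (Tgt \<C> g)
      \<Longrightarrow> \<exists>u. u \<in> Mor \<C> \<and> Src \<C> u = Src \<C> h \<and> Tgt \<C> u = Src \<C> f \<and> f \<bullet> u = h"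
    and "\<And>u v. u \<in> Mor \<C> \<Longrightarrow> v \<in> Mor \<C> \<Longrightarrow> Src \<C> u = Src \<C> v \<Longrightarrow> Tgt \<C> u = Src \<C> f
      \<Longrightarrow> Tgt \<C> v = Src \<C> f \<Longrightarrow> f \<bullet> u = f \<bullet> v \<Longrightarrow> u = v"
  shows "is_kernel \<C> f g"
  unfolding is_kernel_def
proof (intro conjI ballI impI, goal_cases)
  case (5 h)
  then obtain u where u: "u \<in> Mor \<C>" "Src \<C> u = Src \<C> h" "Tgt \<C> u = Src \<C> f" "f \<bullet> u = h"
    using assms(5) by blast
  show ?case
  proof (rule ex1I[of _ u])
    show "u \<in> Hom \<C> (Src \<C> h) (Src \<C> f) \<and> f \<bullet> u = h" using u by (simp add: Hom_iff)
  next
    fix v assume "v \<in> Hom \<C> (Src \<C> h) (Src \<C> f) \<and> f \<bullet> v = h"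
    then show "v = u" using u assms(6)[of v u] by (simp add: Hom_iff)
  qed
qed (use assms in auto)

lemma is_cokernelD:
  assumes "is_cokernel \<C> g f"
  shows "f \<in> Mor \<C>" "g \<in> Mor \<C>" "Tgt \<C> f = Src \<C> g" "g \<bullet> f = Nul \<C> (Src \<C> f) (Tgt \<C> g)"
    "\<forall>h. h \<in> Mor \<C> \<longrightarrow> Tgt \<C> h = Src \<C> f \<longrightarrow> g \<bullet> (f \<bullet> h) = Nul \<C> (Src \<C> h) (Tgt \<C> g)"
proof -
  show *: "f \<in> Mor \<C>" "g \<in> Mor \<C>" "Tgt \<C> f = Src \<C> g" "g \<bullet> f = Nul \<C> (Src \<C> f) (Tgt \<C> g)"
    using assms by (simp_all add: is_cokernel_def)
  show "\<forall>h. h \<in> Mor \<C> \<longrightarrow> Tgt \<C> h = Src \<C> f \<longrightarrow> g \<bullet> (f \<bullet> h) = Nul \<C> (Src \<C> h) (Tgt \<C> g)"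
    using cmp_eq_assoc[OF *(4)] * by simp
qed

lemma cokernel_lift:
  assumes "is_cokernel \<C> g f" "h \<in> Mor \<C>" "Src \<C> h = Src \<C> g" "h \<bullet> f = Nul \<C> (Src \<C> f) (Tgt \<C> h)"
  obtains u where "u \<in> Mor \<C>" "Src \<C> u = Tgt \<C> g" "Tgt \<C> u = Tgt \<C> h" "u \<bullet> g = h"
  using assms is_cokernelD(3)[OF assms(1)] unfolding is_cokernel_def Hom_iff by metis

lemma cokernel_epic:
  assumes "is_cokernel \<C> g f" "u \<in> Mor \<C>" "v \<in> Mor \<C>" "Tgt \<C> u = Tgt \<C> v" "Src \<C> u = Tgt \<C> g"
    "Src \<C> v = Tgt \<C> g" "u \<bullet> g = v \<bullet> g"
  shows "u = v"
proof -
  note K = is_cokernelD[OF assms(1)]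
  have "v \<bullet> g \<in> Mor \<C>" "Src \<C> (v \<bullet> g) = Tgt \<C> f" "v \<bullet> g \<bullet> f = Nul \<C> (Src \<C> f) (Tgt \<C> (v \<bullet> g))"
    "Tgt \<C> (v \<bullet> g) = Tgt \<C> v"
    using assms(2-6) K by simp_all
  then have "\<exists>!w. w \<in> Hom \<C> (Tgt \<C> g) (Tgt \<C> v) \<and> w \<bullet> g = v \<bullet> g"
    using assms(1) unfolding is_cokernel_def by metis
  then show ?thesis using assms(2-) unfolding Hom_iff by blast
qed

lemma is_cokernelI:
  assumes "f \<in> Mor \<C>" "g \<in> Mor \<C>" "Tgt \<C> f = Src \<C> g" "g \<bullet> f = Nul \<C> (Src \<C> f) (Tgt \<C> g)"
    and "\<And>h. h \<in> Mor \<C> \<Longrightarrow> Src \<C> h = Src \<C> g \<Longrightarrow> h \<bullet> f = Nul \<C> (Src \<C> f) (Tgt \<C> h)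
      \<Longrightarrow> \<exists>u. u \<in> Mor \<C> \<and> Src \<C> u = Tgt \<C> g \<and> Tgt \<C> u = Tgt \<C> h \<and> u \<bullet> g = h"
    and "\<And>u v. u \<in> Mor \<C> \<Longrightarrow> v \<in> Mor \<C> \<Longrightarrow> Tgt \<C> u = Tgt \<C> v \<Longrightarrow> Src \<C> u = Tgt \<C> g
      \<Longrightarrow> Src \<C> v = Tgt \<C> g \<Longrightarrow> u \<bullet> g = v \<bullet> g \<Longrightarrow> u = v"
  shows "is_cokernel \<C> g f"
  unfolding is_cokernel_def
proof (intro conjI ballI impI, goal_cases)
  case (5 h)
  then obtain u where u: "u \<in> Mor \<C>" "Src \<C> u = Tgt \<C> g" "Tgt \<C> u = Tgt \<C> h" "u \<bullet> g = h"
    using assms(3) assms(5)[of h] by auto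
  show ?case
  proof (rule ex1I[of _ u])
    show "u \<in> Hom \<C> (Tgt \<C> g) (Tgt \<C> h) \<and> u \<bullet> g = h" using u by (simp add: Hom_iff)
  next
    fix v assume "v \<in> Hom \<C> (Tgt \<C> g) (Tgt \<C> h) \<and> v \<bullet> g = h"
    then show "v = u" using u assms(6)[of v u] by (simp add: Hom_iff)
  qed
qed (use assms in auto)

lemma is_pullbackD:
  assumes "is_pullback \<C> g' b c g"
  shows "g' \<in> Mor \<C>" "b \<in> Mor \<C>" "c \<in> Mor \<C>" "g \<in> Mor \<C>" "Src \<C> b = Src \<C> g'"
    "Tgt \<C> g' = Src \<C> c" "Tgt \<C> b = Src \<C> g" "Tgt \<C> c = Tgt \<C> g" "c \<bullet> g' = g \<bullet> b"
    "\<forall>h. h \<in> Mor \<C> \<longrightarrow> Tgt \<C> h = Src \<C> g' \<longrightarrow> c \<bullet> (g' \<bullet> h) = g \<bullet> (b \<bullet> h)"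
proof -
  show *: "g' \<in> Mor \<C>" "b \<in> Mor \<C>" "c \<in> Mor \<C>" "g \<in> Mor \<C>" "Src \<C> b = Src \<C> g'"
    "Tgt \<C> g' = Src \<C> c" "Tgt \<C> b = Src \<C> g" "Tgt \<C> c = Tgt \<C> g" "c \<bullet> g' = g \<bullet> b"
    using assms by (simp_all add: is_pullback_def comm_square_def)
  show "\<forall>h. h \<in> Mor \<C> \<longrightarrow> Tgt \<C> h = Src \<C> g' \<longrightarrow> c \<bullet> (g' \<bullet> h) = g \<bullet> (b \<bullet> h)"
    using cmp_eq_assoc[OF *(9)] * by simp
qed

lemma pullback_lift:
  assumes "is_pullback \<C> g' b c g" "u \<in> Mor \<C>" "v \<in> Mor \<C>" "Src \<C> u = Src \<C> v"
    "Tgt \<C> u = Src \<C> c" "Tgt \<C> v = Src \<C> g" "c \<bullet> u = g \<bullet> v"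
  obtains w where "w \<in> Mor \<C>" "Src \<C> w = Src \<C> v" "Tgt \<C> w = Src \<C> g'" "g' \<bullet> w = u" "b \<bullet> w = v"
proof -
  have "comm_square \<C> u v c g" using assms is_pullbackD[OF assms(1)] by (simp add: comm_square_def)
  then have "\<exists>w. w \<in> Hom \<C> (Src \<C> u) (Src \<C> g') \<and> g' \<bullet> w = u \<and> b \<bullet> w = v"
    using assms(1) unfolding is_pullback_def by blast
  then show thesis using that assms(4) by (auto simp: Hom_iff)
qed

lemma pullback_eqI:
  assumes "is_pullback \<C> g' b c g" "w \<in> Mor \<C>" "w' \<in> Mor \<C>" "Src \<C> w = Src \<C> w'"
    "Tgt \<C> w = Src \<C> g'" "Tgt \<C> w' = Src \<C> g'" "g' \<bullet> w = g' \<bullet> w'" "b \<bullet> w = b \<bullet> w'"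
  shows "w = w'"
proof -
  note P = is_pullbackD[OF assms(1)]
  have "comm_square \<C> (g' \<bullet> w') (b \<bullet> w') c g" using assms(2-6) P by (simp add: comm_square_def)
  then have "\<exists>!w. w \<in> Hom \<C> (Src \<C> (g' \<bullet> w')) (Src \<C> g') \<and> g' \<bullet> w = g' \<bullet> w' \<and> b \<bullet> w = b \<bullet> w'"
    using assms(1) unfolding is_pullback_def by blast
  moreover have "Src \<C> (g' \<bullet> w') = Src \<C> w'" using assms(2-6) P by simp
  ultimately show ?thesis using assms(2-) unfolding Hom_iff by metis
qed

lemma is_pullbackI:
  assumes "g' \<in> Mor \<C>" "b \<in> Mor \<C>" "c \<in> Mor \<C>" "g \<in> Mor \<C>" "Src \<C> b = Src \<C> g'"
    "Tgt \<C> g' = Src \<C> c" "Tgt \<C> b = Src \<C> g" "Tgt \<C> c = Tgt \<C> g" "c \<bullet> g' = g \<bullet> b"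
    and "\<And>u v. u \<in> Mor \<C> \<Longrightarrow> v \<in> Mor \<C> \<Longrightarrow> Src \<C> u = Src \<C> v \<Longrightarrow> Tgt \<C> u = Src \<C> c
      \<Longrightarrow> Tgt \<C> v = Src \<C> g \<Longrightarrow> c \<bullet> u = g \<bullet> v
      \<Longrightarrow> \<exists>w. w \<in> Mor \<C> \<and> Src \<C> w = Src \<C> v \<and> Tgt \<C> w = Src \<C> g' \<and> g' \<bullet> w = u \<and> b \<bullet> w = v"
    and "\<And>w w'. w \<in> Mor \<C> \<Longrightarrow> w' \<in> Mor \<C> \<Longrightarrow> Src \<C> w = Src \<C> w' \<Longrightarrow> Tgt \<C> w = Src \<C> g'
      \<Longrightarrow> Tgt \<C> w' = Src \<C> g' \<Longrightarrow> g' \<bullet> w = g' \<bullet> w' \<Longrightarrow> b \<bullet> w = b \<bullet> w' \<Longrightarrow> w = w'"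
  shows "is_pullback \<C> g' b c g"
  unfolding is_pullback_def
proof (intro conjI allI impI)
  show "comm_square \<C> g' b c g" using assms(1-9) by (simp add: comm_square_def)
  fix u v assume uv: "comm_square \<C> u v c g"
  then obtain w where w: "w \<in> Mor \<C>" "Src \<C> w = Src \<C> v" "Tgt \<C> w = Src \<C> g'" "g' \<bullet> w = u" "b \<bullet> w = v"
    using assms(10)[of u v] unfolding comm_square_def by blast
  show "\<exists>!w. w \<in> Hom \<C> (Src \<C> u) (Src \<C> g') \<and> g' \<bullet> w = u \<and> b \<bullet> w = v"
  proof (rule ex1I[of _ w])
    show "w \<in> Hom \<C> (Src \<C> u) (Src \<C> g') \<and> g' \<bullet> w = u \<and> b \<bullet> w = v"
      using w uv by (simp add: Hom_iff comm_square_def)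
  next
    fix w' assume "w' \<in> Hom \<C> (Src \<C> u) (Src \<C> g') \<and> g' \<bullet> w' = u \<and> b \<bullet> w' = v"
    then show "w' = w" using w uv assms(11)[of w' w] by (simp add: Hom_iff comm_square_def)
  qed
qed

lemma is_pullback_swap:
  assumes "is_pullback \<C> g' b c g"
  shows "is_pullback \<C> b g' g c"
proof -
  note P = is_pullbackD[OF assms]
  show ?thesis
  proof (rule is_pullbackI)
    fix u v assume *: "u \<in> Mor \<C>" "v \<in> Mor \<C>" "Src \<C> u = Src \<C> v" "Tgt \<C> u = Src \<C> g"
      "Tgt \<C> v = Src \<C> c" "g \<bullet> u = c \<bullet> v"
    obtain w where "w \<in> Mor \<C>" "Src \<C> w = Src \<C> u" "Tgt \<C> w = Src \<C> g'" "g' \<bullet> w = v" "b \<bullet> w = u"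
      by (rule pullback_lift[OF assms *(2,1) *(3)[symmetric] *(5,4) *(6)[symmetric]])
    then show "\<exists>w. w \<in> Mor \<C> \<and> Src \<C> w = Src \<C> v \<and> Tgt \<C> w = Src \<C> b \<and> b \<bullet> w = u \<and> g' \<bullet> w = v"
      using *(3) P by auto
  next
    fix w w' assume *: "w \<in> Mor \<C>" "w' \<in> Mor \<C>" "Src \<C> w = Src \<C> w'" "Tgt \<C> w = Src \<C> b"
      "Tgt \<C> w' = Src \<C> b" "b \<bullet> w = b \<bullet> w'" "g' \<bullet> w = g' \<bullet> w'"
    show "w = w'" by (rule pullback_eqI[OF assms *(1-3)]) (use * P in simp_all)
  qed (use P in simp_all)
qed

lemma is_pushoutD:
  assumes "is_pushout \<C> f a b f'"
  shows "f \<in> Mor \<C>" "a \<in> Mor \<C>" "b \<in> Mor \<C>" "f' \<in> Mor \<C>" "Src \<C> a = Src \<C> f"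
    "Src \<C> b = Tgt \<C> f" "Src \<C> f' = Tgt \<C> a" "Tgt \<C> b = Tgt \<C> f'" "b \<bullet> f = f' \<bullet> a"
    "\<forall>h. h \<in> Mor \<C> \<longrightarrow> Tgt \<C> h = Src \<C> f \<longrightarrow> b \<bullet> (f \<bullet> h) = f' \<bullet> (a \<bullet> h)"
proof -
  show *: "f \<in> Mor \<C>" "a \<in> Mor \<C>" "b \<in> Mor \<C>" "f' \<in> Mor \<C>" "Src \<C> a = Src \<C> f"
    "Src \<C> b = Tgt \<C> f" "Src \<C> f' = Tgt \<C> a" "Tgt \<C> b = Tgt \<C> f'" "b \<bullet> f = f' \<bullet> a"
    using assms by (simp_all add: is_pushout_def comm_square_def)
  show "\<forall>h. h \<in> Mor \<C> \<longrightarrow> Tgt \<C> h = Src \<C> f \<longrightarrow> b \<bullet> (f \<bullet> h) = f' \<bullet> (a \<bullet> h)"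
    using cmp_eq_assoc[OF *(9)] * by simp
qed

lemma pushout_lift:
  assumes "is_pushout \<C> f a b f'" "u \<in> Mor \<C>" "v \<in> Mor \<C>" "Tgt \<C> u = Tgt \<C> v"
    "Src \<C> u = Tgt \<C> f" "Src \<C> v = Tgt \<C> a" "u \<bullet> f = v \<bullet> a"
  obtains w where "w \<in> Mor \<C>" "Src \<C> w = Tgt \<C> f'" "Tgt \<C> w = Tgt \<C> v" "w \<bullet> b = u" "w \<bullet> f' = v"
proof -
  note P = is_pushoutD[OF assms(1)]
  have "comm_square \<C> f a u v" using assms P by (simp add: comm_square_def)
  then have "\<exists>w. w \<in> Hom \<C> (Tgt \<C> b) (Tgt \<C> u) \<and> w \<bullet> b = u \<and> w \<bullet> f' = v"
    using assms(1) unfolding is_pushout_def by blast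
  then show thesis using that assms(4) P(8) by (auto simp: Hom_iff)
qed

lemma pushout_eqI:
  assumes "is_pushout \<C> f a b f'" "w \<in> Mor \<C>" "w' \<in> Mor \<C>" "Tgt \<C> w = Tgt \<C> w'"
    "Src \<C> w = Tgt \<C> f'" "Src \<C> w' = Tgt \<C> f'" "w \<bullet> b = w' \<bullet> b" "w \<bullet> f' = w' \<bullet> f'"
  shows "w = w'"
proof -
  note P = is_pushoutD[OF assms(1)]
  have "comm_square \<C> f a (w' \<bullet> b) (w' \<bullet> f')" using assms(2-6) P by (simp add: comm_square_def)
  then have "\<exists>!w. w \<in> Hom \<C> (Tgt \<C> b) (Tgt \<C> (w' \<bullet> b)) \<and> w \<bullet> b = w' \<bullet> b \<and> w \<bullet> f' = w' \<bullet> f'"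
    using assms(1) unfolding is_pushout_def by blast
  moreover have "Tgt \<C> (w' \<bullet> b) = Tgt \<C> w'" using assms(2-6) P by simp
  ultimately show ?thesis using assms(2-) P(8) unfolding Hom_iff by metis
qed

lemma is_pushoutI:
  assumes "f \<in> Mor \<C>" "a \<in> Mor \<C>" "b \<in> Mor \<C>" "f' \<in> Mor \<C>" "Src \<C> a = Src \<C> f"
    "Src \<C> b = Tgt \<C> f" "Src \<C> f' = Tgt \<C> a" "Tgt \<C> b = Tgt \<C> f'" "b \<bullet> f = f' \<bullet> a"
    and "\<And>u v. u \<in> Mor \<C> \<Longrightarrow> v \<in> Mor \<C> \<Longrightarrow> Tgt \<C> u = Tgt \<C> v \<Longrightarrow> Src \<C> u = Tgt \<C> f
      \<Longrightarrow> Src \<C> v = Tgt \<C> a \<Longrightarrow> u \<bullet> f = v \<bullet> a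
      \<Longrightarrow> \<exists>w. w \<in> Mor \<C> \<and> Src \<C> w = Tgt \<C> f' \<and> Tgt \<C> w = Tgt \<C> v \<and> w \<bullet> b = u \<and> w \<bullet> f' = v"
    and "\<And>w w'. w \<in> Mor \<C> \<Longrightarrow> w' \<in> Mor \<C> \<Longrightarrow> Tgt \<C> w = Tgt \<C> w' \<Longrightarrow> Src \<C> w = Tgt \<C> f'
      \<Longrightarrow> Src \<C> w' = Tgt \<C> f' \<Longrightarrow> w \<bullet> b = w' \<bullet> b \<Longrightarrow> w \<bullet> f' = w' \<bullet> f' \<Longrightarrow> w = w'"
  shows "is_pushout \<C> f a b f'"
  unfolding is_pushout_def
proof (intro conjI allI impI)
  show "comm_square \<C> f a b f'" using assms(1-9) by (simp add: comm_square_def)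
  fix u v assume uv: "comm_square \<C> f a u v"
  then obtain w where w: "w \<in> Mor \<C>" "Src \<C> w = Tgt \<C> f'" "Tgt \<C> w = Tgt \<C> v" "w \<bullet> b = u" "w \<bullet> f' = v"
    using assms(10)[of u v] unfolding comm_square_def by metis
  show "\<exists>!w. w \<in> Hom \<C> (Tgt \<C> b) (Tgt \<C> u) \<and> w \<bullet> b = u \<and> w \<bullet> f' = v"
  proof (rule ex1I[of _ w])
    show "w \<in> Hom \<C> (Tgt \<C> b) (Tgt \<C> u) \<and> w \<bullet> b = u \<and> w \<bullet> f' = v"
      using w uv assms(8) by (simp add: Hom_iff comm_square_def)
  next
    fix w' assume "w' \<in> Hom \<C> (Tgt \<C> b) (Tgt \<C> u) \<and> w' \<bullet> b = u \<and> w' \<bullet> f' = v"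
    then show "w' = w" using w uv assms(8) assms(11)[of w' w] by (simp add: Hom_iff comm_square_def)
  qed
qed

text \<open>The kernel of a composite \<open>e t\<close> is the preimage of the kernel of \<open>e\<close> under \<open>t\<close>.\<close>

lemma kernel_cmp:
  assumes "is_pullback \<C> t' b k t" "is_kernel \<C> k e"
  shows "is_kernel \<C> b (e \<bullet> t)"
proof -
  note P = is_pullbackD[OF assms(1)] and K = is_kernelD[OF assms(2)]
  have tb': "t \<bullet> (b \<bullet> h) = k \<bullet> (t' \<bullet> h)" if "h \<in> Mor \<C>" "Tgt \<C> h = Src \<C> t'" for h
    using P(10) that by simp
  have Pt: "t \<in> Mor \<C>" "Tgt \<C> t = Src \<C> e" using P(4,8) K(3) by simp_all
  show ?thesis
  proof (rule is_kernelI)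
    have "e \<bullet> t \<bullet> b = e \<bullet> (k \<bullet> t')" using P(1-8) K(1-3) Pt by (simp add: P(9))
    also have "\<dots> = Nul \<C> (Src \<C> b) (Tgt \<C> (e \<bullet> t))" using P(1-8) K Pt by simp
    finally show "e \<bullet> t \<bullet> b = Nul \<C> (Src \<C> b) (Tgt \<C> (e \<bullet> t))" .
  next
    fix h assume h: "h \<in> Mor \<C>" "Tgt \<C> h = Src \<C> (e \<bullet> t)" "e \<bullet> t \<bullet> h = Nul \<C> (Src \<C> h) (Tgt \<C> (e \<bullet> t))"
    then have h': "Tgt \<C> h = Src \<C> t" "e \<bullet> (t \<bullet> h) = Nul \<C> (Src \<C> h) (Tgt \<C> e)"
      using Pt K(2) by simp_all
    obtain u where u: "u \<in> Mor \<C>" "Src \<C> u = Src \<C> (t \<bullet> h)" "Tgt \<C> u = Src \<C> k" "k \<bullet> u = t \<bullet> h"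
      by (rule kernel_lift[OF assms(2), of "t \<bullet> h"]) (use h h' Pt in simp_all)
    obtain w where "w \<in> Mor \<C>" "Src \<C> w = Src \<C> h" "Tgt \<C> w = Src \<C> t'" "t' \<bullet> w = u" "b \<bullet> w = h"
      by (rule pullback_lift[OF assms(1), of u h]) (use u h h' P in simp_all)
    then show "\<exists>u. u \<in> Mor \<C> \<and> Src \<C> u = Src \<C> h \<and> Tgt \<C> u = Src \<C> b \<and> b \<bullet> u = h"
      using P(5) by auto
  next
    fix u v assume *: "u \<in> Mor \<C>" "v \<in> Mor \<C>" "Src \<C> u = Src \<C> v" "Tgt \<C> u = Src \<C> b"
      "Tgt \<C> v = Src \<C> b" "b \<bullet> u = b \<bullet> v"
    have "k \<bullet> (t' \<bullet> u) = t \<bullet> (b \<bullet> u)" using *(1-5) P(5) by (simp add: tb')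
    also have "\<dots> = t \<bullet> (b \<bullet> v)" by (simp only: *(6))
    also have "\<dots> = k \<bullet> (t' \<bullet> v)" using *(1-5) P(5) by (simp add: tb')
    finally have eq: "k \<bullet> (t' \<bullet> u) = k \<bullet> (t' \<bullet> v)" .
    have eq': "t' \<bullet> u = t' \<bullet> v"
      by (rule kernel_monic[OF assms(2) _ _ _ _ _ eq]) (use *(1-5) P(1-8) in simp_all)
    show "u = v" by (rule pullback_eqI[OF assms(1) _ _ _ _ _ eq' *(6)]) (use *(1-5) P(1-8) in simp_all)
  qed (use P(1-8) K(1-3) in simp_all)
qed

lemma cokernel_cmp:
  assumes "is_pushout \<C> m e b m'" "is_cokernel \<C> e m1"
  shows "is_cokernel \<C> b (m \<bullet> m1)"
proof -
  note P = is_pushoutD[OF assms(1)] and K = is_cokernelD[OF assms(2)]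
  have Pm: "Src \<C> m = Tgt \<C> m1" "Src \<C> e = Tgt \<C> m1" using P(5) K(3) by simp_all
  note T = P(1-4) P(6-8) Pm K(1)
  show ?thesis
  proof (rule is_cokernelI)
    have "b \<bullet> (m \<bullet> m1) = m' \<bullet> (e \<bullet> m1)" using P(10) T by simp
    also have "\<dots> = Nul \<C> (Src \<C> (m \<bullet> m1)) (Tgt \<C> b)" unfolding K(4) using T by simp
    finally show "b \<bullet> (m \<bullet> m1) = Nul \<C> (Src \<C> (m \<bullet> m1)) (Tgt \<C> b)" .
  next
    fix h assume h: "h \<in> Mor \<C>" "Src \<C> h = Src \<C> b" "h \<bullet> (m \<bullet> m1) = Nul \<C> (Src \<C> (m \<bullet> m1)) (Tgt \<C> h)"
    obtain u where u: "u \<in> Mor \<C>" "Src \<C> u = Tgt \<C> e" "Tgt \<C> u = Tgt \<C> (h \<bullet> m)" "u \<bullet> e = h \<bullet> m"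
      by (rule cokernel_lift[OF assms(2), of "h \<bullet> m"]) (use h T in simp_all)
    obtain w where "w \<in> Mor \<C>" "Src \<C> w = Tgt \<C> m'" "Tgt \<C> w = Tgt \<C> u" "w \<bullet> b = h" "w \<bullet> m' = u"
      by (rule pushout_lift[OF assms(1), of h u]) (use u h T in simp_all)
    then show "\<exists>u. u \<in> Mor \<C> \<and> Src \<C> u = Tgt \<C> b \<and> Tgt \<C> u = Tgt \<C> h \<and> u \<bullet> b = h"
      using T u h by auto
  next
    fix u v assume *: "u \<in> Mor \<C>" "v \<in> Mor \<C>" "Tgt \<C> u = Tgt \<C> v" "Src \<C> u = Tgt \<C> b"
      "Src \<C> v = Tgt \<C> b" "u \<bullet> b = v \<bullet> b"
    have "(u \<bullet> m') \<bullet> e = u \<bullet> (b \<bullet> m)" using *(1-5) T P(9) by simp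
    also have "\<dots> = (u \<bullet> b) \<bullet> m" using *(1-5) T by simp
    also have "\<dots> = (v \<bullet> b) \<bullet> m" by (simp only: *(6))
    also have "\<dots> = v \<bullet> (b \<bullet> m)" using *(1-5) T by simp
    also have "\<dots> = (v \<bullet> m') \<bullet> e" using *(1-5) T P(9) by simp
    finally have eq: "(u \<bullet> m') \<bullet> e = (v \<bullet> m') \<bullet> e" .
    have eq': "u \<bullet> m' = v \<bullet> m'"
      by (rule cokernel_epic[OF assms(2) _ _ _ _ _ eq]) (use *(1-5) T in simp_all)
    show "u = v" by (rule pushout_eqI[OF assms(1) _ _ _ _ _ *(6) eq']) (use *(1-5) T in simp_all)
  qed (use T in simp_all)
qed

end

context exact_category
begin

lemma exact_kernel: "(f, g) \<in> \<E> \<Longrightarrow> is_kernel \<C> f g"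
  and exact_cokernel: "(f, g) \<in> \<E> \<Longrightarrow> is_cokernel \<C> g f"
  using kernel_cokernel by blast+

lemmas exactD = is_kernelD[OF exact_kernel]

lemma exact_replace_kernel:
  assumes "(f, g) \<in> \<E>" "is_kernel \<C> f' g"
  shows "(f', g) \<in> \<E>"
proof -
  note K = exactD[OF assms(1)] and K' = is_kernelD[OF assms(2)]
  obtain u where u: "u \<in> Mor \<C>" "Src \<C> u = Src \<C> f" "Tgt \<C> u = Src \<C> f'" "f' \<bullet> u = f"
    by (rule kernel_lift[OF assms(2), of f]) (use K in simp_all)
  obtain v where v: "v \<in> Mor \<C>" "Src \<C> v = Src \<C> f'" "Tgt \<C> v = Src \<C> f" "f \<bullet> v = f'"
    by (rule kernel_lift[OF exact_kernel[OF assms(1)], of f']) (use K' in simp_all)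
  have fv: "f \<bullet> (v \<bullet> h) = f' \<bullet> h" if "h \<in> Mor \<C>" "Tgt \<C> h = Src \<C> f'" for h
    using arg_cong[OF v(4), of "\<lambda>x. x \<bullet> h"] v(1-3) K(1) that by simp
  have fu: "f' \<bullet> (u \<bullet> h) = f \<bullet> h" if "h \<in> Mor \<C>" "Tgt \<C> h = Src \<C> f" for h
    using arg_cong[OF u(4), of "\<lambda>x. x \<bullet> h"] u(1-3) K'(1) that by simp
  have "v \<bullet> u = Idn \<C> (Src \<C> f)"
    by (rule kernel_monic[OF exact_kernel[OF assms(1)]]) (use K u v fv in simp_all)
  moreover have "u \<bullet> v = Idn \<C> (Src \<C> f')"
    by (rule kernel_monic[OF assms(2)]) (use K' u v fu in simp_all)
  ultimately have "inverse_arrows u v" using u v by (simp add: inverse_arrows_def Hom_iff)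
  then have "iso_arrow \<C> u" by (auto simp: iso_arrow_iff)
  then show ?thesis
    by (intro iso_closed[OF assms(1), of u "Idn \<C> (Tgt \<C> f)" f' "Idn \<C> (Tgt \<C> g)" g])
      (use K K' u in \<open>simp_all add: comm_square_def\<close>)
qed

lemma exact_replace_cokernel:
  assumes "(f, g) \<in> \<E>" "is_cokernel \<C> g' f"
  shows "(f, g') \<in> \<E>"
proof -
  note K = exactD[OF assms(1)] and K' = is_cokernelD[OF assms(2)]
  have S: "Src \<C> g' = Src \<C> g" using K(3) K'(3) by simp
  obtain u where u: "u \<in> Mor \<C>" "Src \<C> u = Tgt \<C> g" "Tgt \<C> u = Tgt \<C> g'" "u \<bullet> g = g'"
    by (rule cokernel_lift[OF exact_cokernel[OF assms(1)], of g']) (use K' S in simp_all)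
  obtain v where v: "v \<in> Mor \<C>" "Src \<C> v = Tgt \<C> g'" "Tgt \<C> v = Tgt \<C> g" "v \<bullet> g' = g"
    by (rule cokernel_lift[OF assms(2), of g]) (use K S in simp_all)
  have "v \<bullet> u = Idn \<C> (Tgt \<C> g)"
    by (rule cokernel_epic[OF exact_cokernel[OF assms(1)]]) (use K u v in simp_all)
  moreover have "u \<bullet> v = Idn \<C> (Tgt \<C> g')"
    by (rule cokernel_epic[OF assms(2)]) (use K' u v K(2) in simp_all)
  ultimately have "inverse_arrows u v" using u v by (simp add: inverse_arrows_def Hom_iff)
  then have "iso_arrow \<C> u" by (auto simp: iso_arrow_iff)
  then show ?thesis
    by (intro iso_closed[OF assms(1), of "Idn \<C> (Src \<C> f)" "Idn \<C> (Tgt \<C> f)" f u g'])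
      (use K K' S u in \<open>simp_all add: comm_square_def\<close>)
qed

text \<open>
  The axioms provide one pullback that is an admissible epic, and any other one is isomorphic to it. The kernel \<open>f\<close> of \<open>g\<close>
  together with the zero arrow induces the kernel of \<open>g'\<close>.
\<close>

lemma pullback_exact:
  assumes "is_pullback \<C> g' b c g" "(f, g) \<in> \<E>"
  obtains f' where "(f', g') \<in> \<E>" "f' \<in> Mor \<C>" "Src \<C> f' = Src \<C> f" "Tgt \<C> f' = Src \<C> g'"
    "b \<bullet> f' = f"
proof -
  note P = is_pullbackD[OF assms(1)] and K = exactD[OF assms(2)]
  have "admissible_epic \<E> g" using assms(2) by (auto simp: admissible_epic_def)
  then obtain b1 g1 where P1: "is_pullback \<C> g1 b1 c g" and "admissible_epic \<E> g1"
    using pullback_epic P by metis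
  then obtain f1 where E1: "(f1, g1) \<in> \<E>" by (auto simp: admissible_epic_def)
  note P' = is_pullbackD[OF P1] and K1 = exactD[OF E1]
  obtain w where w: "w \<in> Mor \<C>" "Src \<C> w = Src \<C> b" "Tgt \<C> w = Src \<C> g1" "g1 \<bullet> w = g'" "b1 \<bullet> w = b"
    by (rule pullback_lift[OF P1, of g' b]) (use P in simp_all)
  obtain w' where w': "w' \<in> Mor \<C>" "Src \<C> w' = Src \<C> b1" "Tgt \<C> w' = Src \<C> g'" "g' \<bullet> w' = g1" "b \<bullet> w' = b1"
    by (rule pullback_lift[OF assms(1), of g1 b1]) (use P' in simp_all)
  note T = P(1-8) P'(1-8) w(1-3) w'(1-3)
  have a: "g' \<bullet> (w' \<bullet> h) = g1 \<bullet> h" "b \<bullet> (w' \<bullet> h) = b1 \<bullet> h" if "h \<in> Mor \<C>" "Tgt \<C> h = Src \<C> g1" for h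
    using arg_cong[OF w'(4), of "\<lambda>x. x \<bullet> h"] arg_cong[OF w'(5), of "\<lambda>x. x \<bullet> h"] T that by simp_all
  have a': "g1 \<bullet> (w \<bullet> h) = g' \<bullet> h" "b1 \<bullet> (w \<bullet> h) = b \<bullet> h" if "h \<in> Mor \<C>" "Tgt \<C> h = Src \<C> g'" for h
    using arg_cong[OF w(4), of "\<lambda>x. x \<bullet> h"] arg_cong[OF w(5), of "\<lambda>x. x \<bullet> h"] T that by simp_all
  have "w' \<bullet> w = Idn \<C> (Src \<C> g')"
    by (rule pullback_eqI[OF assms(1)]) (use T in \<open>simp_all add: a w\<close>)
  moreover have "w \<bullet> w' = Idn \<C> (Src \<C> g1)"
    by (rule pullback_eqI[OF P1]) (use T in \<open>simp_all add: a' w'\<close>)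
  ultimately have "inverse_arrows w' w" using T by (simp add: inverse_arrows_def Hom_iff)
  then have "iso_arrow \<C> w'" by (auto simp: iso_arrow_iff)
  then have E': "(w' \<bullet> f1, g') \<in> \<E>"
    by (intro iso_closed[OF E1, of "Idn \<C> (Src \<C> f1)" w' _ "Idn \<C> (Src \<C> c)"])
      (use T K1(1-3) w'(4) in \<open>simp_all add: comm_square_def\<close>)
  obtain f' where f': "f' \<in> Mor \<C>" "Src \<C> f' = Src \<C> f" "Tgt \<C> f' = Src \<C> g'"
    "g' \<bullet> f' = Nul \<C> (Src \<C> f) (Src \<C> c)" "b \<bullet> f' = f"
    by (rule pullback_lift[OF assms(1), of "Nul \<C> (Src \<C> f) (Src \<C> c)" f]) (use P K in simp_all)
  have bf: "b \<bullet> (f' \<bullet> h) = f \<bullet> h" "g' \<bullet> (f' \<bullet> h) = Nul \<C> (Src \<C> h) (Src \<C> c)"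
    if "h \<in> Mor \<C>" "Tgt \<C> h = Src \<C> f" for h
    using arg_cong[OF f'(5), of "\<lambda>x. x \<bullet> h"] arg_cong[OF f'(4), of "\<lambda>x. x \<bullet> h"] P(1-8) f'(1-3) K(1) that
    by simp_all
  have "is_kernel \<C> f' g'"
  proof (rule is_kernelI)
    fix h assume h: "h \<in> Mor \<C>" "Tgt \<C> h = Src \<C> g'" "g' \<bullet> h = Nul \<C> (Src \<C> h) (Tgt \<C> g')"
    have gb: "g \<bullet> (b \<bullet> h) = Nul \<C> (Src \<C> h) (Tgt \<C> g)" using h P(1-8) P(10)[rule_format, of h] by simp
    obtain u where u: "u \<in> Mor \<C>" "Src \<C> u = Src \<C> (b \<bullet> h)" "Tgt \<C> u = Src \<C> f" "f \<bullet> u = b \<bullet> h"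
      by (rule kernel_lift[OF exact_kernel[OF assms(2)], of "b \<bullet> h"]) (use h(1,2) P(1-8) gb in simp_all)
    have "f' \<bullet> u = h"
      by (rule pullback_eqI[OF assms(1)]) (use h u f'(1-3) P(1-8) in \<open>simp_all add: bf\<close>)
    then show "\<exists>u. u \<in> Mor \<C> \<and> Src \<C> u = Src \<C> h \<and> Tgt \<C> u = Src \<C> f' \<and> f' \<bullet> u = h"
      using u f' h P by auto
  next
    fix u v assume *: "u \<in> Mor \<C>" "v \<in> Mor \<C>" "Src \<C> u = Src \<C> v" "Tgt \<C> u = Src \<C> f'"
      "Tgt \<C> v = Src \<C> f'" "f' \<bullet> u = f' \<bullet> v"
    have "f \<bullet> u = b \<bullet> (f' \<bullet> u)" using *(1-5) f'(2) by (simp add: bf)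
    also have "\<dots> = b \<bullet> (f' \<bullet> v)" by (simp only: *(6))
    also have "\<dots> = f \<bullet> v" using *(1-5) f'(2) by (simp add: bf)
    finally have eq: "f \<bullet> u = f \<bullet> v" .
    show "u = v"
      by (rule kernel_monic[OF exact_kernel[OF assms(2)] _ _ _ _ _ eq]) (use *(1-5) f'(2) in simp_all)
  qed (use f' P in simp_all)
  then show thesis using that exact_replace_kernel[OF E'] f' by blast
qed

lemma ex_pullback:
  assumes "(f, g) \<in> \<E>" "c \<in> Mor \<C>" "Tgt \<C> c = Tgt \<C> g"
  obtains b g' where "is_pullback \<C> g' b c g"
  using assms pullback_epic unfolding admissible_epic_def by blast

text \<open>The dual of \<open>pullback_exact\<close>.\<close>

lemma pushout_exact:
  assumes "is_pushout \<C> f a b f'" "(f, g) \<in> \<E>"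
  obtains g' where "(f', g') \<in> \<E>" "g' \<in> Mor \<C>" "Tgt \<C> g' = Tgt \<C> g" "Src \<C> g' = Tgt \<C> f'"
    "g' \<bullet> b = g"
proof -
  note P = is_pushoutD[OF assms(1)] and K = exactD[OF assms(2)]
  have "admissible_monic \<E> f" using assms(2) by (auto simp: admissible_monic_def)
  then obtain b1 f1 where P1: "is_pushout \<C> f a b1 f1" and "admissible_monic \<E> f1"
    using pushout_monic P by metis
  then obtain g1 where E1: "(f1, g1) \<in> \<E>" by (auto simp: admissible_monic_def)
  note P' = is_pushoutD[OF P1] and K1 = exactD[OF E1]
  obtain w where w: "w \<in> Mor \<C>" "Src \<C> w = Tgt \<C> f1" "Tgt \<C> w = Tgt \<C> f'" "w \<bullet> b1 = b" "w \<bullet> f1 = f'"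
    by (rule pushout_lift[OF P1, of b f']) (use P in simp_all)
  obtain w' where w': "w' \<in> Mor \<C>" "Src \<C> w' = Tgt \<C> f'" "Tgt \<C> w' = Tgt \<C> f1" "w' \<bullet> b = b1" "w' \<bullet> f' = f1"
    by (rule pushout_lift[OF assms(1), of b1 f1]) (use P' in simp_all)
  note T = P(1-8) P'(1-8) w(1-3) w'(1-3)
  have "w' \<bullet> w = Idn \<C> (Tgt \<C> f1)"
    by (rule pushout_eqI[OF P1]) (use T in \<open>simp_all add: w(4,5) w'(4,5)\<close>)
  moreover have "w \<bullet> w' = Idn \<C> (Tgt \<C> f')"
    by (rule pushout_eqI[OF assms(1)]) (use T in \<open>simp_all add: w(4,5) w'(4,5)\<close>)
  ultimately have ww: "inverse_arrows w w'" using T by (simp add: inverse_arrows_def Hom_iff)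
  then have "iso_arrow \<C> w" by (auto simp: iso_arrow_iff)
  then have E': "(f', g1 \<bullet> w') \<in> \<E>"
    by (intro iso_closed[OF E1, of "Idn \<C> (Tgt \<C> a)" w _ "Idn \<C> (Tgt \<C> g1)"])
      (use T K1(1-3) w(5) inverse_arrowsD[OF ww] in \<open>simp_all add: comm_square_def\<close>)
  obtain g' where g': "g' \<in> Mor \<C>" "Src \<C> g' = Tgt \<C> f'" "Tgt \<C> g' = Tgt \<C> g"
    "g' \<bullet> b = g" "g' \<bullet> f' = Nul \<C> (Tgt \<C> a) (Tgt \<C> g)"
    by (rule pushout_lift[OF assms(1), of g "Nul \<C> (Tgt \<C> a) (Tgt \<C> g)"]) (use P K in simp_all)
  have "is_cokernel \<C> g' f'"
  proof (rule is_cokernelI)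
    fix h assume h: "h \<in> Mor \<C>" "Src \<C> h = Src \<C> g'" "h \<bullet> f' = Nul \<C> (Src \<C> f') (Tgt \<C> h)"
    have "(h \<bullet> b) \<bullet> f = (h \<bullet> f') \<bullet> a" using h(1,2) g'(2) P by simp
    also have "\<dots> = Nul \<C> (Src \<C> f) (Tgt \<C> (h \<bullet> b))" unfolding h(3) using h(1,2) g'(2) P(1-8) by simp
    finally have hb: "(h \<bullet> b) \<bullet> f = Nul \<C> (Src \<C> f) (Tgt \<C> (h \<bullet> b))" .
    obtain u where u: "u \<in> Mor \<C>" "Src \<C> u = Tgt \<C> g" "Tgt \<C> u = Tgt \<C> (h \<bullet> b)" "u \<bullet> g = h \<bullet> b"
      by (rule cokernel_lift[OF exact_cokernel[OF assms(2)] _ _ hb])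
        (use h(1,2) g'(2) P(1-8) K(3) in simp_all)
    have "u \<bullet> g' = h"
      by (rule pushout_eqI[OF assms(1)]) (use h u g' P(1-8) in simp_all)
    then show "\<exists>u. u \<in> Mor \<C> \<and> Src \<C> u = Tgt \<C> g' \<and> Tgt \<C> u = Tgt \<C> h \<and> u \<bullet> g' = h"
      using u g' h P by auto
  next
    fix u v assume *: "u \<in> Mor \<C>" "v \<in> Mor \<C>" "Tgt \<C> u = Tgt \<C> v" "Src \<C> u = Tgt \<C> g'"
      "Src \<C> v = Tgt \<C> g'" "u \<bullet> g' = v \<bullet> g'"
    have "u \<bullet> g = (u \<bullet> g') \<bullet> b" using *(1-5) g' P(1-8) by simp
    also have "\<dots> = (v \<bullet> g') \<bullet> b" by (simp only: *(6))
    also have "\<dots> = v \<bullet> g" using *(1-5) g' P(1-8) by simp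
    finally have eq: "u \<bullet> g = v \<bullet> g" .
    show "u = v"
      by (rule cokernel_epic[OF exact_cokernel[OF assms(2)] _ _ _ _ _ eq]) (use *(1-5) g'(3) in simp_all)
  qed (use g' P in simp_all)
  then show thesis using that exact_replace_cokernel[OF E'] g' by blast
qed

lemma ex_pushout:
  assumes "(f, g) \<in> \<E>" "a \<in> Mor \<C>" "Src \<C> a = Src \<C> f"
  obtains b f' where "is_pushout \<C> f a b f'"
  using assms pushout_monic unfolding admissible_monic_def by blast

lemma split_exact:
  assumes "(f, g) \<in> \<E>" "s \<in> Mor \<C>" "Src \<C> s = Tgt \<C> g" "Tgt \<C> s = Src \<C> g" "g \<bullet> s = Idn \<C> (Tgt \<C> g)"
  obtains r where "biproduct \<C> (Src \<C> f) (Tgt \<C> g) (Src \<C> g) f s r g"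
proof -
  note K = exactD[OF assms(1)]
  define e where "e = Idn \<C> (Src \<C> g) \<boxplus> neg (s \<bullet> g)"
  have e: "e \<in> Mor \<C>" "Src \<C> e = Src \<C> g" "Tgt \<C> e = Src \<C> g"
    unfolding e_def using assms K by simp_all
  have gs: "g \<bullet> (s \<bullet> h) = h" if "h \<in> Mor \<C>" "Tgt \<C> h = Tgt \<C> g" for h
    using cmp_eq_assoc[OF assms(5,2) K(2) assms(4)] assms(3) that by simp
  have "g \<bullet> e = Nul \<C> (Src \<C> g) (Tgt \<C> g)"
    unfolding e_def using assms K by (simp add: gs)
  then obtain r where r: "r \<in> Mor \<C>" "Src \<C> r = Src \<C> g" "Tgt \<C> r = Src \<C> f" "f \<bullet> r = e"
    using kernel_lift[OF exact_kernel[OF assms(1)], of e] e by metis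
  have fr: "f \<bullet> (r \<bullet> h) = e \<bullet> h" if "h \<in> Mor \<C>" "Tgt \<C> h = Src \<C> g" for h
    using arg_cong[OF r(4), of "\<lambda>x. x \<bullet> h"] K r(1-3) that by simp
  have "r \<bullet> f = Idn \<C> (Src \<C> f)"
    by (rule kernel_monic[OF exact_kernel[OF assms(1)]])
      (use K r assms in \<open>simp_all add: fr\<close>, simp add: e_def)
  moreover have "r \<bullet> s = Nul \<C> (Tgt \<C> g) (Src \<C> f)"
    by (rule kernel_monic[OF exact_kernel[OF assms(1)]])
      (use K r assms in \<open>simp_all add: fr\<close>, simp add: e_def)
  moreover have "f \<bullet> r \<boxplus> s \<bullet> g = Idn \<C> (Src \<C> g)"
    unfolding r(4) e_def using assms K by simp
  ultimately have "biproduct \<C> (Src \<C> f) (Tgt \<C> g) (Src \<C> g) f s r g"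
    by (intro biproductI) (use K r(1-3) assms in simp_all)
  then show thesis by (rule that)
qed

lemma cokernel_idn_zero:
  assumes "(Idn \<C> X, e) \<in> \<E>" "X \<in> Obj \<C>"
  shows "zero_object \<C> (Tgt \<C> e)"
  unfolding zero_object_iff
proof
  note K = exactD[OF assms(1)]
  have S: "Src \<C> e = X" using K(3) assms(2) by simp
  have eN: "e = Nul \<C> X (Tgt \<C> e)" using K(4) K(2) S assms(2) by simp
  show "Idn \<C> (Tgt \<C> e) = Nul \<C> (Tgt \<C> e) (Tgt \<C> e)"
    by (rule cokernel_epic[OF exact_cokernel[OF assms(1)]]) (use K S assms(2) eN[symmetric] in simp_all)
qed (use exactD(2)[OF assms(1)] in simp)

text \<open>
  Split sequences are exact: \<open>X \<oplus> Y \<rightarrow> Y\<close> is the pullback of \<open>X \<rightarrow> 0\<close>, the cokernel of an identity.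
\<close>

lemma dsum_exact:
  assumes "biproduct \<C> X Y S i1 i2 p1 p2"
  shows "(i1, p2) \<in> \<E>"
proof -
  note B = biprodD[OF assms]
  obtain e where e: "(Idn \<C> X, e) \<in> \<E>" using idn_monic[OF B(1)] by (auto simp: admissible_monic_def)
  note K = exactD[OF e]
  let ?Z = "Tgt \<C> e"
  have S: "Src \<C> e = X" using K(3) B by simp
  have Z: "zero_object \<C> ?Z" by (rule cokernel_idn_zero[OF e B(1)])
  have to_Z: "f = Nul \<C> (Src \<C> f) ?Z" if "f \<in> Mor \<C>" "Tgt \<C> f = ?Z" for f
    using zero_object_arrow(2)[OF Z] that by blast
  have ZO: "?Z \<in> Obj \<C>" using K by simp
  have "is_pullback \<C> p2 p1 (Nul \<C> Y ?Z) e"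
  proof (rule is_pullbackI)
    have "e \<bullet> p1 = Nul \<C> (Src \<C> (e \<bullet> p1)) ?Z" by (rule to_Z) (use K(2) S B in simp_all)
    then show "Nul \<C> Y ?Z \<bullet> p2 = e \<bullet> p1" using B ZO K(2) S by simp
  next
    fix u v assume *: "u \<in> Mor \<C>" "v \<in> Mor \<C>" "Src \<C> u = Src \<C> v" "Tgt \<C> u = Src \<C> (Nul \<C> Y ?Z)"
      "Tgt \<C> v = Src \<C> e"
    then have "Tgt \<C> u = Y" "Tgt \<C> v = X" using B ZO S by simp_all
    then show "\<exists>w. w \<in> Mor \<C> \<and> Src \<C> w = Src \<C> v \<and> Tgt \<C> w = Src \<C> p2 \<and> p2 \<bullet> w = u \<and> p1 \<bullet> w = v"
      using *(1-3) by (intro exI[of _ "i1 \<bullet> v \<boxplus> i2 \<bullet> u"]) (simp add: B)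
  next
    fix w w' assume *: "w \<in> Mor \<C>" "w' \<in> Mor \<C>" "Src \<C> w = Src \<C> w'" "Tgt \<C> w = Src \<C> p2"
      "Tgt \<C> w' = Src \<C> p2" "p2 \<bullet> w = p2 \<bullet> w'" "p1 \<bullet> w = p1 \<bullet> w'"
    show "w = w'" by (rule biprod_into_eqI[OF assms *(1-3) _ _ *(7,6)]) (use *(4,5) B in simp_all)
  qed (use B K S ZO in simp_all)
  from pullback_exact[OF this e] obtain f' where f': "(f', p2) \<in> \<E>" "f' \<in> Mor \<C>"
    "Src \<C> f' = Src \<C> (Idn \<C> X)" "Tgt \<C> f' = Src \<C> p2" "p1 \<bullet> f' = Idn \<C> X"
    by blast
  have "p2 \<bullet> f' = Nul \<C> X Y" using exactD(4)[OF f'(1)] f' B by simp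
  then have "f' = i1" using biprod_into_eqI[OF assms, of f' i1] f' B by simp
  with f' show ?thesis by simp
qed

text \<open>
  Adding an identity: \<open>g \<oplus> 1\<close> is the pullback of \<open>g\<close> along a projection,
  and dually \<open>f \<oplus> 1\<close> is the pushout of \<open>f\<close> along an inclusion.
\<close>

lemma exact_add_idn_epic:
  assumes "biproduct \<C> X Q S i1 i2 p1 p2" "biproduct \<C> Y Q T j1 j2 q1 q2"
    "(f, g) \<in> \<E>" "g \<in> Hom \<C> X Y"
  shows "(i1 \<bullet> f, j1 \<bullet> g \<bullet> p1 \<boxplus> j2 \<bullet> p2) \<in> \<E>"
proof -
  note B = biprodD[OF assms(1)] biprodD[OF assms(2)] and K = exactD[OF assms(3)]
  have g: "Src \<C> g = X" "Tgt \<C> g = Y" "Tgt \<C> f = X" using assms(4) K(3) by (simp_all add: Hom_iff)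
  let ?t = "j1 \<bullet> g \<bullet> p1 \<boxplus> j2 \<bullet> p2"
  have "is_pullback \<C> ?t p1 q1 g"
  proof (rule is_pullbackI)
    fix u v assume *: "u \<in> Mor \<C>" "v \<in> Mor \<C>" "Src \<C> u = Src \<C> v" "Tgt \<C> u = Src \<C> q1"
      "Tgt \<C> v = Src \<C> g" "q1 \<bullet> u = g \<bullet> v"
    have "j1 \<bullet> (g \<bullet> v) \<boxplus> j2 \<bullet> (q2 \<bullet> u) = u"
      by (rule biprod_into_eqI[OF assms(2)]) (use *(1-5) in \<open>simp_all add: B g K(1,2) *(6)[symmetric]\<close>)
    then show "\<exists>w. w \<in> Mor \<C> \<and> Src \<C> w = Src \<C> v \<and> Tgt \<C> w = Src \<C> ?t \<and> ?t \<bullet> w = u \<and> p1 \<bullet> w = v"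
      using *(1-5) by (intro exI[of _ "i1 \<bullet> v \<boxplus> i2 \<bullet> (q2 \<bullet> u)"]) (simp add: B K(1,2) g)
  next
    fix w w' assume *: "w \<in> Mor \<C>" "w' \<in> Mor \<C>" "Src \<C> w = Src \<C> w'" "Tgt \<C> w = Src \<C> ?t"
      "Tgt \<C> w' = Src \<C> ?t" "?t \<bullet> w = ?t \<bullet> w'" "p1 \<bullet> w = p1 \<bullet> w'"
    have w: "Tgt \<C> w = S" "Tgt \<C> w' = S" using *(4,5) by (simp_all add: B g K)
    have "p2 \<bullet> x = q2 \<bullet> (?t \<bullet> x)" if "x \<in> Mor \<C>" "Tgt \<C> x = S" for x
      using that by (simp add: B g K(1,2))
    then have eq: "p2 \<bullet> w = p2 \<bullet> w'" using *(1,2,6) w by simp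
    show "w = w'" by (rule biprod_into_eqI[OF assms(1) *(1-3) w *(7) eq])
  qed (simp_all add: B g K(1,2))
  from pullback_exact[OF this assms(3)] obtain f' where f': "(f', ?t) \<in> \<E>" "f' \<in> Mor \<C>"
    "Src \<C> f' = Src \<C> f" "Tgt \<C> f' = Src \<C> ?t" "p1 \<bullet> f' = f"
    by blast
  have T: "Tgt \<C> f' = S" using f'(4) by (simp add: B g K(2))
  have "p2 \<bullet> f' = q2 \<bullet> (?t \<bullet> f')" using f'(2) T by (simp add: B g K(1,2))
  also have "\<dots> = Nul \<C> (Src \<C> f) Q" unfolding exactD(4)[OF f'(1)] using f'(3) by (simp add: B g K(1,2))
  finally have "p2 \<bullet> f' = Nul \<C> (Src \<C> f) Q" .
  then have "f' = i1 \<bullet> f"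
    using biprod_into_eqI[OF assms(1), of f' "i1 \<bullet> f"] f'(2,3,5) T by (simp add: B g K(1,2))
  with f'(1) show ?thesis by simp
qed

lemma exact_add_idn_monic:
  assumes "biproduct \<C> X Q S i1 i2 p1 p2" "biproduct \<C> Y Q T j1 j2 q1 q2"
    "(f, g) \<in> \<E>" "f \<in> Hom \<C> X Y"
  shows "(j1 \<bullet> f \<bullet> p1 \<boxplus> j2 \<bullet> p2, g \<bullet> q1) \<in> \<E>"
proof -
  note B = biprodD[OF assms(1)] biprodD[OF assms(2)] and K = exactD[OF assms(3)]
  have g: "Src \<C> f = X" "Tgt \<C> f = Y" "Src \<C> g = Y" using assms(4) K(3) by (simp_all add: Hom_iff)
  let ?t = "j1 \<bullet> f \<bullet> p1 \<boxplus> j2 \<bullet> p2"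
  have "is_pushout \<C> f i1 j1 ?t"
  proof (rule is_pushoutI)
    fix u v assume *: "u \<in> Mor \<C>" "v \<in> Mor \<C>" "Tgt \<C> u = Tgt \<C> v" "Src \<C> u = Tgt \<C> f"
      "Src \<C> v = Tgt \<C> i1" "u \<bullet> f = v \<bullet> i1"
    have uf: "u \<bullet> (f \<bullet> p1) = v \<bullet> (i1 \<bullet> p1)"
      using arg_cong[OF *(6), of "\<lambda>x. x \<bullet> p1"] *(1-5) by (simp add: B g K(1,2))
    have "u \<bullet> (f \<bullet> p1) \<boxplus> v \<bullet> (i2 \<bullet> p2) = v"
      unfolding uf by (rule biprod_from_eqI[OF assms(1)]) (use *(1-5) in \<open>simp_all add: B g K(1,2)\<close>)
    then show "\<exists>w. w \<in> Mor \<C> \<and> Src \<C> w = Tgt \<C> ?t \<and> Tgt \<C> w = Tgt \<C> v \<and> w \<bullet> j1 = u \<and> w \<bullet> ?t = v"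
      using *(1-5) by (intro exI[of _ "u \<bullet> q1 \<boxplus> v \<bullet> (i2 \<bullet> q2)"]) (simp add: B K(1,2) g)
  next
    fix w w' assume *: "w \<in> Mor \<C>" "w' \<in> Mor \<C>" "Tgt \<C> w = Tgt \<C> w'" "Src \<C> w = Tgt \<C> ?t"
      "Src \<C> w' = Tgt \<C> ?t" "w \<bullet> j1 = w' \<bullet> j1" "w \<bullet> ?t = w' \<bullet> ?t"
    have w: "Src \<C> w = T" "Src \<C> w' = T" using *(4,5) by (simp_all add: B g K)
    have "x \<bullet> j2 = (x \<bullet> ?t) \<bullet> i2" if "x \<in> Mor \<C>" "Src \<C> x = T" for x
      using that by (simp add: B g K(1,2))
    then have eq: "w \<bullet> j2 = w' \<bullet> j2" using *(1,2,7) w by simp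
    show "w = w'" by (rule biprod_from_eqI[OF assms(2) *(1-3) w *(6) eq])
  qed (simp_all add: B g K(1,2))
  from pushout_exact[OF this assms(3)] obtain g' where g': "(?t, g') \<in> \<E>" "g' \<in> Mor \<C>"
    "Tgt \<C> g' = Tgt \<C> g" "Src \<C> g' = Tgt \<C> ?t" "g' \<bullet> j1 = g"
    by blast
  have T: "Src \<C> g' = T" using g'(4) by (simp add: B g K(1))
  have "g' \<bullet> j2 = (g' \<bullet> ?t) \<bullet> i2" using g'(2) T by (simp add: B g K(1,2))
  also have "\<dots> = Nul \<C> Q (Tgt \<C> g)" unfolding exactD(4)[OF g'(1)] using g'(3) by (simp add: B g K(1,2))
  finally have "g' \<bullet> j2 = Nul \<C> Q (Tgt \<C> g)" .
  then have "g' = g \<bullet> q1"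
    using biprod_from_eqI[OF assms(2), of g' "g \<bullet> q1"] g'(2,3,5) T by (simp add: B g K(1,2))
  with g'(1) show ?thesis by simp
qed

text \<open>
  The pushout of \<open>m\<close> along the cokernel of \<open>m\<^sub>1\<close> is a cokernel of \<open>m m\<^sub>1\<close>. As a pushout of \<open>m\<close>, it is an extension of
  the cokernel of \<open>m\<close> by that of \<open>m\<^sub>1\<close>.
\<close>

lemma exact_cmp_monic:
  assumes "(m1, e1) \<in> \<E>" "(m, e) \<in> \<E>" "Tgt \<C> m1 = Src \<C> m"
  obtains b j q where "(m \<bullet> m1, b) \<in> \<E>" "(j, q) \<in> \<E>" "j \<in> Hom \<C> (Tgt \<C> e1) (Tgt \<C> b)"
    "q \<in> Hom \<C> (Tgt \<C> b) (Tgt \<C> e)"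
proof -
  note K1 = exactD[OF assms(1)] and K = exactD[OF assms(2)]
  obtain b j where P: "is_pushout \<C> m e1 b j"
    by (rule ex_pushout[OF assms(2), of e1]) (use K1 assms(3) in simp_all)
  obtain q where q: "(j, q) \<in> \<E>" "q \<in> Mor \<C>" "Tgt \<C> q = Tgt \<C> e" "Src \<C> q = Tgt \<C> j"
    by (rule pushout_exact[OF P assms(2)])
  have "admissible_monic \<E> (m \<bullet> m1)"
    using assms cmp_monic[of m1 m] unfolding admissible_monic_def by blast
  then obtain e' where "(m \<bullet> m1, e') \<in> \<E>" by (auto simp: admissible_monic_def)
  then have "(m \<bullet> m1, b) \<in> \<E>"
    using exact_replace_cokernel cokernel_cmp[OF P exact_cokernel[OF assms(1)]] by blast
  then show thesis using that[of b j q] q is_pushoutD[OF P] by (simp add: Hom_iff)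
qed

text \<open>
  After elimination \<open>f\<close> itself includes \<open>Y\<close> into its target. Dividing both sides by \<open>Y\<close>, that is, pushing \<open>f\<close> out along
  the projection onto \<open>A1\<close>, gives \<open>f'\<close>, and a pushout keeps the cokernel.
\<close>

lemma exact_gauss:
  assumes "(f, g) \<in> \<E>" "biproduct \<C> Y A1 (Src \<C> f) i1 i2 p1 p2"
    "biproduct \<C> Y B1 (Src \<C> g) j1 j2 q1 q2" "inverse_arrows (q1 \<bullet> f \<bullet> i1) a"
  obtains f' g' where "(f', g') \<in> \<E>" "f' \<in> Hom \<C> A1 B1" "Tgt \<C> g' = Tgt \<C> g"
    "f' = q2 \<bullet> f \<bullet> i2 \<boxplus> neg (q2 \<bullet> f \<bullet> i1 \<bullet> a \<bullet> q1 \<bullet> f \<bullet> i2)"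
proof -
  note B = biprodD[OF assms(2)] biprodD[OF assms(3)] and K = exactD[OF assms(1)]
  have [simp]: "Src \<C> (q1 \<bullet> f \<bullet> i1) = Y" "Tgt \<C> (q1 \<bullet> f \<bullet> i1) = Y" using K(1-3) by (simp_all add: B)
  have a: "a \<in> Mor \<C>" "Src \<C> a = Y" "Tgt \<C> a = Y" "a \<bullet> (q1 \<bullet> (f \<bullet> i1)) = Idn \<C> Y"
    using inverse_arrowsD[OF assms(4)] K(1-3) by (simp_all add: B)
  have "inverse_arrows (q1 \<bullet> (f \<bullet> i1)) a" using assms(4) K(1-3) by (simp add: B)
  then have "biproduct \<C> Y B1 (Src \<C> g) (f \<bullet> i1) j2 (a \<bullet> q1) (q2 \<boxplus> neg (q2 \<bullet> (f \<bullet> i1) \<bullet> a \<bullet> q1))"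
    using K(1-3) by (intro biproduct_gauss[OF assms(3)]) (simp_all add: B Hom_iff)
  then obtain q2' where B': "biproduct \<C> Y B1 (Src \<C> g) (f \<bullet> i1) j2 (a \<bullet> q1) q2'"
    and q2': "q2' = q2 \<boxplus> neg (q2 \<bullet> (f \<bullet> i1) \<bullet> a \<bullet> q1)" by blast
  note B2 = biprodD[OF B']
  have N: "q2' \<bullet> (f \<bullet> (i1 \<bullet> h)) = Nul \<C> (Src \<C> h) B1" if "h \<in> Mor \<C>" "Tgt \<C> h = Y" for h
    using arg_cong[OF B2(18), of "\<lambda>x. x \<bullet> h"] that K(1-3) by (simp add: B B2(1-15))
  let ?f = "q2' \<bullet> (f \<bullet> i2)"
  have sq: "q2' \<bullet> f = ?f \<bullet> p2"
    by (rule biprod_from_eqI[OF assms(2)]) (use K(1-3) N[of "Idn \<C> Y"] in \<open>simp_all add: B B2(1-15)\<close>)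
  have f12: "f = f \<bullet> (i1 \<bullet> p1) \<boxplus> f \<bullet> (i2 \<bullet> p2)"
    by (rule biprod_from_eqI[OF assms(2)]) (use K(1-3) in \<open>simp_all add: B\<close>)
  have "is_pushout \<C> f p2 q2' ?f"
  proof (rule is_pushoutI)
    fix u v assume *: "u \<in> Mor \<C>" "v \<in> Mor \<C>" "Tgt \<C> u = Tgt \<C> v" "Src \<C> u = Tgt \<C> f"
      "Src \<C> v = Tgt \<C> p2" "u \<bullet> f = v \<bullet> p2"
    have uf: "u \<bullet> (f \<bullet> h) = v \<bullet> (p2 \<bullet> h)" if "h \<in> Mor \<C>" "Tgt \<C> h = Src \<C> f" for h
      using arg_cong[OF *(6), of "\<lambda>x. x \<bullet> h"] *(1-5) that K(1-3) by (simp add: B)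
    have u: "(u \<bullet> j2) \<bullet> q2' = u"
      by (rule biprod_from_eqI[OF B']) (use *(1-5) K(1-3) in \<open>simp_all add: B B2 uf N[of "Idn \<C> Y", simplified B(1-15)]\<close>)
    have "(u \<bullet> j2) \<bullet> ?f = ((u \<bullet> j2) \<bullet> q2') \<bullet> (f \<bullet> i2)" using *(1-5) K(1-3) by (simp add: B B2(1-15))
    also have "\<dots> = v" unfolding u using *(1-5) K(1-3) by (simp add: B uf)
    finally have "(u \<bullet> j2) \<bullet> ?f = v" .
    with u show "\<exists>w. w \<in> Mor \<C> \<and> Src \<C> w = Tgt \<C> ?f \<and> Tgt \<C> w = Tgt \<C> v \<and> w \<bullet> q2' = u \<and> w \<bullet> ?f = v"
      using *(1-5) K(1-3) by (intro exI[of _ "u \<bullet> j2"]) (simp add: B B2(1-15))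
  next
    fix w w' assume *: "w \<in> Mor \<C>" "w' \<in> Mor \<C>" "Tgt \<C> w = Tgt \<C> w'" "Src \<C> w = Tgt \<C> ?f"
      "Src \<C> w' = Tgt \<C> ?f" "w \<bullet> q2' = w' \<bullet> q2'"
    have w: "Src \<C> w = B1" "Src \<C> w' = B1" using *(4,5) K(1-3) by (simp_all add: B B2(1-15))
    have "x = (x \<bullet> q2') \<bullet> j2" if "x \<in> Mor \<C>" "Src \<C> x = B1" for x
      using that K(1-3) by (simp add: B2)
    then show "w = w'" using *(1,2,6) w by metis
  qed (use K(1-3) sq in \<open>simp_all add: B B2(1-15)\<close>)
  from pushout_exact[OF this assms(1)] obtain g' where g': "(?f, g') \<in> \<E>" "Tgt \<C> g' = Tgt \<C> g"
    by blast
  moreover have "?f \<in> Hom \<C> A1 B1" using K(1-3) by (simp add: Hom_iff B B2(1-15))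
  moreover have "?f = q2 \<bullet> f \<bullet> i2 \<boxplus> neg (q2 \<bullet> f \<bullet> i1 \<bullet> a \<bullet> q1 \<bullet> f \<bullet> i2)"
    unfolding q2' using K(1-3) a(1-3) by (simp add: B)
  ultimately show thesis using that by blast
qed

end

section \<open>Projective objects and syzygies\<close>

context exact_category
begin

lemma projective_obj: "projective \<C> \<E> P \<Longrightarrow> P \<in> Obj \<C>"
  by (simp add: projective_def)

lemma projective_lift:
  assumes "projective \<C> \<E> P" "(f, g) \<in> \<E>" "h \<in> Mor \<C>" "Src \<C> h = P" "Tgt \<C> h = Tgt \<C> g"
  obtains k where "k \<in> Mor \<C>" "Src \<C> k = P" "Tgt \<C> k = Src \<C> g" "g \<bullet> k = h"
proof -
  have "short_exact_sequence (hom_group \<C> P (Tgt \<C> g)) (hom_group \<C> P (Src \<C> g))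
    (hom_group \<C> P (Src \<C> f)) (\<lambda>h. g \<bullet> h) (\<lambda>h. f \<bullet> h)"
    using assms(1,2) unfolding projective_def by blast
  from short_exact_sequenceD[OF this]
  have "(\<lambda>h. g \<bullet> h) \<in> epi (hom_group \<C> P (Src \<C> g)) (hom_group \<C> P (Tgt \<C> g))" by blast
  then have "(\<lambda>h. g \<bullet> h) ` Hom \<C> P (Src \<C> g) = Hom \<C> P (Tgt \<C> g)" by (simp add: epi_def)
  then have "h \<in> (\<lambda>h. g \<bullet> h) ` Hom \<C> P (Src \<C> g)" using assms by (simp add: Hom_iff)
  then show thesis using that by (auto simp: Hom_iff)
qed

text \<open>Left exactness of \<open>Hom\<close> is automatic, so projectivity is the lifting property alone.\<close>

lemma projectiveI:
  assumes P: "P \<in> Obj \<C>" and lift: "\<And>f g h. (f, g) \<in> \<E> \<Longrightarrow> h \<in> Mor \<C> \<Longrightarrow> Src \<C> h = P \<Longrightarrow> Tgt \<C> h = Tgt \<C> g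
    \<Longrightarrow> \<exists>k. k \<in> Mor \<C> \<and> Src \<C> k = P \<and> Tgt \<C> k = Src \<C> g \<and> g \<bullet> k = h"
  shows "projective \<C> \<E> P"
  unfolding projective_def
proof (intro conjI P, clarify)
  fix f g assume E: "(f, g) \<in> \<E>"
  note K = exactD[OF E]
  have grp: "comm_group (hom_group \<C> P X)" "group (hom_group \<C> P X)" if "X \<in> Obj \<C>" for X
    using hom_comm_group[OF P that] comm_group.axioms(2) by blast+
  have hom: "(\<lambda>h. x \<bullet> h) \<in> hom (hom_group \<C> P (Src \<C> x)) (hom_group \<C> P (Tgt \<C> x))"
    if "x \<in> Mor \<C>" for x
    using that by (auto simp: hom_def Hom_iff)
  have f: "(\<lambda>h. f \<bullet> h) \<in> mon (hom_group \<C> P (Src \<C> f)) (hom_group \<C> P (Src \<C> g))"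
    unfolding mon_def
  proof (intro CollectI conjI inj_onI)
    show "(\<lambda>h. f \<bullet> h) \<in> hom (hom_group \<C> P (Src \<C> f)) (hom_group \<C> P (Src \<C> g))"
      using hom[OF K(1)] K(3) by simp
    fix x y assume "x \<in> carrier (hom_group \<C> P (Src \<C> f))" "y \<in> carrier (hom_group \<C> P (Src \<C> f))"
      and eq: "f \<bullet> x = f \<bullet> y"
    then show "x = y" using kernel_monic[OF exact_kernel[OF E] _ _ _ _ _ eq] by (simp add: Hom_iff)
  qed
  have g: "(\<lambda>h. g \<bullet> h) \<in> epi (hom_group \<C> P (Src \<C> g)) (hom_group \<C> P (Tgt \<C> g))"
  proof -
    have "h \<in> (\<lambda>h. g \<bullet> h) ` Hom \<C> P (Src \<C> g)" if "h \<in> Hom \<C> P (Tgt \<C> g)" for h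
      using lift[OF E, of h] that by (auto simp: Hom_iff image_iff)
    moreover have "g \<bullet> h \<in> Hom \<C> P (Tgt \<C> g)" if "h \<in> Hom \<C> P (Src \<C> g)" for h
      using that K(2) by (simp add: Hom_iff)
    ultimately show ?thesis unfolding epi_def using hom[OF K(2)] by auto
  qed
  have ker: "kernel (hom_group \<C> P (Src \<C> g)) (hom_group \<C> P (Tgt \<C> g)) (\<lambda>h. g \<bullet> h)
    = (\<lambda>h. f \<bullet> h) ` carrier (hom_group \<C> P (Src \<C> f))"
  proof (intro equalityI subsetI)
    fix h assume "h \<in> kernel (hom_group \<C> P (Src \<C> g)) (hom_group \<C> P (Tgt \<C> g)) (\<lambda>h. g \<bullet> h)"
    then have h: "h \<in> Mor \<C>" "Src \<C> h = P" "Tgt \<C> h = Src \<C> g" "g \<bullet> h = Nul \<C> (Src \<C> h) (Tgt \<C> g)"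
      by (auto simp: kernel_def Hom_iff)
    from kernel_lift[OF exact_kernel[OF E] h(1,3,4)] obtain u where
      "u \<in> Mor \<C>" "Src \<C> u = Src \<C> h" "Tgt \<C> u = Src \<C> f" "f \<bullet> u = h" by blast
    then show "h \<in> (\<lambda>h. f \<bullet> h) ` carrier (hom_group \<C> P (Src \<C> f))"
      using h by (auto simp: Hom_iff)
  qed (use K P in \<open>auto simp: kernel_def Hom_iff\<close>)
  show "short_exact_sequence (hom_group \<C> P (Tgt \<C> g)) (hom_group \<C> P (Src \<C> g))
    (hom_group \<C> P (Src \<C> f)) (\<lambda>h. g \<bullet> h) (\<lambda>h. f \<bullet> h)"
    unfolding short_exact_sequence_iff using f g ker grp K(1,2)
    by (auto simp: group_hom_def group_hom_axioms_def mon_def epi_def)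
qed

lemma projective_retract:
  assumes "projective \<C> \<E> P" "retract Y P"
  shows "projective \<C> \<E> Y"
proof -
  obtain i p where ip: "i \<in> Mor \<C>" "p \<in> Mor \<C>" "Src \<C> i = Y" "Tgt \<C> i = P" "Src \<C> p = P" "Tgt \<C> p = Y"
    "p \<bullet> i = Idn \<C> Y" "Y \<in> Obj \<C>"
    using assms(2) by (rule retractE)
  show ?thesis
  proof (rule projectiveI)
    fix f g h assume *: "(f, g) \<in> \<E>" "h \<in> Mor \<C>" "Src \<C> h = Y" "Tgt \<C> h = Tgt \<C> g"
    obtain k where k: "k \<in> Mor \<C>" "Src \<C> k = P" "Tgt \<C> k = Src \<C> g" "g \<bullet> k = h \<bullet> p"
      by (rule projective_lift[OF assms(1) *(1), of "h \<bullet> p"]) (use * ip in simp_all)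
    have "g \<bullet> (k \<bullet> i) = (g \<bullet> k) \<bullet> i" using exactD[OF *(1)] k(1-3) ip by simp
    also have "\<dots> = h" unfolding k(4) using * ip by simp
    finally show "\<exists>k. k \<in> Mor \<C> \<and> Src \<C> k = Y \<and> Tgt \<C> k = Src \<C> g \<and> g \<bullet> k = h"
      using k ip by (intro exI[of _ "k \<bullet> i"]) simp
  qed (rule ip)
qed

lemma projective_dsum:
  assumes "projective \<C> \<E> P" "projective \<C> \<E> Q" "is_dsum \<C> P Q S"
  shows "projective \<C> \<E> S"
proof -
  obtain i1 i2 p1 p2 where bp: "biproduct \<C> P Q S i1 i2 p1 p2" using assms(3) by (rule is_dsumE)
  note B = biprodD[OF bp]
  show ?thesis
  proof (rule projectiveI)
    fix f g h assume *: "(f, g) \<in> \<E>" "h \<in> Mor \<C>" "Src \<C> h = S" "Tgt \<C> h = Tgt \<C> g"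
    note K = exactD[OF *(1)]
    obtain k1 where k1: "k1 \<in> Mor \<C>" "Src \<C> k1 = P" "Tgt \<C> k1 = Src \<C> g" "g \<bullet> k1 = h \<bullet> i1"
      by (rule projective_lift[OF assms(1) *(1), of "h \<bullet> i1"]) (use * B in simp_all)
    obtain k2 where k2: "k2 \<in> Mor \<C>" "Src \<C> k2 = Q" "Tgt \<C> k2 = Src \<C> g" "g \<bullet> k2 = h \<bullet> i2"
      by (rule projective_lift[OF assms(2) *(1), of "h \<bullet> i2"]) (use * B in simp_all)
    have "g \<bullet> (k1 \<bullet> p1 \<boxplus> k2 \<bullet> p2) = h"
      by (rule biprod_from_eqI[OF bp]) (use * k1 k2 K(1-3) in \<open>simp_all add: B\<close>)
    then show "\<exists>k. k \<in> Mor \<C> \<and> Src \<C> k = S \<and> Tgt \<C> k = Src \<C> g \<and> g \<bullet> k = h"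
      using k1 k2 B by (intro exI[of _ "k1 \<bullet> p1 \<boxplus> k2 \<bullet> p2"]) simp
  qed (rule B)
qed

lemma projective_zero:
  assumes "zero_object \<C> Z"
  shows "projective \<C> \<E> Z"
proof (rule projectiveI)
  show Z: "Z \<in> Obj \<C>" using assms by (simp add: zero_object_def)
  fix f g h assume *: "(f, g) \<in> \<E>" "h \<in> Mor \<C>" "Src \<C> h = Z" "Tgt \<C> h = Tgt \<C> g"
  have "g \<bullet> Nul \<C> Z (Src \<C> g) = h"
    using zero_object_arrow(1)[OF assms *(2,3)] exactD(2)[OF *(1)] Z *(4) by simp
  then show "\<exists>k. k \<in> Mor \<C> \<and> Src \<C> k = Z \<and> Tgt \<C> k = Src \<C> g \<and> g \<bullet> k = h"
    using Z exactD(2)[OF *(1)] by (intro exI[of _ "Nul \<C> Z (Src \<C> g)"]) simp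
qed

lemma projective_split:
  assumes "(f, g) \<in> \<E>" "projective \<C> \<E> (Tgt \<C> g)"
  obtains s r where "biproduct \<C> (Src \<C> f) (Tgt \<C> g) (Src \<C> g) f s r g"
proof -
  obtain s where "s \<in> Mor \<C>" "Src \<C> s = Tgt \<C> g" "Tgt \<C> s = Src \<C> g" "g \<bullet> s = Idn \<C> (Tgt \<C> g)"
    by (rule projective_lift[OF assms(2,1), of "Idn \<C> (Tgt \<C> g)"]) (use exactD[OF assms(1)] in simp_all)
  then show thesis using split_exact[OF assms(1)] that by blast
qed

lemma is_syzygyI:
  "(f, g) \<in> \<E> \<Longrightarrow> projective \<C> \<E> (Src \<C> g) \<Longrightarrow> Src \<C> f = K \<Longrightarrow> Tgt \<C> g = M \<Longrightarrow> is_syzygy \<C> \<E> M K"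
  unfolding is_syzygy_def
  by (intro exI[of _ "Src \<C> g"] exI[of _ f] exI[of _ g]) (auto simp: Hom_iff dest: exactD)

lemma is_syzygyE:
  assumes "is_syzygy \<C> \<E> M K"
  obtains f g where "(f, g) \<in> \<E>" "projective \<C> \<E> (Src \<C> g)" "Src \<C> f = K" "Tgt \<C> g = M"
  using assms by (auto simp: is_syzygy_def Hom_iff)

lemma is_syzygy_obj: "is_syzygy \<C> \<E> M K \<Longrightarrow> M \<in> Obj \<C> \<and> K \<in> Obj \<C>"
  by (auto elim!: is_syzygyE dest: exactD)

definition stably_iso where
  "stably_iso X Y \<longleftrightarrow> X \<in> Obj \<C> \<and> Y \<in> Obj \<C> \<and>
     (\<exists>P Q. projective \<C> \<E> P \<and> projective \<C> \<E> Q \<and> isoclass \<C> X \<star> isoclass \<C> P = isoclass \<C> Y \<star> isoclass \<C> Q)"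

lemma stably_isoI:
  "is_dsum \<C> X P S \<Longrightarrow> is_dsum \<C> Y Q S \<Longrightarrow> projective \<C> \<E> P \<Longrightarrow> projective \<C> \<E> Q \<Longrightarrow> stably_iso X Y"
  unfolding stably_iso_def using is_dsum_obj isoclass_dsum by metis

lemma stably_isoE:
  assumes "stably_iso X Y"
  obtains P Q S where "is_dsum \<C> X P S" "is_dsum \<C> Y Q S" "projective \<C> \<E> P" "projective \<C> \<E> Q"
proof -
  obtain P Q where *: "projective \<C> \<E> P" "projective \<C> \<E> Q" "X \<in> Obj \<C>" "Y \<in> Obj \<C>"
    "isoclass \<C> X \<star> isoclass \<C> P = isoclass \<C> Y \<star> isoclass \<C> Q"
    using assms by (auto simp: stably_iso_def)
  then obtain S where S: "is_dsum \<C> X P S" using ex_dsum projective_obj by blast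
  then have "is_dsum \<C> Y Q S" using * projective_obj is_dsum_iff by auto
  with S * that show thesis by blast
qed

lemma stably_iso_sym: "stably_iso X Y \<Longrightarrow> stably_iso Y X"
  by (metis stably_iso_def)

lemma isomorphic_stably_iso: "isomorphic X Y \<Longrightarrow> stably_iso X Y"
  using isomorphic_obj isoclass_eq ex_zero_object projective_zero unfolding stably_iso_def by metis

lemma stably_iso_projective:
  assumes "stably_iso X Y" "projective \<C> \<E> Y"
  shows "projective \<C> \<E> X"
  using assms projective_dsum projective_retract dsum_retract(1) by (metis stably_isoE)

text \<open>
  The pullback of the two epics onto \<open>M\<close> maps onto both projective objects, so it splits in two ways.
\<close>

lemma schanuel:
  assumes "is_syzygy \<C> \<E> M K" "is_syzygy \<C> \<E> M K'"
  shows "stably_iso K K'"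
proof -
  obtain f g where 1: "(f, g) \<in> \<E>" "projective \<C> \<E> (Src \<C> g)" "Src \<C> f = K" "Tgt \<C> g = M"
    using assms(1) by (rule is_syzygyE)
  obtain f' g' where 2: "(f', g') \<in> \<E>" "projective \<C> \<E> (Src \<C> g')" "Src \<C> f' = K'" "Tgt \<C> g' = M"
    using assms(2) by (rule is_syzygyE)
  obtain b h where P: "is_pullback \<C> h b g' g"
    by (rule ex_pullback[OF 1(1), of g']) (use exactD[OF 2(1)] 1 2 in simp_all)
  note PD = is_pullbackD[OF P]
  obtain k where k: "(k, h) \<in> \<E>" "Src \<C> k = K" using pullback_exact[OF P 1(1)] 1(3) by metis
  obtain k' where k': "(k', b) \<in> \<E>" "Src \<C> k' = K'"
    using pullback_exact[OF is_pullback_swap[OF P] 2(1)] 2(3) by metis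
  have "is_dsum \<C> K (Src \<C> g') (Src \<C> h)"
    using projective_split[OF k(1)] 2(2) PD(6) k(2) is_dsumI by metis
  moreover have "is_dsum \<C> K' (Src \<C> g) (Src \<C> h)"
    using projective_split[OF k'(1)] 1(2) PD(5,7) k'(2) is_dsumI by metis
  ultimately show ?thesis using stably_isoI 1(2) 2(2) by blast
qed

text \<open>
  The sum of two admissible epics is the composite of \<open>g\<^sub>1 \<oplus> 1\<close> and \<open>1 \<oplus> g\<^sub>2\<close>.
\<close>

lemma syzygy_dsum:
  assumes "is_syzygy \<C> \<E> M1 K1" "is_syzygy \<C> \<E> M2 K2" "is_dsum \<C> M1 M2 M" "is_dsum \<C> K1 K2 K"
  shows "is_syzygy \<C> \<E> M K"
proof -
  obtain f1 g1 where 1: "(f1, g1) \<in> \<E>" "projective \<C> \<E> (Src \<C> g1)" "Src \<C> f1 = K1" "Tgt \<C> g1 = M1"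
    using assms(1) by (rule is_syzygyE)
  obtain f2 g2 where 2: "(f2, g2) \<in> \<E>" "projective \<C> \<E> (Src \<C> g2)" "Src \<C> f2 = K2" "Tgt \<C> g2 = M2"
    using assms(2) by (rule is_syzygyE)
  note E = exactD[OF 1(1)] exactD[OF 2(1)]
  obtain m1 m2 mm1 mm2 where M: "biproduct \<C> M1 M2 M m1 m2 mm1 mm2" using assms(3) by (rule is_dsumE)
  obtain k1 k2 kk1 kk2 where K: "biproduct \<C> K1 K2 K k1 k2 kk1 kk2" using assms(4) by (rule is_dsumE)
  obtain P where dP: "is_dsum \<C> (Src \<C> g1) (Src \<C> g2) P" using ex_dsum E by (meson src_obj)
  then obtain p1 p2 pp1 pp2 where P: "biproduct \<C> (Src \<C> g1) (Src \<C> g2) P p1 p2 pp1 pp2" by (rule is_dsumE)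
  have "M1 \<in> Obj \<C>" using biprodD(1)[OF M] .
  then obtain N where "is_dsum \<C> M1 (Src \<C> g2) N" using ex_dsum E by (meson src_obj)
  then obtain n1 n2 nn1 nn2 where N: "biproduct \<C> M1 (Src \<C> g2) N n1 n2 nn1 nn2" by (rule is_dsumE)
  note B = biprodD[OF M] biprodD[OF K] biprodD[OF P] biprodD[OF N]
  have T: "g1 \<in> Mor \<C>" "g2 \<in> Mor \<C>" "f1 \<in> Mor \<C>" "f2 \<in> Mor \<C>" "Tgt \<C> f1 = Src \<C> g1" "Tgt \<C> f2 = Src \<C> g2"
    using E by simp_all
  define t where "t = m1 \<bullet> g1 \<bullet> pp1 \<boxplus> m2 \<bullet> g2 \<bullet> pp2"
  have t: "t \<in> Mor \<C>" "Src \<C> t = P" "Tgt \<C> t = M" unfolding t_def by (simp_all add: B T 1 2)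
  have mt: "mm1 \<bullet> (t \<bullet> h) = g1 \<bullet> (pp1 \<bullet> h)" "mm2 \<bullet> (t \<bullet> h) = g2 \<bullet> (pp2 \<bullet> h)"
    if "h \<in> Mor \<C>" "Tgt \<C> h = P" for h
    unfolding t_def using that by (simp_all add: B T 1 2)
  let ?t1 = "n1 \<bullet> g1 \<bullet> pp1 \<boxplus> n2 \<bullet> pp2" and ?t2 = "m2 \<bullet> g2 \<bullet> nn2 \<boxplus> m1 \<bullet> nn1"
  have "(p1 \<bullet> f1, ?t1) \<in> \<E>"
    by (rule exact_add_idn_epic[OF P N 1(1)]) (simp add: Hom_iff T 1)
  moreover have "(n2 \<bullet> f2, ?t2) \<in> \<E>"
    by (rule exact_add_idn_epic[OF biproduct_swap[OF N] biproduct_swap[OF M] 2(1)]) (simp add: Hom_iff T 2)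
  moreover have "Tgt \<C> ?t1 = Src \<C> ?t2" by (simp add: B T 1 2)
  ultimately have "admissible_epic \<E> (?t2 \<bullet> ?t1)" using cmp_epic unfolding admissible_epic_def by blast
  moreover have "?t2 \<bullet> ?t1 = t" unfolding t_def by (simp add: B T 1 2 add_comm)
  ultimately obtain f0 where f0: "(f0, t) \<in> \<E>" by (auto simp: admissible_epic_def)
  define s where "s = p1 \<bullet> f1 \<bullet> kk1 \<boxplus> p2 \<bullet> f2 \<bullet> kk2"
  have s: "s \<in> Mor \<C>" "Src \<C> s = K" "Tgt \<C> s = P" unfolding s_def by (simp_all add: B T 1 2)
  have ps: "pp1 \<bullet> (s \<bullet> h) = f1 \<bullet> (kk1 \<bullet> h)" "pp2 \<bullet> (s \<bullet> h) = f2 \<bullet> (kk2 \<bullet> h)"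
    if "h \<in> Mor \<C>" "Tgt \<C> h = K" for h
    unfolding s_def using that by (simp_all add: B T 1 2)
  have "is_kernel \<C> s t"
  proof (rule is_kernelI)
    show "t \<bullet> s = Nul \<C> (Src \<C> s) (Tgt \<C> t)"
      unfolding s(2) t(3) unfolding s_def t_def by (simp add: B E(5,10) T 1 2)
  next
    fix h assume h: "h \<in> Mor \<C>" "Tgt \<C> h = Src \<C> t" "t \<bullet> h = Nul \<C> (Src \<C> h) (Tgt \<C> t)"
    have N1: "g1 \<bullet> (pp1 \<bullet> h) = Nul \<C> (Src \<C> h) M1"
      using mt(1)[of h] h t by (simp add: B)
    have N2: "g2 \<bullet> (pp2 \<bullet> h) = Nul \<C> (Src \<C> h) M2"
      using mt(2)[of h] h t by (simp add: B)
    obtain u1 where u1: "u1 \<in> Mor \<C>" "Src \<C> u1 = Src \<C> (pp1 \<bullet> h)" "Tgt \<C> u1 = Src \<C> f1" "f1 \<bullet> u1 = pp1 \<bullet> h"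
      by (rule kernel_lift[OF exact_kernel[OF 1(1)], of "pp1 \<bullet> h"]) (use h(1,2) t N1 in \<open>simp_all add: B 1\<close>)
    obtain u2 where u2: "u2 \<in> Mor \<C>" "Src \<C> u2 = Src \<C> (pp2 \<bullet> h)" "Tgt \<C> u2 = Src \<C> f2" "f2 \<bullet> u2 = pp2 \<bullet> h"
      by (rule kernel_lift[OF exact_kernel[OF 2(1)], of "pp2 \<bullet> h"]) (use h(1,2) t N2 in \<open>simp_all add: B 2\<close>)
    have u: "u1 \<in> Mor \<C>" "Src \<C> u1 = Src \<C> h" "Tgt \<C> u1 = K1" "f1 \<bullet> u1 = pp1 \<bullet> h"
      "u2 \<in> Mor \<C>" "Src \<C> u2 = Src \<C> h" "Tgt \<C> u2 = K2" "f2 \<bullet> u2 = pp2 \<bullet> h"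
      using u1 u2 h(1,2) t by (simp_all add: B 1 2)
    have "s \<bullet> (k1 \<bullet> u1 \<boxplus> k2 \<bullet> u2) = h"
      by (rule biprod_into_eqI[OF P]) (use h(1,2) t u s in \<open>simp_all add: ps B T 1 2\<close>)
    then show "\<exists>u. u \<in> Mor \<C> \<and> Src \<C> u = Src \<C> h \<and> Tgt \<C> u = Src \<C> s \<and> s \<bullet> u = h"
      using u s by (intro exI[of _ "k1 \<bullet> u1 \<boxplus> k2 \<bullet> u2"]) (simp add: B)
  next
    fix u v assume *: "u \<in> Mor \<C>" "v \<in> Mor \<C>" "Src \<C> u = Src \<C> v" "Tgt \<C> u = Src \<C> s"
      "Tgt \<C> v = Src \<C> s" "s \<bullet> u = s \<bullet> v"
    have uv: "Tgt \<C> u = K" "Tgt \<C> v = K" using * s by simp_all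
    have e1: "f1 \<bullet> (kk1 \<bullet> u) = f1 \<bullet> (kk1 \<bullet> v)"
      using ps(1)[of u] ps(1)[of v] *(1,2,6) uv by simp
    have e2: "f2 \<bullet> (kk2 \<bullet> u) = f2 \<bullet> (kk2 \<bullet> v)"
      using ps(2)[of u] ps(2)[of v] *(1,2,6) uv by simp
    have "kk1 \<bullet> u = kk1 \<bullet> v"
      by (rule kernel_monic[OF exact_kernel[OF 1(1)] _ _ _ _ _ e1]) (use *(1-3) uv in \<open>simp_all add: B 1\<close>)
    moreover have "kk2 \<bullet> u = kk2 \<bullet> v"
      by (rule kernel_monic[OF exact_kernel[OF 2(1)] _ _ _ _ _ e2]) (use *(1-3) uv in \<open>simp_all add: B 2\<close>)
    ultimately show "u = v" by (rule biprod_into_eqI[OF K *(1-3) uv])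
  qed (use s t in simp_all)
  from exact_replace_kernel[OF f0 this] have "(s, t) \<in> \<E>" .
  moreover have "projective \<C> \<E> (Src \<C> t)" using projective_dsum[OF 1(2) 2(2) dP] t by simp
  ultimately show ?thesis using is_syzygyI s t by blast
qed

lemma syzygy_of_projective:
  assumes "is_syzygy \<C> \<E> P K" "projective \<C> \<E> P"
  shows "projective \<C> \<E> K"
proof -
  obtain f g where 1: "(f, g) \<in> \<E>" "projective \<C> \<E> (Src \<C> g)" "Src \<C> f = K" "Tgt \<C> g = P"
    using assms(1) by (rule is_syzygyE)
  with assms(2) have "is_dsum \<C> K P (Src \<C> g)" using projective_split[OF 1(1)] is_dsumI by metis
  then show ?thesis using projective_retract[OF 1(2)] dsum_retract by blast
qed

lemma zero_syzygy:
  assumes "projective \<C> \<E> P"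
  obtains Z where "zero_object \<C> Z" "is_syzygy \<C> \<E> P Z"
proof -
  have P: "P \<in> Obj \<C>" using assms projective_obj by simp
  then obtain k where k: "(k, Idn \<C> P) \<in> \<E>" using idn_epic by (auto simp: admissible_epic_def)
  note K = exactD[OF k]
  have kN: "Nul \<C> (Src \<C> k) P = k" using K(1,3,4) P by simp
  have "Idn \<C> (Src \<C> k) = Nul \<C> (Src \<C> k) (Src \<C> k)"
    by (rule kernel_monic[OF exact_kernel[OF k]]) (use K(1,3) P kN in simp_all)
  then have "zero_object \<C> (Src \<C> k)" using K(1) by (simp add: zero_object_iff)
  moreover have "is_syzygy \<C> \<E> P (Src \<C> k)" using k assms P by (intro is_syzygyI[OF k]) simp_all
  ultimately show thesis by (rule that)
qed

text \<open>
  A projective object has a zero object as syzygy, and \<open>K \<oplus> 0 \<cong> K\<close>.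
\<close>

lemma syzygy_add_projective:
  assumes "is_syzygy \<C> \<E> M K" "projective \<C> \<E> P" "is_dsum \<C> M P M'"
  shows "is_syzygy \<C> \<E> M' K"
proof -
  obtain Z where Z: "zero_object \<C> Z" "is_syzygy \<C> \<E> P Z" using zero_syzygy[OF assms(2)] by blast
  then have "is_dsum \<C> K Z K" using is_dsum_zero is_syzygy_obj assms(1) by blast
  then show ?thesis by (rule syzygy_dsum[OF assms(1) Z(2) assms(3)])
qed

lemma syzygy_stably_iso:
  assumes "stably_iso M M'" "is_syzygy \<C> \<E> M K" "is_syzygy \<C> \<E> M' K'"
  shows "stably_iso K K'"
proof -
  obtain P Q S where "is_dsum \<C> M P S" "is_dsum \<C> M' Q S" "projective \<C> \<E> P" "projective \<C> \<E> Q"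
    using assms(1) by (rule stably_isoE)
  then have "is_syzygy \<C> \<E> S K" "is_syzygy \<C> \<E> S K'" using syzygy_add_projective assms(2,3) by blast+
  then show ?thesis by (rule schanuel)
qed

text \<open>
  With \<open>P\<^sub>A \<rightarrow> A\<close> and \<open>P\<^sub>C \<rightarrow> C\<close> the given epics, the pullback \<open>E\<close> of \<open>P\<^sub>C \<rightarrow> C\<close> along
  \<open>B \<rightarrow> C\<close> splits as \<open>A \<oplus> P\<^sub>C\<close>, and \<open>P\<^sub>A \<oplus> P\<^sub>C \<rightarrow> E \<rightarrow> B\<close> is the sought epic onto \<open>B\<close>: its kernel
  is the preimage in \<open>P\<^sub>A \<oplus> P\<^sub>C\<close> of the kernel of \<open>E \<rightarrow> B\<close>, which is the syzygy of \<open>C\<close>.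
\<close>

lemma horseshoe:
  assumes "(f, g) \<in> \<E>" "is_syzygy \<C> \<E> (Src \<C> f) KA" "is_syzygy \<C> \<E> (Tgt \<C> g) KC"
  obtains f' g' where "(f', g') \<in> \<E>" "Src \<C> f' = KA" "Tgt \<C> g' = KC" "is_syzygy \<C> \<E> (Src \<C> g) (Src \<C> g')"
proof -
  obtain a0 a1 where a: "(a0, a1) \<in> \<E>" "projective \<C> \<E> (Src \<C> a1)" "Src \<C> a0 = KA" "Tgt \<C> a1 = Src \<C> f"
    using assms(2) by (rule is_syzygyE)
  obtain c0 c1 where c: "(c0, c1) \<in> \<E>" "projective \<C> \<E> (Src \<C> c1)" "Src \<C> c0 = KC" "Tgt \<C> c1 = Tgt \<C> g"
    using assms(3) by (rule is_syzygyE)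
  note K = exactD[OF assms(1)]
  obtain b e where P: "is_pullback \<C> e b g c1"
    by (rule ex_pullback[OF c(1), of g]) (use K c in simp_all)
  note PD = is_pullbackD[OF P]
  obtain k where k: "(k, e) \<in> \<E>" "k \<in> Mor \<C>" "Src \<C> k = KC" "Tgt \<C> k = Src \<C> e"
    using pullback_exact[OF P c(1)] c(3) by metis
  obtain f1 where f1: "(f1, b) \<in> \<E>" "Src \<C> f1 = Src \<C> f"
    using pullback_exact[OF is_pullback_swap[OF P] assms(1)] by metis
  have prb: "projective \<C> \<E> (Tgt \<C> b)" using c(2) PD(7) by simp
  obtain s r where E: "biproduct \<C> (Src \<C> f1) (Tgt \<C> b) (Src \<C> b) f1 s r b"
    by (rule projective_split[OF f1(1) prb])
  obtain T where dT: "is_dsum \<C> (Src \<C> a1) (Tgt \<C> b) T"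
    using ex_dsum a(2) prb projective_obj by blast
  then obtain t1 t2 u1 u2 where T: "biproduct \<C> (Src \<C> a1) (Tgt \<C> b) T t1 t2 u1 u2" by (rule is_dsumE)
  note B = biprodD(1-4,6-13,16-24)[OF E] biprodD[OF T]
  define t where "t = f1 \<bullet> a1 \<bullet> u1 \<boxplus> s \<bullet> u2"
  have t: "(t1 \<bullet> a0, t) \<in> \<E>"
    unfolding t_def by (rule exact_add_idn_epic[OF T E a(1)])
      (use a(4) f1(2) exactD(2)[OF a(1)] in \<open>simp add: Hom_iff\<close>)
  have tM: "t \<in> Mor \<C>" "Src \<C> t = T" "Tgt \<C> t = Src \<C> e"
    unfolding t_def using a(4) f1(2) exactD(2)[OF a(1)] PD(5) by (simp_all add: B)
  obtain b' t' where Q: "is_pullback \<C> t' b' k t"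
    by (rule ex_pullback[OF t, of k]) (use k tM in simp_all)
  note QD = is_pullbackD[OF Q]
  obtain x where x: "(x, t') \<in> \<E>" "Src \<C> x = Src \<C> (t1 \<bullet> a0)" by (rule pullback_exact[OF Q t])
  have xA: "Src \<C> x = KA" using x(2) a(3) exactD(1,3)[OF a(1)] by (simp add: B)
  have "admissible_epic \<E> (e \<bullet> t)"
    using cmp_epic[of t e] t k(1) tM(3) unfolding admissible_epic_def by blast
  then obtain y where "(y, e \<bullet> t) \<in> \<E>" by (auto simp: admissible_epic_def)
  then have "(b', e \<bullet> t) \<in> \<E>"
    by (rule exact_replace_kernel) (rule kernel_cmp[OF Q exact_kernel[OF k(1)]])
  moreover have "projective \<C> \<E> (Src \<C> (e \<bullet> t))"
    using projective_dsum[OF a(2) prb dT] tM PD(1) by simp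
  ultimately have "is_syzygy \<C> \<E> (Src \<C> g) (Src \<C> t')"
    by (rule is_syzygyI) (use tM PD(1,6) QD(5) in simp_all)
  then show thesis using that[OF x(1) xA] QD(6) k(3) by simp
qed

primrec nth_syzygy where
  "nth_syzygy 0 M K \<longleftrightarrow> M \<in> Obj \<C> \<and> K = M"
| "nth_syzygy (Suc n) M K \<longleftrightarrow> (\<exists>L. is_syzygy \<C> \<E> M L \<and> nth_syzygy n L K)"

lemma nth_syzygy_obj: "nth_syzygy n M K \<Longrightarrow> M \<in> Obj \<C> \<and> K \<in> Obj \<C>"
  by (induction n arbitrary: M) (auto dest: is_syzygy_obj)

lemma nth_syzygy_trans: "nth_syzygy m M L \<Longrightarrow> nth_syzygy n L K \<Longrightarrow> nth_syzygy (m + n) M K"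
  by (induction m arbitrary: M) auto

lemma nth_syzygy_step: "nth_syzygy n M L \<Longrightarrow> is_syzygy \<C> \<E> L K \<Longrightarrow> nth_syzygy (Suc n) M K"
  using nth_syzygy_trans[of n M L 1 K] is_syzygy_obj by auto

lemma nth_syzygy_stably_iso:
  "stably_iso M M' \<Longrightarrow> nth_syzygy n M K \<Longrightarrow> nth_syzygy n M' K' \<Longrightarrow> stably_iso K K'"
  by (induction n arbitrary: M M') (auto dest: syzygy_stably_iso)

lemma nth_syzygy_dsum:
  "nth_syzygy n M1 K1 \<Longrightarrow> nth_syzygy n M2 K2 \<Longrightarrow> is_dsum \<C> M1 M2 M \<Longrightarrow>
    \<exists>K. nth_syzygy n M K \<and> is_dsum \<C> K1 K2 K"
proof (induction n arbitrary: M1 M2 M)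
  case 0
  then show ?case using is_dsum_obj by auto
next
  case (Suc n)
  then obtain L1 L2 where L: "is_syzygy \<C> \<E> M1 L1" "nth_syzygy n L1 K1" "is_syzygy \<C> \<E> M2 L2" "nth_syzygy n L2 K2"
    by auto
  then obtain L where dL: "is_dsum \<C> L1 L2 L" using ex_dsum is_syzygy_obj by blast
  have "is_syzygy \<C> \<E> M L" using syzygy_dsum L dL Suc.prems by blast
  then show ?case using Suc.IH[OF L(2,4) dL] by auto
qed

lemma nth_syzygy_projective: "nth_syzygy n P K \<Longrightarrow> projective \<C> \<E> P \<Longrightarrow> projective \<C> \<E> K"
  by (induction n arbitrary: P) (auto dest: syzygy_of_projective)

text \<open>One projective syzygy suffices, since all \<open>n\<close>-th syzygies of \<open>X\<close> are stably isomorphic.\<close>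

definition proj_dim_le where
  "proj_dim_le n X \<longleftrightarrow> (\<exists>K. nth_syzygy n X K \<and> projective \<C> \<E> K)"

lemma proj_dim_le_0: "projective \<C> \<E> P \<Longrightarrow> proj_dim_le 0 P"
  by (auto simp: proj_dim_le_def projective_obj)

lemma proj_dim_leD:
  assumes "proj_dim_le n X" "nth_syzygy n X K"
  shows "projective \<C> \<E> K"
proof -
  obtain L where L: "nth_syzygy n X L" "projective \<C> \<E> L" using assms(1) by (auto simp: proj_dim_le_def)
  have "stably_iso X X" using isomorphic_stably_iso isomorphic_refl nth_syzygy_obj L by blast
  then have "stably_iso K L" using nth_syzygy_stably_iso assms(2) L by blast
  then show ?thesis using stably_iso_projective L by blast
qed

lemma proj_dim_le_obj: "proj_dim_le n X \<Longrightarrow> X \<in> Obj \<C>"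
  unfolding proj_dim_le_def using nth_syzygy_obj by blast

end

section \<open>Projective dimension\<close>

lemma trivial_quotient_iff:
  assumes "comm_group G" "subgroup H G"
  shows "trivial_group (G Mod H) \<longleftrightarrow> carrier G \<subseteq> H"
proof -
  interpret comm_group G by fact
  have n: "H \<lhd> G" using assms(2) by (simp add: normal_iff_subgroup)
  interpret N: normal H G by fact
  have "carrier (G Mod H) = {\<one>\<^bsub>G Mod H\<^esub>} \<longleftrightarrow> carrier G \<subseteq> H"
  proof
    assume *: "carrier (G Mod H) = {\<one>\<^bsub>G Mod H\<^esub>}"
    show "carrier G \<subseteq> H"
    proof
      fix x assume x: "x \<in> carrier G"
      then have "H #>\<^bsub>G\<^esub> x \<in> carrier (G Mod H)" by (auto simp: FactGroup_def RCOSETS_def)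
      with * have "H #>\<^bsub>G\<^esub> x = H" by (simp add: FactGroup_def)
      then show "x \<in> H" using rcos_self[OF x assms(2)] by simp
    qed
  next
    assume "carrier G \<subseteq> H"
    then have "H = carrier G" using subgroup.subset[OF assms(2)] by blast
    then show "carrier (G Mod H) = {\<one>\<^bsub>G Mod H\<^esub>}"
      using coset_join2[OF _ assms(2)] one_closed by (auto simp: FactGroup_def RCOSETS_def)
  qed
  then show ?thesis unfolding trivial_group_def using N.factorgroup_is_group by blast
qed

context exact_IT_context
begin

lemma is_syzygy_syzygy: "X \<in> Obj \<C> \<Longrightarrow> is_syzygy \<C> \<E> X (syzygy \<C> \<E> X)"
proof -
  assume "X \<in> Obj \<C>"
  then obtain P g where "projective \<C> \<E> P" "g \<in> Hom \<C> P X" "admissible_epic \<E> g"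
    using enough_projectives by blast
  moreover from this obtain f where "(f, g) \<in> \<E>" by (auto simp: admissible_epic_def)
  ultimately have "is_syzygy \<C> \<E> X (Src \<C> f)" by (auto simp: Hom_iff intro: is_syzygyI)
  then show ?thesis unfolding syzygy_def by (rule someI)
qed

lemma nth_syzygy_syzygy: "X \<in> Obj \<C> \<Longrightarrow> nth_syzygy n X ((syzygy \<C> \<E> ^^ n) X)"
proof (induction n)
  case (Suc n)
  then have "(syzygy \<C> \<E> ^^ n) X \<in> Obj \<C>" using nth_syzygy_obj by blast
  with Suc show ?case using nth_syzygy_step is_syzygy_syzygy by simp
qed simp

lemma nth_horseshoe:
  assumes "(f, g) \<in> \<E>"
  obtains f' g' where "(f', g') \<in> \<E>" "nth_syzygy n (Src \<C> f) (Src \<C> f')"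
    "nth_syzygy n (Src \<C> g) (Src \<C> g')" "nth_syzygy n (Tgt \<C> g) (Tgt \<C> g')"
  using assms
proof (induction n arbitrary: f g thesis)
  case 0
  then show ?case using exactD(1,2)[OF 0(2)] by simp
next
  case (Suc n)
  note K = exactD(1,2)[OF Suc.prems(2)]
  obtain f1 g1 where 1: "(f1, g1) \<in> \<E>" "Src \<C> f1 = syzygy \<C> \<E> (Src \<C> f)" "Tgt \<C> g1 = syzygy \<C> \<E> (Tgt \<C> g)"
    "is_syzygy \<C> \<E> (Src \<C> g) (Src \<C> g1)"
    using horseshoe[OF Suc.prems(2) is_syzygy_syzygy is_syzygy_syzygy] K by auto
  obtain f' g' where 2: "(f', g') \<in> \<E>" "nth_syzygy n (Src \<C> f1) (Src \<C> f')"
    "nth_syzygy n (Src \<C> g1) (Src \<C> g')" "nth_syzygy n (Tgt \<C> g1) (Tgt \<C> g')"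
    by (rule Suc.IH[OF _ 1(1)])
  have "is_syzygy \<C> \<E> (Src \<C> f) (Src \<C> f1)" "is_syzygy \<C> \<E> (Tgt \<C> g) (Tgt \<C> g1)"
    using is_syzygy_syzygy K 1 by simp_all
  then show ?case using Suc.prems(1)[OF 2(1)] 1(4) 2 by auto
qed

lemma proj_dim_le_shift:
  assumes "nth_syzygy m X K"
  shows "proj_dim_le (m + n) X \<longleftrightarrow> proj_dim_le n K"
proof
  assume "proj_dim_le n K"
  then show "proj_dim_le (m + n) X" using assms nth_syzygy_trans unfolding proj_dim_le_def by blast
next
  assume *: "proj_dim_le (m + n) X"
  have L: "nth_syzygy n K ((syzygy \<C> \<E> ^^ n) K)" using nth_syzygy_syzygy nth_syzygy_obj[OF assms] by blast
  then have "projective \<C> \<E> ((syzygy \<C> \<E> ^^ n) K)" using proj_dim_leD[OF *] nth_syzygy_trans[OF assms] by blast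
  with L show "proj_dim_le n K" unfolding proj_dim_le_def by blast
qed

lemma proj_dim_le_mono: "proj_dim_le n X \<Longrightarrow> n \<le> m \<Longrightarrow> proj_dim_le m X"
proof -
  assume *: "proj_dim_le n X" "n \<le> m"
  then obtain K where K: "nth_syzygy n X K" "projective \<C> \<E> K" by (auto simp: proj_dim_le_def)
  then obtain L where L: "nth_syzygy (m - n) K L" using nth_syzygy_syzygy nth_syzygy_obj by blast
  then have "projective \<C> \<E> L" using nth_syzygy_projective K by blast
  moreover have "nth_syzygy m X L" using nth_syzygy_trans[OF K(1) L] *(2) by simp
  ultimately show ?thesis by (auto simp: proj_dim_le_def)
qed

lemma proj_dim_le_dsum_iff:
  assumes "is_dsum \<C> X Y S"
  shows "proj_dim_le n S \<longleftrightarrow> proj_dim_le n X \<and> proj_dim_le n Y"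
proof -
  have O: "X \<in> Obj \<C>" "Y \<in> Obj \<C>" using is_dsum_obj assms by blast+
  obtain K L where KL: "nth_syzygy n X K" "nth_syzygy n Y L" using nth_syzygy_syzygy O by blast
  obtain M where "nth_syzygy n S M" "is_dsum \<C> K L M" using nth_syzygy_dsum[OF KL assms] by blast
  note * = KL this
  have "projective \<C> \<E> M \<longleftrightarrow> projective \<C> \<E> K \<and> projective \<C> \<E> L"
    using *(4) projective_dsum projective_retract dsum_retract by blast
  moreover have "proj_dim_le n X \<longleftrightarrow> projective \<C> \<E> K" "proj_dim_le n Y \<longleftrightarrow> projective \<C> \<E> L"
    "proj_dim_le n S \<longleftrightarrow> projective \<C> \<E> M"
    using *(1-3) proj_dim_leD unfolding proj_dim_le_def by blast+
  ultimately show ?thesis by blast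
qed

lemma proj_dim_le_extension:
  assumes "(f, g) \<in> \<E>" "proj_dim_le n (Src \<C> f)" "proj_dim_le n (Tgt \<C> g)"
  shows "proj_dim_le n (Src \<C> g)"
proof -
  obtain f' g' where *: "(f', g') \<in> \<E>" "nth_syzygy n (Src \<C> f) (Src \<C> f')"
    "nth_syzygy n (Src \<C> g) (Src \<C> g')" "nth_syzygy n (Tgt \<C> g) (Tgt \<C> g')"
    using nth_horseshoe[OF assms(1)] by blast
  have P: "projective \<C> \<E> (Src \<C> f')" "projective \<C> \<E> (Tgt \<C> g')"
    using proj_dim_leD[OF assms(2) *(2)] proj_dim_leD[OF assms(3) *(4)] by blast+
  obtain s r where "biproduct \<C> (Src \<C> f') (Tgt \<C> g') (Src \<C> g') f' s r g'"
    by (rule projective_split[OF *(1) P(2)])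
  then have "is_dsum \<C> (Src \<C> f') (Tgt \<C> g') (Src \<C> g')" by (rule is_dsumI)
  then have "projective \<C> \<E> (Src \<C> g')" using projective_dsum P by blast
  then show ?thesis using *(3) by (auto simp: proj_dim_le_def)
qed

lemma proj_dim_le_quotient:
  assumes "(f, g) \<in> \<E>" "proj_dim_le n (Src \<C> f)" "proj_dim_le n (Src \<C> g)"
  shows "proj_dim_le (Suc n) (Tgt \<C> g)"
proof -
  obtain f' g' where *: "(f', g') \<in> \<E>" "nth_syzygy n (Src \<C> f) (Src \<C> f')"
    "nth_syzygy n (Src \<C> g) (Src \<C> g')" "nth_syzygy n (Tgt \<C> g) (Tgt \<C> g')"
    using nth_horseshoe[OF assms(1)] by blast
  have P: "projective \<C> \<E> (Src \<C> f')" "projective \<C> \<E> (Src \<C> g')"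
    using proj_dim_leD[OF assms(2) *(2)] proj_dim_leD[OF assms(3) *(3)] by blast+
  then have "is_syzygy \<C> \<E> (Tgt \<C> g') (Src \<C> f')" using *(1) is_syzygyI by blast
  then show ?thesis using nth_syzygy_step *(4) P(1) unfolding proj_dim_le_def by blast
qed

lemma ex_proj_resolution:
  assumes "X \<in> Obj \<C>"
  shows "\<exists>P d. proj_resolution \<C> \<E> X P d"
proof -
  let ?K = "\<lambda>n. (syzygy \<C> \<E> ^^ n) X"
  have "\<forall>n. \<exists>f g. (f, g) \<in> \<E> \<and> projective \<C> \<E> (Src \<C> g) \<and> Src \<C> f = ?K (Suc n) \<and> Tgt \<C> g = ?K n"
  proof
    fix n
    have "is_syzygy \<C> \<E> (?K n) (?K (Suc n))"
      using is_syzygy_syzygy nth_syzygy_obj[OF nth_syzygy_syzygy[OF assms]] by simp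
    then show "\<exists>f g. (f, g) \<in> \<E> \<and> projective \<C> \<E> (Src \<C> g) \<and> Src \<C> f = ?K (Suc n) \<and> Tgt \<C> g = ?K n"
      by (auto elim!: is_syzygyE)
  qed
  then obtain \<mu> \<epsilon> where *: "\<And>n. (\<mu> n, \<epsilon> n) \<in> \<E>" "\<And>n. projective \<C> \<E> (Src \<C> (\<epsilon> n))"
    "\<And>n. Src \<C> (\<mu> n) = ?K (Suc n)" "\<And>n. Tgt \<C> (\<epsilon> n) = ?K n"
    by metis
  have "proj_resolution \<C> \<E> X (\<lambda>n. Src \<C> (\<epsilon> n)) (\<lambda>n. \<mu> n \<bullet> \<epsilon> (Suc n))"
    unfolding proj_resolution_def
    using * exactD(1-3)[OF *(1)] by (intro conjI exI[of _ ?K] exI[of _ \<mu>] exI[of _ \<epsilon>]) (auto simp: Hom_iff)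
  then show ?thesis by blast
qed

text \<open>
  A cocycle of degree \<open>n + 1\<close> is the same as an arrow from the syzygy \<open>K\<^sub>n\<^sub>+\<^sub>1\<close>, and it is a coboundary
  if and only if this arrow extends along \<open>K\<^sub>n\<^sub>+\<^sub>1 \<rightarrow> P\<^sub>n\<close>. For the identity of \<open>K\<^sub>n\<^sub>+\<^sub>1\<close> this means that
  \<open>P\<^sub>n \<rightarrow> K\<^sub>n\<close> splits.
\<close>

lemma Ext_trivial_iff:
  assumes "X \<in> Obj \<C>"
  shows "\<exists>K. \<forall>n. nth_syzygy n X (K n) \<and>
    ((\<forall>Z \<in> Obj \<C>. trivial_group (Ext \<C> \<E> (Suc n) X Z)) \<longleftrightarrow> projective \<C> \<E> (K n))"
proof -
  obtain P d where Pd: "(SOME (P, d). proj_resolution \<C> \<E> X P d) = (P, d)" by fastforce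
  have "proj_resolution \<C> \<E> X P d"
    using someI_ex[of "\<lambda>(P, d). proj_resolution \<C> \<E> X P d"] ex_proj_resolution[OF assms] Pd by auto
  then obtain K \<mu> \<epsilon> where pr: "\<And>n. projective \<C> \<E> (P n)" and K0: "K 0 = X"
    and E: "\<And>n. (\<mu> n, \<epsilon> n) \<in> \<E>" and \<mu>: "\<And>n. \<mu> n \<in> Hom \<C> (K (Suc n)) (P n)"
    and \<epsilon>: "\<And>n. \<epsilon> n \<in> Hom \<C> (P n) (K n)" and d: "\<And>n. d n = \<mu> n \<bullet> \<epsilon> (Suc n)"
    unfolding proj_resolution_def by blast
  have T: "\<mu> n \<in> Mor \<C>" "Src \<C> (\<mu> n) = K (Suc n)" "Tgt \<C> (\<mu> n) = P n"
    "\<epsilon> n \<in> Mor \<C>" "Src \<C> (\<epsilon> n) = P n" "Tgt \<C> (\<epsilon> n) = K n" for n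
    using \<mu>[of n] \<epsilon>[of n] by (simp_all add: Hom_iff)
  have PO: "P n \<in> Obj \<C>" and KO: "K n \<in> Obj \<C>" for n using hom_obj[OF \<epsilon>] by blast+
  have nth: "nth_syzygy n X (K n)" for n
  proof (induction n)
    case (Suc n)
    have "is_syzygy \<C> \<E> (K n) (K (Suc n))" by (rule is_syzygyI[OF E]) (simp_all add: T pr)
    with Suc show ?case by (rule nth_syzygy_step)
  qed (simp add: K0 assms)
  have Ext: "trivial_group (Ext \<C> \<E> (Suc n) X Z) \<longleftrightarrow>
      (\<forall>h \<in> Hom \<C> (P (Suc n)) Z. h \<bullet> d (Suc n) = Nul \<C> (P (Suc (Suc n))) Z
          \<longrightarrow> (\<exists>k \<in> Hom \<C> (P n) Z. h = k \<bullet> d n))"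
    if Z: "Z \<in> Obj \<C>" for n Z
  proof -
    let ?G = "hom_group \<C> (P (Suc n)) Z"
    let ?C = "cocycles \<C> P d (Suc n) Z" and ?B = "coboundaries \<C> P d (Suc n) Z"
    interpret G: comm_group ?G by (rule hom_comm_group[OF PO Z])
    interpret G0: comm_group "hom_group \<C> (P n) Z" by (rule hom_comm_group[OF PO Z])
    interpret G2: comm_group "hom_group \<C> (P (Suc (Suc n))) Z" by (rule hom_comm_group[OF PO Z])
    have dM: "d m \<in> Mor \<C>" "Src \<C> (d m) = P (Suc m)" "Tgt \<C> (d m) = P m" for m
      unfolding d by (simp_all add: T)
    interpret h1: group_hom ?G "hom_group \<C> (P (Suc (Suc n))) Z" "\<lambda>h. h \<bullet> d (Suc n)"
      by unfold_locales (auto simp: hom_def Hom_iff dM)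
    interpret h0: group_hom "hom_group \<C> (P n) Z" ?G "\<lambda>h. h \<bullet> d n"
      by unfold_locales (auto simp: hom_def Hom_iff dM)
    have dd: "d n \<bullet> d (Suc n) = Nul \<C> (P (Suc (Suc n))) (P n)"
      unfolding d using exactD(5)[OF E, of "Suc n"] by (simp add: T KO PO)
    have C: "subgroup ?C ?G" unfolding cocycles_def by (rule h1.subgroup_kernel)
    have "?B = (\<lambda>h. h \<bullet> d n) ` carrier (hom_group \<C> (P n) Z)" by simp
    then have B: "subgroup ?B ?G" using h0.img_is_subgroup by simp
    have "?B \<subseteq> ?C"
    proof
      fix x assume "x \<in> ?B"
      then obtain h where h: "h \<in> Mor \<C>" "Src \<C> h = P n" "Tgt \<C> h = Z" "x = h \<bullet> d n" by (auto simp: Hom_iff)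
      then show "x \<in> ?C" using Z PO by (simp add: cocycles_def kernel_def Hom_iff dM dd)
    qed
    then have B': "subgroup ?B (?G\<lparr>carrier := ?C\<rparr>)" using G.subgroup_incl[OF B C] by blast
    have G': "comm_group (?G\<lparr>carrier := ?C\<rparr>)" 
      by (rule group.group_comm_groupI[OF G.subgroup_imp_group[OF C]])
        (use G.m_comm subgroup.subset[OF C] in auto)
    have "trivial_group (Ext \<C> \<E> (Suc n) X Z) \<longleftrightarrow> ?C \<subseteq> ?B"
      unfolding Ext_def Pd cohomology_def using trivial_quotient_iff[OF G' B'] by simp
    also have "\<dots> \<longleftrightarrow> (\<forall>h \<in> Hom \<C> (P (Suc n)) Z. h \<bullet> d (Suc n) = Nul \<C> (P (Suc (Suc n))) Z
          \<longrightarrow> (\<exists>k \<in> Hom \<C> (P n) Z. h = k \<bullet> d n))"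
      by (auto simp: cocycles_def kernel_def)
    finally show ?thesis .
  qed
  have "(\<forall>Z \<in> Obj \<C>. trivial_group (Ext \<C> \<E> (Suc n) X Z)) \<longleftrightarrow> projective \<C> \<E> (K n)" for n
  proof
    assume "\<forall>Z \<in> Obj \<C>. trivial_group (Ext \<C> \<E> (Suc n) X Z)"
    then have "\<epsilon> (Suc n) \<bullet> d (Suc n) = Nul \<C> (P (Suc (Suc n))) (K (Suc n))
      \<longrightarrow> (\<exists>k \<in> Hom \<C> (P n) (K (Suc n)). \<epsilon> (Suc n) = k \<bullet> d n)"
      using Ext[of "K (Suc n)" n] KO \<epsilon> by blast
    moreover have "\<epsilon> (Suc n) \<bullet> d (Suc n) = Nul \<C> (P (Suc (Suc n))) (K (Suc n))"
      unfolding d using exactD(5)[OF E, of "Suc n"] by (simp add: T KO PO)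
    ultimately obtain k where k: "k \<in> Mor \<C>" "Src \<C> k = P n" "Tgt \<C> k = K (Suc n)" "\<epsilon> (Suc n) = k \<bullet> d n"
      by (auto simp: Hom_iff)
    have k\<mu>: "k \<bullet> \<mu> n = Idn \<C> (K (Suc n))"
      by (rule cokernel_epic[OF exact_cokernel[OF E[of "Suc n"]]])
        (use k(1-3) k(4)[symmetric, unfolded d] in \<open>simp_all add: T KO\<close>)
    define e where "e = Idn \<C> (P n) \<boxplus> neg (\<mu> n \<bullet> k)"
    have e: "e \<in> Mor \<C>" "Src \<C> e = P n" "Tgt \<C> e = P n" unfolding e_def using k by (simp_all add: T PO)
    have "e \<bullet> \<mu> n = Nul \<C> (K (Suc n)) (P n)"
      unfolding e_def using k k\<mu> by (simp add: T PO KO)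
    then obtain s where s: "s \<in> Mor \<C>" "Src \<C> s = K n" "Tgt \<C> s = P n" "s \<bullet> \<epsilon> n = e"
      using cokernel_lift[OF exact_cokernel[OF E[of n]], of e] e by (auto simp: T)
    have "\<epsilon> n \<bullet> (s \<bullet> \<epsilon> n) = \<epsilon> n"
      unfolding s(4) e_def using k exactD(5)[OF E, of n] by (simp add: T PO KO)
    then have "\<epsilon> n \<bullet> s = Idn \<C> (K n)"
      by (intro cokernel_epic[OF exact_cokernel[OF E[of n]], of "\<epsilon> n \<bullet> s" "Idn \<C> (K n)"])
        (use s(1-3) in \<open>simp_all add: T KO\<close>)
    then have "retract (K n) (P n)" by (intro retractI[of s "\<epsilon> n"]) (simp_all add: s T)
    then show "projective \<C> \<E> (K n)" by (rule projective_retract[OF pr])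
  next
    assume "projective \<C> \<E> (K n)"
    then obtain s r where B: "biproduct \<C> (K (Suc n)) (K n) (P n) (\<mu> n) s r (\<epsilon> n)"
      using projective_split[OF E[of n]] by (auto simp: T)
    note B = biprodD[OF B]
    show "\<forall>Z \<in> Obj \<C>. trivial_group (Ext \<C> \<E> (Suc n) X Z)"
    proof (intro ballI, subst Ext, assumption, intro ballI impI)
      fix Z h assume "Z \<in> Obj \<C>" "h \<in> Hom \<C> (P (Suc n)) Z" and hd: "h \<bullet> d (Suc n) = Nul \<C> (P (Suc (Suc n))) Z"
      then have h: "h \<in> Mor \<C>" "Src \<C> h = P (Suc n)" "Tgt \<C> h = Z" "Z \<in> Obj \<C>" by (simp_all add: Hom_iff)
      have "h \<bullet> \<mu> (Suc n) = Nul \<C> (K (Suc (Suc n))) Z"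
        by (rule cokernel_epic[OF exact_cokernel[OF E[of "Suc (Suc n)"]]])
          (use h hd[unfolded d] in \<open>simp_all add: T KO\<close>)
      then obtain u where u: "u \<in> Mor \<C>" "Src \<C> u = K (Suc n)" "Tgt \<C> u = Z" "u \<bullet> \<epsilon> (Suc n) = h"
        using cokernel_lift[OF exact_cokernel[OF E[of "Suc n"]], of h] h by (auto simp: T)
      show "\<exists>k \<in> Hom \<C> (P n) Z. h = k \<bullet> d n"
        unfolding d by (rule bexI[of _ "u \<bullet> r"]) (use u B in \<open>simp_all add: Hom_iff T\<close>)
    qed
  qed
  with nth show ?thesis by blast
qed

lemma pd_le_iff:
  assumes "X \<in> Obj \<C>"
  shows "pd \<C> \<E> X \<le> enat n \<longleftrightarrow> proj_dim_le n X"
proof -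
  obtain K where K: "\<And>n. nth_syzygy n X (K n)"
    "\<And>n. (\<forall>Z \<in> Obj \<C>. trivial_group (Ext \<C> \<E> (Suc n) X Z)) \<longleftrightarrow> projective \<C> \<E> (K n)"
    using Ext_trivial_iff[OF assms] by blast
  let ?S = "{n. \<forall>j>n. \<forall>Z \<in> Obj \<C>. trivial_group (Ext \<C> \<E> j X Z)}"
  have P: "projective \<C> \<E> (K m) \<longleftrightarrow> proj_dim_le m X" for m
    using K(1) proj_dim_leD unfolding proj_dim_le_def by blast
  have S: "m \<in> ?S \<longleftrightarrow> proj_dim_le m X" for m
  proof
    assume "m \<in> ?S"
    then have "\<forall>Z \<in> Obj \<C>. trivial_group (Ext \<C> \<E> (Suc m) X Z)" by blast
    then show "proj_dim_le m X" using K(2) P by blast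
  next
    assume m: "proj_dim_le m X"
    have "\<forall>Z \<in> Obj \<C>. trivial_group (Ext \<C> \<E> j X Z)" if jm: "j > m" for j
    proof -
      obtain i where i: "j = Suc i" "m \<le> i"
        using less_imp_Suc_add[OF jm] by auto
      then show ?thesis using K(2)[of i] P proj_dim_le_mono[OF m] by blast
    qed
    then show "m \<in> ?S" by blast
  qed
  show ?thesis
  proof
    assume *: "pd \<C> \<E> X \<le> enat n"
    have "\<exists>m\<in>?S. m \<le> n"
    proof (rule ccontr)
      assume "\<not> (\<exists>m\<in>?S. m \<le> n)"
      then have "enat (Suc n) \<le> enat m" if "m \<in> ?S" for m
        using that unfolding enat_ord_simps Suc_le_eq by (meson not_le)
      then have "enat (Suc n) \<le> pd \<C> \<E> X" unfolding pd_def by (rule INF_greatest)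
      also note *
      finally have "enat (Suc n) \<le> enat n" .
      then show False by simp
    qed
    then show "proj_dim_le n X" using S proj_dim_le_mono by blast
  next
    assume "proj_dim_le n X"
    then show "pd \<C> \<E> X \<le> enat n" unfolding pd_def using S by (intro INF_lower) blast
  qed
qed

lemma pd_finite_iff:
  assumes "X \<in> Obj \<C>"
  shows "pd \<C> \<E> X < \<infinity> \<longleftrightarrow> (\<exists>n. proj_dim_le n X)"
proof
  assume "pd \<C> \<E> X < \<infinity>"
  then obtain n where "pd \<C> \<E> X = enat n" by (cases "pd \<C> \<E> X") auto
  then show "\<exists>n. proj_dim_le n X" using pd_le_iff[OF assms, of n] by auto
next
  assume "\<exists>n. proj_dim_le n X"
  then obtain n where "pd \<C> \<E> X \<le> enat n" using pd_le_iff[OF assms] by blast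
  then show "pd \<C> \<E> X < \<infinity>" using enat_ord_simps(4) le_less_trans by blast
qed

end

section \<open>Krull--Schmidt decompositions\<close>

lemma (in additive_category) monoid_end_ring:
  assumes "X \<in> Obj \<C>"
  shows "monoid (end_ring \<C> X)"
  by unfold_locales (use assms in \<open>auto simp: end_ring_def Hom_iff\<close>)

lemma end_ring_simps [simp]:
  "carrier (end_ring \<C> X) = Hom \<C> X X" "monoid.mult (end_ring \<C> X) = Cmp \<C>"
  "monoid.one (end_ring \<C> X) = Idn \<C> X" "ring.zero (end_ring \<C> X) = Nul \<C> X X"
  "ring.add (end_ring \<C> X) = Add \<C>"
  by (simp_all add: end_ring_def)

context additive_category
begin

definition local_object where
  "local_object Y \<longleftrightarrow> Y \<in> Obj \<C> \<and> local_ring (end_ring \<C> Y)"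

lemma local_object_sum_idn:
  assumes "local_object Y" "x \<in> Hom \<C> Y Y" "y \<in> Hom \<C> Y Y" "x \<boxplus> y = Idn \<C> Y"
  shows "iso_arrow \<C> x \<or> iso_arrow \<C> y"
proof -
  let ?R = "end_ring \<C> Y"
  have *: "iso_arrow \<C> a \<longleftrightarrow> a \<in> Units ?R" if "a \<in> Hom \<C> Y Y" for a
    using that by (auto simp: iso_arrow_def Units_def Hom_iff)
  have "Idn \<C> Y \<in> Units ?R"
    using assms(1) *[of "Idn \<C> Y"] by (simp add: local_object_def Hom_iff)
  moreover have "\<forall>a \<in> Hom \<C> Y Y - Units ?R. \<forall>b \<in> Hom \<C> Y Y - Units ?R. a \<boxplus> b \<notin> Units ?R"
    using assms(1) by (simp add: local_object_def local_ring_def)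
  ultimately have "x \<in> Units ?R \<or> y \<in> Units ?R"
    using assms(2-4) by (metis DiffI)
  then show ?thesis using * assms by blast
qed

lemma local_object_nonzero: "local_object Y \<Longrightarrow> \<not> zero_object \<C> Y"
  by (auto simp: local_object_def local_ring_def zero_object_iff)

text \<open>A nonzero idempotent of a local ring is \<open>1\<close>.\<close>

lemma retract_of_local:
  assumes "local_object X" "\<not> zero_object \<C> Y" "i \<in> Hom \<C> Y X" "p \<in> Hom \<C> X Y" "p \<bullet> i = Idn \<C> Y"
  shows "inverse_arrows i p"
proof -
  have T: "i \<in> Mor \<C>" "Src \<C> i = Y" "Tgt \<C> i = X" "p \<in> Mor \<C>" "Src \<C> p = X" "Tgt \<C> p = Y"
    "X \<in> Obj \<C>" "Y \<in> Obj \<C>"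
    using assms(3,4) hom_obj[OF assms(3)] by (simp_all add: Hom_iff)
  have pi: "p \<bullet> (i \<bullet> f) = f" if "f \<in> Mor \<C>" "Tgt \<C> f = Y" for f
    using cmp_eq_assoc[OF assms(5)] T that by simp
  let ?e' = "Idn \<C> X \<boxplus> neg (i \<bullet> p)"
  have "i \<bullet> p \<boxplus> ?e' = ?e' \<boxplus> i \<bullet> p" by (rule add_comm) (simp_all add: T)
  also have "\<dots> = Idn \<C> X" by (simp add: T)
  finally have "iso_arrow \<C> (i \<bullet> p) \<or> iso_arrow \<C> ?e'"
    by (intro local_object_sum_idn[OF assms(1)]) (simp_all add: T Hom_iff)
  then have "i \<bullet> p = Idn \<C> X"
  proof
    assume "iso_arrow \<C> (i \<bullet> p)"
    then obtain a where a: "inverse_arrows (i \<bullet> p) a" by (auto simp: iso_arrow_iff)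
    note A = inverse_arrowsD[OF a]
    have "a \<bullet> ((i \<bullet> p) \<bullet> (i \<bullet> p)) = i \<bullet> p" using A(7) T by simp
    moreover have "a \<bullet> ((i \<bullet> p) \<bullet> (i \<bullet> p)) = a \<bullet> (i \<bullet> p)" using T by (simp add: pi)
    moreover have "a \<bullet> (i \<bullet> p) = Idn \<C> X" using A(5) T by simp
    ultimately show ?thesis by simp
  next
    assume "iso_arrow \<C> ?e'"
    then obtain a where a: "inverse_arrows ?e' a" by (auto simp: iso_arrow_iff)
    note A = inverse_arrowsD[OF a]
    have S: "Src \<C> ?e' = X" "Tgt \<C> ?e' = X" using T by simp_all
    have "a \<bullet> (?e' \<bullet> (i \<bullet> p)) = i \<bullet> p" using A(7) S T by simp
    moreover have "?e' \<bullet> (i \<bullet> p) = Nul \<C> X X" using T by (simp add: pi)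
    ultimately have N: "i \<bullet> p = Nul \<C> X X" using A(2-4) S T by simp
    have "Idn \<C> Y = p \<bullet> ((i \<bullet> p) \<bullet> i)" using T by (simp add: pi assms(5))
    also have "\<dots> = Nul \<C> Y Y" unfolding N using T by simp
    finally show ?thesis using assms(2) T by (simp add: zero_object_iff)
  qed
  then show ?thesis using T assms(5) by (simp add: inverse_arrows_def Hom_iff)
qed

lemma iso_cmp_retract:
  assumes "iso_arrow \<C> (b \<bullet> a)" "a \<in> Mor \<C>" "b \<in> Mor \<C>" "Src \<C> a = Y" "Tgt \<C> a = X"
    "Src \<C> b = X" "Tgt \<C> b = Y"
  shows "retract Y X"
proof -
  obtain c where c: "inverse_arrows (b \<bullet> a) c" using assms(1) by (auto simp: iso_arrow_iff)
  note C = inverse_arrowsD[OF c]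
  show ?thesis by (rule retractI[of a "c \<bullet> b"]) (use assms C in simp_all)
qed

text \<open>The identity of \<open>L\<close> is the sum of its routes through \<open>X\<close> and through \<open>Y\<close>, one of which is invertible.\<close>

lemma local_retract_sum:
  assumes "local_object L" "biproduct \<C> X Y S i1 i2 p1 p2" "i \<in> Hom \<C> L S" "p \<in> Hom \<C> S L"
    "p \<bullet> i = Idn \<C> L"
  shows "retract L X \<or> retract L Y"
proof -
  note B = biprodD[OF assms(2)]
  have T: "i \<in> Mor \<C>" "Src \<C> i = L" "Tgt \<C> i = S" "p \<in> Mor \<C>" "Src \<C> p = S" "Tgt \<C> p = L" "L \<in> Obj \<C>"
    using assms(3,4) hom_obj[OF assms(3)] by (simp_all add: Hom_iff)
  have "p \<bullet> (i1 \<bullet> (p1 \<bullet> i)) \<boxplus> p \<bullet> (i2 \<bullet> (p2 \<bullet> i)) = p \<bullet> ((i1 \<bullet> p1 \<boxplus> i2 \<bullet> p2) \<bullet> i)"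
    using T by (simp add: B(1-19,21-24))
  also have "\<dots> = Idn \<C> L" unfolding B(20) using T assms(5) by simp
  finally have "iso_arrow \<C> (p \<bullet> (i1 \<bullet> (p1 \<bullet> i))) \<or> iso_arrow \<C> (p \<bullet> (i2 \<bullet> (p2 \<bullet> i)))"
    by (intro local_object_sum_idn[OF assms(1)]) (simp_all add: T B Hom_iff)
  then show ?thesis
    using iso_cmp_retract[of "p \<bullet> i1" "p1 \<bullet> i" L X] iso_cmp_retract[of "p \<bullet> i2" "p2 \<bullet> i" L Y] T by (auto simp: B)
qed

end

context strong_exact_IT_context
begin

text \<open>
  Idempotents split: for an idempotent, the automorphism in Fitting's decomposition is the identity and
  the nilpotent endomorphism is zero.
\<close>

lemma retract_complement:
  assumes "i \<in> Hom \<C> Y X" "p \<in> Hom \<C> X Y" "p \<bullet> i = Idn \<C> Y"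
  obtains Z k q where "biproduct \<C> Y Z X i k p q"
proof -
  have T: "i \<in> Mor \<C>" "Src \<C> i = Y" "Tgt \<C> i = X" "p \<in> Mor \<C>" "Src \<C> p = X" "Tgt \<C> p = Y"
    "X \<in> Obj \<C>" "Y \<in> Obj \<C>"
    using assms(1,2) hom_obj[OF assms(1)] by (simp_all add: Hom_iff)
  have pi: "p \<bullet> (i \<bullet> f) = f" if "f \<in> Mor \<C>" "Tgt \<C> f = Y" for f
    using cmp_eq_assoc[OF assms(3)] T that by simp
  define e where "e = i \<bullet> p"
  have e: "e \<in> Mor \<C>" "Src \<C> e = X" "Tgt \<C> e = X" "e \<bullet> e = e" unfolding e_def using T by (simp_all add: pi)
  obtain Y' Z i1 i2 p1 p2 \<theta> \<alpha> n where bp: "biproduct \<C> Y' Z X i1 i2 p1 p2" and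
    \<theta>: "\<theta> \<in> Hom \<C> Y' Y'" "iso_arrow \<C> \<theta>" and \<alpha>: "\<alpha> \<in> Hom \<C> Z Z" "\<alpha> [^]\<^bsub>end_ring \<C> Z\<^esub> (n::nat) = Nul \<C> Z Z"
    and e12: "e = i1 \<bullet> \<theta> \<bullet> p1 \<boxplus> i2 \<bullet> \<alpha> \<bullet> p2"
    using fitting[of e X] e by (auto simp: Hom_iff)
  note B = biprodD[OF bp]
  have TT: "\<theta> \<in> Mor \<C>" "Src \<C> \<theta> = Y'" "Tgt \<C> \<theta> = Y'" "\<alpha> \<in> Mor \<C>" "Src \<C> \<alpha> = Z" "Tgt \<C> \<alpha> = Z"
    using \<theta> \<alpha> by (simp_all add: Hom_iff)
  have "p1 \<bullet> (e \<bullet> e) \<bullet> i1 = p1 \<bullet> e \<bullet> i1" "p2 \<bullet> (e \<bullet> e) \<bullet> i2 = p2 \<bullet> e \<bullet> i2" by (simp_all only: e(4))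
  then have \<theta>\<theta>: "\<theta> \<bullet> \<theta> = \<theta>" and \<alpha>\<alpha>: "\<alpha> \<bullet> \<alpha> = \<alpha>" unfolding e12 by (simp_all add: B TT)
  obtain \<theta>' where "inverse_arrows \<theta> \<theta>'" using \<theta>(2) by (auto simp: iso_arrow_iff)
  note I = inverse_arrowsD[OF this]
  have \<theta>1: "\<theta> = Idn \<C> Y'"
    using I(7)[rule_format, of \<theta>] I(5) \<theta>\<theta> TT by simp
  interpret Z: monoid "end_ring \<C> Z" using monoid_end_ring B(2) by blast
  have "\<alpha> [^]\<^bsub>end_ring \<C> Z\<^esub> Suc m = \<alpha>" for m :: nat
  proof (induction m)
    case 0
    show ?case using TT by simp
  next
    case (Suc m)
    then show ?case using \<alpha>\<alpha> by simp
  qed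
  from this[of n] have "Nul \<C> Z Z \<bullet> \<alpha> = \<alpha>" using \<alpha>(2) by simp
  then have \<alpha>0: "\<alpha> = Nul \<C> Z Z" using TT B(2) by simp
  have e1: "i \<bullet> p = i1 \<bullet> p1" using e12 unfolding e_def \<theta>1 \<alpha>0 by (simp add: B)
  have e1': "i \<bullet> (p \<bullet> f) = i1 \<bullet> (p1 \<bullet> f)" if "f \<in> Mor \<C>" "Tgt \<C> f = X" for f
    using cmp_eq_assoc[OF e1] T that by (simp add: B)
  have "p2 \<bullet> i = p2 \<bullet> (i \<bullet> (p \<bullet> i))" using T by (simp add: assms(3))
  also have "\<dots> = Nul \<C> Y Z" using T by (simp add: e1' B)
  finally have 1: "p2 \<bullet> i = Nul \<C> Y Z" .
  have "p \<bullet> i2 = p \<bullet> (i \<bullet> (p \<bullet> i2))" using T by (simp add: pi B)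
  also have "\<dots> = Nul \<C> Z Y" using T by (simp add: e1' B)
  finally have 2: "p \<bullet> i2 = Nul \<C> Z Y" .
  have "biproduct \<C> Y Z X i i2 p p2"
    by (rule biproductI) (use T assms(3) 1 2 e1 in \<open>simp_all add: B\<close>)
  then show thesis by (rule that)
qed

lemma retract_direct_summand:
  assumes "retract Y X"
  obtains Z where "is_dsum \<C> Y Z X"
  using assms retract_complement is_dsumI unfolding retract_def by metis

text \<open>
  If \<open>M\<close> returns invertibly through the other copy of \<open>M\<close>, then its component \<open>q1 i1\<close> is invertible, so by Gaussian elimination \<open>X\<close> and
  \<open>Y\<close> are complements of the same summand \<open>M\<close>.
\<close>

lemma local_cancel_case:
  assumes "local_object M" "biproduct \<C> M X S i1 i2 p1 p2" "biproduct \<C> M Y S j1 j2 q1 q2"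
    "iso_arrow \<C> (p1 \<bullet> j1 \<bullet> q1 \<bullet> i1)"
  shows "isomorphic X Y"
proof -
  note B = biprodD[OF assms(2)] biprodD[OF assms(3)]
  obtain a where "inverse_arrows (p1 \<bullet> j1 \<bullet> q1 \<bullet> i1) a" using assms(4) by (auto simp: iso_arrow_iff)
  note A = inverse_arrowsD[OF this]
  have "inverse_arrows (q1 \<bullet> i1) (a \<bullet> (p1 \<bullet> j1))"
    by (rule retract_of_local[OF assms(1) local_object_nonzero[OF assms(1)]])
      (use A in \<open>simp_all add: B Hom_iff\<close>)
  then have "biproduct \<C> M Y S i1 j2 (a \<bullet> (p1 \<bullet> j1) \<bullet> q1) (q2 \<boxplus> neg (q2 \<bullet> i1 \<bullet> (a \<bullet> (p1 \<bullet> j1)) \<bullet> q1))"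
    by (intro biproduct_gauss[OF assms(3)]) (simp_all add: B Hom_iff)
  then show ?thesis by (rule biproduct_complement_unique[OF assms(2)])
qed

text \<open>
  The identity of \<open>M\<close> is the sum of its routes through \<open>M\<close> and through \<open>Y\<close>, one of which is invertible. In the second
  case \<open>M\<close> is a summand of \<open>Y\<close>, and that copy of \<open>M\<close> may be exchanged with the first one.
\<close>

lemma local_cancel:
  assumes "local_object M" "is_dsum \<C> M X S" "is_dsum \<C> M Y S"
  shows "isomorphic X Y"
proof -
  obtain i1 i2 p1 p2 where 1: "biproduct \<C> M X S i1 i2 p1 p2" using assms(2) by (rule is_dsumE)
  obtain j1 j2 q1 q2 where 2: "biproduct \<C> M Y S j1 j2 q1 q2" using assms(3) by (rule is_dsumE)
  note B = biprodD[OF 1] biprodD[OF 2]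
  have "(p1 \<bullet> j1 \<bullet> q1 \<bullet> i1) \<boxplus> (p1 \<bullet> j2 \<bullet> q2 \<bullet> i1) = p1 \<bullet> (j1 \<bullet> q1 \<boxplus> j2 \<bullet> q2) \<bullet> i1"
    by (simp add: B(1-43,45-))
  also have "\<dots> = Idn \<C> M" by (simp add: B)
  finally have "iso_arrow \<C> (p1 \<bullet> j1 \<bullet> q1 \<bullet> i1) \<or> iso_arrow \<C> (p1 \<bullet> j2 \<bullet> q2 \<bullet> i1)"
    by (intro local_object_sum_idn[OF assms(1)]) (simp_all add: B Hom_iff)
  then show ?thesis
  proof
    assume "iso_arrow \<C> (p1 \<bullet> j1 \<bullet> q1 \<bullet> i1)"
    then show ?thesis by (rule local_cancel_case[OF assms(1) 1 2])
  next
    assume "iso_arrow \<C> (p1 \<bullet> j2 \<bullet> q2 \<bullet> i1)"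
    then obtain a where "inverse_arrows (p1 \<bullet> j2 \<bullet> q2 \<bullet> i1) a" by (auto simp: iso_arrow_iff)
    note A = inverse_arrowsD[OF this]
    define c where "c = q2 \<bullet> i1"
    define r where "r = a \<bullet> (p1 \<bullet> j2)"
    have c: "c \<in> Hom \<C> M Y" "r \<in> Hom \<C> Y M" "r \<bullet> c = Idn \<C> M"
      unfolding c_def r_def using A by (simp_all add: B Hom_iff)
    then obtain Y' k r' where 3: "biproduct \<C> M Y' Y c k r r'" by (rule retract_complement)
    note B3 = biprodD[OF 3]
    obtain V where V: "is_dsum \<C> Y' M V" using ex_dsum B3(1,2) by blast
    then obtain k1 k2 r1 r2 where 4: "biproduct \<C> Y' M V k1 k2 r1 r2" by (rule is_dsumE)
    note 5 = biproduct_assoc[OF biproduct_swap[OF 2] 3 4]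
    have "r \<bullet> q2 \<bullet> i1 = Idn \<C> M" using c(3) unfolding c_def by (simp add: B B3)
    then have "p1 \<bullet> (j2 \<bullet> c) \<bullet> (r \<bullet> q2) \<bullet> i1 = p1 \<bullet> j2 \<bullet> q2 \<bullet> i1"
      by (simp add: B B3) (simp add: c_def B)
    then have "iso_arrow \<C> (p1 \<bullet> (j2 \<bullet> c) \<bullet> (r \<bullet> q2) \<bullet> i1)" using \<open>iso_arrow \<C> (p1 \<bullet> j2 \<bullet> q2 \<bullet> i1)\<close> by simp
    then have "isomorphic X V" by (rule local_cancel_case[OF assms(1) 1 5])
    moreover have "isomorphic V Y" using V is_dsumI[OF 3] is_dsum_comm is_dsum_unique by blast
    ultimately show ?thesis by (rule isomorphic_trans)
  qed
qed

lemma cmp_finprod_cmp: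
  assumes "finite A" "q \<in> Hom \<C> S Y" "k \<in> Hom \<C> X S" "\<And>a. a \<in> A \<Longrightarrow> f a \<in> Hom \<C> S S"
  shows "q \<bullet> (finprod (hom_group \<C> S S) f A \<bullet> k) = finprod (hom_group \<C> X Y) (\<lambda>a. q \<bullet> (f a \<bullet> k)) A
    \<and> finprod (hom_group \<C> S S) f A \<in> Hom \<C> S S"
proof -
  have O: "S \<in> Obj \<C>" "X \<in> Obj \<C>" "Y \<in> Obj \<C>" using assms(2,3) hom_obj by blast+
  interpret G: comm_group "hom_group \<C> S S" using hom_comm_group O by blast
  interpret H: comm_group "hom_group \<C> X Y" using hom_comm_group O by blast
  have T: "q \<in> Mor \<C>" "Src \<C> q = S" "Tgt \<C> q = Y" "k \<in> Mor \<C>" "Src \<C> k = X" "Tgt \<C> k = S"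
    using assms(2,3) by (simp_all add: Hom_iff)
  show ?thesis
    using assms(1,4)
  proof (induction A)
    case empty
    show ?case using T O by (simp add: Hom_iff)
  next
    case (insert a A)
    have fH: "f x \<in> Mor \<C>" "Src \<C> (f x) = S" "Tgt \<C> (f x) = S" if "x \<in> insert a A" for x
      using insert.prems[OF that] by (simp_all add: Hom_iff)
    have 1: "finprod (hom_group \<C> S S) f (insert a A) = f a \<boxplus> finprod (hom_group \<C> S S) f A"
      using G.finprod_insert[OF insert.hyps, of f] insert.prems by auto
    have IH: "q \<bullet> (finprod (hom_group \<C> S S) f A \<bullet> k) = finprod (hom_group \<C> X Y) (\<lambda>a. q \<bullet> (f a \<bullet> k)) A"
      "finprod (hom_group \<C> S S) f A \<in> Hom \<C> S S"
      using insert.IH insert.prems by auto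
    have 2: "finprod (hom_group \<C> X Y) (\<lambda>a. q \<bullet> (f a \<bullet> k)) (insert a A)
        = q \<bullet> (f a \<bullet> k) \<boxplus> finprod (hom_group \<C> X Y) (\<lambda>a. q \<bullet> (f a \<bullet> k)) A"
      using H.finprod_insert[OF insert.hyps, of "\<lambda>a. q \<bullet> (f a \<bullet> k)"] T fH by (auto simp: Hom_iff)
    show ?case unfolding 1 2 IH(1)[symmetric] using IH(2) T fH[of a] by (simp add: Hom_iff)
  qed
qed

text \<open>
  Induction along a decomposition into objects with local endomorphism rings. The last summand is
  split off by splitting an idempotent, and its complement decomposes into the remaining ones.
\<close>

lemma is_finite_dsum_induct:
  assumes "is_finite_dsum \<C> n Y X" "\<forall>k<n. local_ring (end_ring \<C> (Y k))"
    and zero: "\<And>Z. zero_object \<C> Z \<Longrightarrow> Q Z"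
    and step: "\<And>X L S. Q X \<Longrightarrow> local_object L \<Longrightarrow> is_dsum \<C> X L S \<Longrightarrow> Q S"
  shows "Q X"
  using assms(1,2)
proof (induction n arbitrary: X)
  case 0
  then have X: "X \<in> Obj \<C>" by (simp add: is_finite_dsum_def)
  interpret G: comm_group "hom_group \<C> X X" using hom_comm_group X by blast
  have "zero_object \<C> X" using 0 by (auto simp: is_finite_dsum_def zero_object_iff)
  then show ?case by (rule zero)
next
  case (Suc n)
  then obtain i p where X: "X \<in> Obj \<C>" and Y: "\<forall>k<Suc n. Y k \<in> Obj \<C>"
    and ip: "\<forall>k<Suc n. i k \<in> Hom \<C> (Y k) X \<and> p k \<in> Hom \<C> X (Y k)"
    and d: "\<forall>k<Suc n. \<forall>l<Suc n. p l \<bullet> i k = (if k = l then Idn \<C> (Y k) else Nul \<C> (Y k) (Y l))"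
    and s: "finprod (hom_group \<C> X X) (\<lambda>k. i k \<bullet> p k) {..<Suc n} = Idn \<C> X"
    unfolding is_finite_dsum_def by blast
  have T: "i k \<in> Mor \<C>" "Src \<C> (i k) = Y k" "Tgt \<C> (i k) = X" "p k \<in> Mor \<C>" "Src \<C> (p k) = X"
    "Tgt \<C> (p k) = Y k" "Y k \<in> Obj \<C>" if "k < Suc n" for k
    using ip Y that by (simp_all add: Hom_iff)
  obtain X' k q where bp: "biproduct \<C> (Y n) X' X (i n) k (p n) q"
    by (rule retract_complement[of "i n" "Y n" X "p n"]) (use ip d in auto)
  note B = biprodD[OF bp]
  have Bk: "k \<in> Mor \<C>" "Src \<C> k = X'" "Tgt \<C> k = X" "q \<in> Mor \<C>" "Src \<C> q = X" "Tgt \<C> q = X'"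
    "X' \<in> Obj \<C>" "q \<bullet> k = Idn \<C> X'" "p n \<bullet> k = Nul \<C> X' (Y n)"
    using B by simp_all
  have pn: "p l \<bullet> (i m \<bullet> f) = Nul \<C> (Src \<C> f) (Y l)" if "l < Suc n" "m < Suc n" "l \<noteq> m" "f \<in> Mor \<C>" "Tgt \<C> f = Y m" for l m f
  proof -
    have "p l \<bullet> i m = Nul \<C> (Y m) (Y l)" using d that by auto
    from cmp_eq_assoc[OF this] show ?thesis using T[of l] T[of m] that by simp
  qed
  have kq: "k \<bullet> (q \<bullet> f) = f \<boxplus> neg (i n \<bullet> (p n \<bullet> f))" if "f \<in> Mor \<C>" "Tgt \<C> f = X" for f
    by (rule biprod_into_eqI[OF bp]) (use that T[of n] Bk in \<open>simp_all add: B\<close>)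
  have "is_finite_dsum \<C> n Y X'"
    unfolding is_finite_dsum_def
  proof (rule conjI[OF Bk(7)], rule conjI, goal_cases)
    case 1
    show ?case using T by simp
  next
    case 2
    show ?case
    proof (rule exI[of _ "\<lambda>l. q \<bullet> i l"], rule exI[of _ "\<lambda>l. p l \<bullet> k"], intro conjI allI impI)
      fix l assume l: "l < n"
      then show "q \<bullet> i l \<in> Hom \<C> (Y l) X'" "p l \<bullet> k \<in> Hom \<C> X' (Y l)"
        using T[of l] Bk by (simp_all add: Hom_iff)
      fix m assume m: "m < n"
      have "p m \<bullet> (k \<bullet> (q \<bullet> i l)) = p m \<bullet> i l"
        using T[of l] T[of m] T[of n] l m d X by (simp add: kq pn)
      then show "(p m \<bullet> k) \<bullet> (q \<bullet> i l) = (if l = m then Idn \<C> (Y l) else Nul \<C> (Y l) (Y m))"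
        using T[of l] T[of m] l m d Bk by simp
    next
      interpret G: comm_group "hom_group \<C> X X" using hom_comm_group X by blast
      interpret H: comm_group "hom_group \<C> X' X'" using hom_comm_group Bk by blast
      let ?F = "finprod (hom_group \<C> X X) (\<lambda>k. i k \<bullet> p k) {..<n}"
      have in_hom: "(\<lambda>l. i l \<bullet> p l) \<in> {..<n} \<rightarrow> Hom \<C> X X" "i n \<bullet> p n \<in> Hom \<C> X X"
        using T by (auto simp: Hom_iff)
      have F: "i n \<bullet> p n \<boxplus> ?F = Idn \<C> X"
        using s G.finprod_insert[of "{..<n}" n "\<lambda>k. i k \<bullet> p k"] in_hom by (simp add: lessThan_Suc)
      have fc: "q \<bullet> (?F \<bullet> k) = finprod (hom_group \<C> X' X') (\<lambda>a. q \<bullet> ((i a \<bullet> p a) \<bullet> k)) {..<n} \<and> ?F \<in> Hom \<C> X X"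
        by (rule cmp_finprod_cmp) (use T Bk in \<open>auto simp: Hom_iff\<close>)
      have "finprod (hom_group \<C> X' X') (\<lambda>l. (q \<bullet> i l) \<bullet> (p l \<bullet> k)) {..<n}
          = finprod (hom_group \<C> X' X') (\<lambda>l. q \<bullet> ((i l \<bullet> p l) \<bullet> k)) {..<n}"
        by (rule H.finprod_cong') (use T Bk in \<open>auto simp: Hom_iff\<close>)
      also have "\<dots> = q \<bullet> (?F \<bullet> k)" using fc by simp
      also have "\<dots> = q \<bullet> ((i n \<bullet> p n \<boxplus> ?F) \<bullet> k)" using fc T[of n] Bk by (simp add: Hom_iff)
      also have "\<dots> = Idn \<C> X'" unfolding F using Bk by simp
      finally show "finprod (hom_group \<C> X' X') (\<lambda>l. (q \<bullet> i l) \<bullet> (p l \<bullet> k)) {..<n} = Idn \<C> X'" .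
    qed
  qed
  then have "Q X'" using Suc by simp
  moreover have "local_object (Y n)" using Suc.prems(2) Y by (simp add: local_object_def)
  moreover have "is_dsum \<C> X' (Y n) X" using is_dsum_comm[OF is_dsumI[OF bp]] .
  ultimately show ?case by (rule step)
qed

lemma local_sum_induct [consumes 1, case_names zero step]:
  assumes "X \<in> Obj \<C>"
    and "\<And>Z. zero_object \<C> Z \<Longrightarrow> Q Z"
    and "\<And>X L S. Q X \<Longrightarrow> local_object L \<Longrightarrow> is_dsum \<C> X L S \<Longrightarrow> Q S"
  shows "Q X"
  using krull_schmidt[OF assms(1)] is_finite_dsum_induct[of _ _ X Q] assms(2,3) by blast

lemma dsum_cancel:
  assumes "W \<in> Obj \<C>" "X \<in> Obj \<C>" "Y \<in> Obj \<C>"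
    "isoclass \<C> W \<star> isoclass \<C> X = isoclass \<C> W \<star> isoclass \<C> Y"
  shows "isoclass \<C> X = isoclass \<C> Y"
  using assms
proof (induction W arbitrary: X Y rule: local_sum_induct)
  case (zero Z)
  then show ?case using isoclass_zero[OF zero(1)] by (simp add: dsum_set_comm)
next
  case (step W L S)
  have L: "L \<in> Obj \<C>" "W \<in> Obj \<C>" using is_dsum_obj step by blast+
  obtain U V where UV: "is_dsum \<C> L X U" "is_dsum \<C> L Y V" using ex_dsum L step by meson
  note c = isoclass_dsum[OF UV(1)] isoclass_dsum[OF UV(2)] isoclass_dsum[OF step(3)]
  have "isoclass \<C> W \<star> isoclass \<C> U = isoclass \<C> W \<star> isoclass \<C> V"
    using step(6) unfolding c[symmetric] by (simp only: dsum_set_assoc)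
  then have "isoclass \<C> U = isoclass \<C> V" using step.IH UV is_dsum_obj by blast
  then have "isomorphic V U" using isoclass_eq isomorphic_sym is_dsum_obj UV by metis
  then have "is_dsum \<C> L Y U" by (rule is_dsum_iso[OF UV(2)])
  then have "isomorphic X Y" by (rule local_cancel[OF step(2) UV(1)])
  then show ?case using isoclass_eq step(4) by simp
qed

end

section \<open>The group of stable isomorphism classes\<close>

text \<open>
  Formal sums of generators as multisets: an equation between two such sums is an equation between multisets, and
  so between the direct sums of their members.
\<close>

definition mset_frag :: "'c multiset \<Rightarrow> 'c \<Rightarrow>\<^sub>0 int" where
  "mset_frag M = sum_mset (image_mset frag_of M)"

lemma mset_frag_simps [simp]:
  "mset_frag {#} = 0" "mset_frag (add_mset c M) = frag_of c + mset_frag M"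
  "mset_frag (M + N) = mset_frag M + mset_frag N"
  by (simp_all add: mset_frag_def)

lemma lookup_mset_frag: "Poly_Mapping.lookup (mset_frag M) c = int (count M c)"
  by (induction M) (simp_all add: Poly_Mapping.lookup_add)

lemma mset_frag_inj: "mset_frag M = mset_frag N \<Longrightarrow> M = N"
  by (metis lookup_mset_frag multiset_eqI of_nat_eq_iff)

context additive_category
begin

definition mset_dsum where
  "mset_dsum M = fold_mset (\<star>) {Z. zero_object \<C> Z} M"

lemma mset_dsum_add [simp]: "mset_dsum (add_mset c M) = c \<star> mset_dsum M"
proof -
  interpret comp_fun_commute "(\<star>)" by unfold_locales (simp add: fun_eq_iff dsum_set_left_comm)
  show ?thesis by (simp add: mset_dsum_def)
qed

lemma zero_objects: "zero_object \<C> Z \<Longrightarrow> {Z. zero_object \<C> Z} = isoclass \<C> Z"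
proof -
  assume Z: "zero_object \<C> Z"
  have "isomorphic Z Z'" if "zero_object \<C> Z'" for Z'
  proof -
    have O: "Z \<in> Obj \<C>" "Z' \<in> Obj \<C>" "Idn \<C> Z = Nul \<C> Z Z" "Idn \<C> Z' = Nul \<C> Z' Z'"
      using Z that by (simp_all add: zero_object_iff)
    then have "inverse_arrows (Nul \<C> Z Z') (Nul \<C> Z' Z)" by (simp add: inverse_arrows_def Hom_iff)
    then show ?thesis by (rule isomorphicI) (use O in simp_all)
  qed
  moreover have "zero_object \<C> Z'" if ZZ: "isomorphic Z Z'" for Z'
  proof -
    obtain f g where *: "inverse_arrows f g" "Src \<C> f = Z" "Tgt \<C> f = Z'" using ZZ by (rule isomorphicE)
    note I = inverse_arrowsD[OF *(1)]
    have "Z \<in> Obj \<C>" "Idn \<C> Z = Nul \<C> Z Z" using Z by (simp_all add: zero_object_iff)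
    moreover have "Idn \<C> Z' = f \<bullet> (Idn \<C> Z \<bullet> g)" using I * by simp
    ultimately show ?thesis using I(1,2,3,4) * by (auto simp: zero_object_iff)
  qed
  ultimately show ?thesis by (auto simp: mem_isoclass)
qed

lemma isoclass_zero_left: "zero_object \<C> Z \<Longrightarrow> X \<in> Obj \<C> \<Longrightarrow> isoclass \<C> Z \<star> isoclass \<C> X = isoclass \<C> X"
  by (subst dsum_set_comm) (rule isoclass_zero)

lemma mset_dsum_empty: "zero_object \<C> Z \<Longrightarrow> mset_dsum {#} = isoclass \<C> Z"
  using zero_objects by (simp add: mset_dsum_def)

lemma mset_dsum_isoclass:
  assumes "set_mset M \<subseteq> isoclass \<C> ` Obj \<C>"
  obtains X where "X \<in> Obj \<C>" "mset_dsum M = isoclass \<C> X"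
  using assms
proof (induction M arbitrary: thesis)
  case empty
  obtain Z where "zero_object \<C> Z" using ex_zero_object by blast
  then show ?case using empty mset_dsum_empty by (auto simp: zero_object_def)
next
  case (add c M)
  obtain X where X: "X \<in> Obj \<C>" "mset_dsum M = isoclass \<C> X" using add.IH add.prems by auto
  obtain Y where Y: "Y \<in> Obj \<C>" "c = isoclass \<C> Y" using add.prems(2) by auto
  obtain S where "is_dsum \<C> Y X S" using ex_dsum X Y by blast
  then show ?case using add.prems(1)[of S] isoclass_dsum is_dsum_obj X Y by simp
qed

lemma mset_dsum_union:
  assumes "set_mset N \<subseteq> isoclass \<C> ` Obj \<C>"
  shows "mset_dsum (M + N) = mset_dsum M \<star> mset_dsum N"
proof (induction M)
  case empty
  obtain Z where "zero_object \<C> Z" using ex_zero_object by blast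
  moreover obtain X where "X \<in> Obj \<C>" "mset_dsum N = isoclass \<C> X" by (rule mset_dsum_isoclass[OF assms])
  ultimately show ?case using isoclass_zero_left mset_dsum_empty by simp
next
  case (add c M)
  then show ?case by (simp add: dsum_set_assoc)
qed

end

context strong_exact_IT_context
begin

abbreviation "isoclasses \<equiv> isoclass \<C> ` Obj \<C>"

sublocale G: comm_group "isoclass_group \<C>"
  unfolding isoclass_group_def by (rule abelian_free_Abelian_group)

lemma isoclass_group_simps [simp]:
  "x \<in> carrier (isoclass_group \<C>) \<longleftrightarrow> Poly_Mapping.keys x \<subseteq> isoclasses"
  "monoid.one (isoclass_group \<C>) = 0" "monoid.mult (isoclass_group \<C>) x y = x + y"
  by (simp_all add: isoclass_group_def)

lemma isoclass_group_inv: "Poly_Mapping.keys x \<subseteq> isoclasses \<Longrightarrow> inv\<^bsub>isoclass_group \<C>\<^esub> x = - x"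
  by (simp add: isoclass_group_def)

lemma frag_of_carrier [simp]: "X \<in> Obj \<C> \<Longrightarrow> Poly_Mapping.keys (frag_of (isoclass \<C> X)) \<subseteq> isoclasses"
  by simp

lemma keys_add_subset:
  "Poly_Mapping.keys x \<subseteq> A \<Longrightarrow> Poly_Mapping.keys y \<subseteq> A \<Longrightarrow> Poly_Mapping.keys (x + y) \<subseteq> A"
  for x y :: "'c \<Rightarrow>\<^sub>0 int"
  using keys_add[of x y] by blast

lemma keys_diff_subset:
  "Poly_Mapping.keys x \<subseteq> A \<Longrightarrow> Poly_Mapping.keys y \<subseteq> A \<Longrightarrow> Poly_Mapping.keys (x - y) \<subseteq> A"
  for x y :: "'c \<Rightarrow>\<^sub>0 int"
  using keys_diff[of x y] by blast

lemma K_relations_carrier: "K_relations \<C> \<E> \<subseteq> carrier (isoclass_group \<C>)"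
proof
  fix x assume "x \<in> K_relations \<C> \<E>"
  then consider N S T where "x = frag_of (isoclass \<C> N) - frag_of (isoclass \<C> S) - frag_of (isoclass \<C> T)" "is_dsum \<C> S T N"
    | P where "x = frag_of (isoclass \<C> P)" "projective \<C> \<E> P"
    unfolding K_relations_def by blast
  then show "x \<in> carrier (isoclass_group \<C>)"
  proof cases
    case 1
    then have "S \<in> Obj \<C>" "T \<in> Obj \<C>" "N \<in> Obj \<C>" using is_dsum_obj by blast+
    then show ?thesis unfolding isoclass_group_simps 1(1) by (intro keys_diff_subset frag_of_carrier)
  next
    case 2
    then show ?thesis using projective_obj by simp
  qed
qed

lemma K_subgroup_subgroup: "subgroup (K_subgroup \<C> \<E>) (isoclass_group \<C>)"
  unfolding K_subgroup_def by (rule G.generate_is_subgroup[OF K_relations_carrier])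

lemma K_subgroup_normal: "K_subgroup \<C> \<E> \<lhd> isoclass_group \<C>"
  using K_subgroup_subgroup by (simp add: G.normal_iff_subgroup)

sublocale K: comm_group "K_group \<C> \<E>"
  unfolding K_group_def by (rule G.abelian_FactGroup[OF K_subgroup_subgroup])

definition K_coset where
  "K_coset x = K_subgroup \<C> \<E> #>\<^bsub>isoclass_group \<C>\<^esub> x"

lemma K_class_coset: "K_class \<C> \<E> M = K_coset (frag_of (isoclass \<C> M))"
  by (simp add: K_class_def K_coset_def)

lemma K_coset_hom: "K_coset \<in> hom (isoclass_group \<C>) (K_group \<C> \<E>)"
  unfolding K_coset_def K_group_def
  by (rule homI) (auto simp: FactGroup_def RCOSETS_def normal.rcos_sum[OF K_subgroup_normal])

sublocale K_coset: group_hom "isoclass_group \<C>" "K_group \<C> \<E>" K_coset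
  by unfold_locales (rule K_coset_hom)

lemma K_group_carrier: "carrier (K_group \<C> \<E>) = K_coset ` carrier (isoclass_group \<C>)"
  by (auto simp: K_group_def K_coset_def FactGroup_def RCOSETS_def)

lemma K_coset_eq_iff:
  assumes "Poly_Mapping.keys x \<subseteq> isoclasses" "Poly_Mapping.keys y \<subseteq> isoclasses"
  shows "K_coset x = K_coset y \<longleftrightarrow> x - y \<in> K_subgroup \<C> \<E>"
proof
  assume "K_coset x = K_coset y"
  then have "x \<in> K_coset y"
    using G.rcos_self[OF _ K_subgroup_subgroup, of x] assms by (simp add: K_coset_def)
  then show "x - y \<in> K_subgroup \<C> \<E>" by (auto simp: K_coset_def r_coset_def)
next
  assume *: "x - y \<in> K_subgroup \<C> \<E>"
  then have "(x - y) + y \<in> K_coset y" unfolding K_coset_def r_coset_def isoclass_group_simps by blast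
  then show "K_coset x = K_coset y"
    using G.repr_independence[OF _ _ K_subgroup_subgroup, of x y] assms by (simp add: K_coset_def)
qed

lemma K_class_carrier [simp]: "X \<in> Obj \<C> \<Longrightarrow> K_class \<C> \<E> X \<in> carrier (K_group \<C> \<E>)"
  by (simp add: K_class_coset K_group_carrier)

lemma K_class_dsum:
  assumes "is_dsum \<C> X Y S"
  shows "K_class \<C> \<E> S = K_class \<C> \<E> X \<otimes>\<^bsub>K_group \<C> \<E>\<^esub> K_class \<C> \<E> Y"
proof -
  have O: "X \<in> Obj \<C>" "Y \<in> Obj \<C>" "S \<in> Obj \<C>" using is_dsum_obj assms by blast+
  let ?x = "frag_of (isoclass \<C> X)" and ?y = "frag_of (isoclass \<C> Y)" and ?s = "frag_of (isoclass \<C> S)"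
  have "?s - ?x - ?y \<in> K_subgroup \<C> \<E>"
    unfolding K_subgroup_def by (rule generate.incl) (use assms in \<open>auto simp: K_relations_def\<close>)
  moreover have "?s - ?x - ?y = ?s - (?x + ?y)" by simp
  moreover have "Poly_Mapping.keys (?x + ?y) \<subseteq> isoclasses"
    by (rule keys_add_subset) (use O in simp_all)
  ultimately have "K_coset ?s = K_coset (?x + ?y)" using K_coset_eq_iff[of ?s "?x + ?y"] O by simp
  also have "\<dots> = K_coset ?x \<otimes>\<^bsub>K_group \<C> \<E>\<^esub> K_coset ?y" using K_coset.hom_mult[of ?x ?y] O by simp
  finally show ?thesis by (simp add: K_class_coset)
qed

lemma K_class_projective:
  assumes "projective \<C> \<E> P"
  shows "K_class \<C> \<E> P = \<one>\<^bsub>K_group \<C> \<E>\<^esub>"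
proof -
  have P: "P \<in> Obj \<C>" using projective_obj assms by blast
  have "frag_of (isoclass \<C> P) - 0 \<in> K_subgroup \<C> \<E>"
    unfolding K_subgroup_def diff_zero by (rule generate.incl) (use assms in \<open>auto simp: K_relations_def\<close>)
  then have "K_coset (frag_of (isoclass \<C> P)) = K_coset 0" using K_coset_eq_iff[of "frag_of (isoclass \<C> P)" 0] P by simp
  then show ?thesis using K_coset.hom_one by (simp add: K_class_coset)
qed

text \<open>
  An element of the subgroup of relations is the difference of two formal sums of objects which become
  isomorphic after adding projective objects; this is checked on generators and is stable under sums.
\<close>

lemma K_subgroup_stably_iso:
  assumes "x \<in> K_subgroup \<C> \<E>"
  shows "\<exists>M N P Q. set_mset M \<subseteq> isoclasses \<and> set_mset N \<subseteq> isoclasses \<and> x = mset_frag M - mset_frag N \<and>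
    projective \<C> \<E> P \<and> projective \<C> \<E> Q \<and> mset_dsum M \<star> isoclass \<C> P = mset_dsum N \<star> isoclass \<C> Q"
    (is "?R x")
proof -
  obtain Z where Z: "zero_object \<C> Z" using ex_zero_object by blast
  note Zp = projective_zero[OF Z]
  have rel: "?R h" if h: "h \<in> K_relations \<C> \<E>" for h
  proof -
    from h consider N S T where "h = frag_of (isoclass \<C> N) - frag_of (isoclass \<C> S) - frag_of (isoclass \<C> T)" "is_dsum \<C> S T N"
      | P where "h = frag_of (isoclass \<C> P)" "projective \<C> \<E> P"
      unfolding K_relations_def by blast
    then show ?thesis
    proof cases
      case 1
      then have O: "S \<in> Obj \<C>" "T \<in> Obj \<C>" "N \<in> Obj \<C>" using is_dsum_obj by blast+
      have "isoclass \<C> S \<star> (isoclass \<C> T \<star> isoclass \<C> Z) = isoclass \<C> N \<star> isoclass \<C> Z"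
        using isoclass_zero[OF Z] O isoclass_dsum[OF 1(2)] by simp
      then show ?thesis using O 1(1) Zp mset_dsum_empty[OF Z]
        by (intro exI[of _ "{#isoclass \<C> N#}"] exI[of _ "{#isoclass \<C> S, isoclass \<C> T#}"])
          (auto intro!: exI[of _ Z])
    next
      case 2
      then have O: "P \<in> Obj \<C>" using projective_obj by blast
      show ?thesis
      proof (rule exI[of _ "{#isoclass \<C> P#}"], rule exI[of _ "{#}"], rule exI[of _ Z], rule exI[of _ P])
      qed (use O 2 Zp mset_dsum_empty[OF Z] isoclass_zero[OF Z] isoclass_zero_left[OF Z] in auto)
    qed
  qed
  have neg: "?R (- h)" if h: "?R h" for h
  proof -
    obtain M N P Q where *: "set_mset M \<subseteq> isoclasses \<and> set_mset N \<subseteq> isoclasses \<and> h = mset_frag M - mset_frag N \<and>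
      projective \<C> \<E> P \<and> projective \<C> \<E> Q \<and> mset_dsum M \<star> isoclass \<C> P = mset_dsum N \<star> isoclass \<C> Q"
      using h by blast
    show ?thesis
      by (rule exI[of _ N], rule exI[of _ M], rule exI[of _ Q], rule exI[of _ P]) (use * in simp)
  qed
  have add: "?R (h + h')" if h: "?R h" and h': "?R h'" for h h'
  proof -
    obtain M N P Q where 1: "set_mset M \<subseteq> isoclasses" "set_mset N \<subseteq> isoclasses" "h = mset_frag M - mset_frag N"
      "projective \<C> \<E> P" "projective \<C> \<E> Q" "mset_dsum M \<star> isoclass \<C> P = mset_dsum N \<star> isoclass \<C> Q"
      using h by blast
    obtain M' N' P' Q' where 2: "set_mset M' \<subseteq> isoclasses" "set_mset N' \<subseteq> isoclasses" "h' = mset_frag M' - mset_frag N'"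
      "projective \<C> \<E> P'" "projective \<C> \<E> Q'" "mset_dsum M' \<star> isoclass \<C> P' = mset_dsum N' \<star> isoclass \<C> Q'"
      using h' by blast
    obtain S T where ST: "is_dsum \<C> P P' S" "is_dsum \<C> Q Q' T" using ex_dsum projective_obj 1 2 by metis
    note c = isoclass_dsum[OF ST(1)] isoclass_dsum[OF ST(2)]
    have "mset_dsum (M + M') \<star> isoclass \<C> S = (mset_dsum M \<star> isoclass \<C> P) \<star> (mset_dsum M' \<star> isoclass \<C> P')"
      unfolding mset_dsum_union[OF 2(1)] c[symmetric] by (simp only: dsum_set_ac)
    also have "\<dots> = (mset_dsum N \<star> isoclass \<C> Q) \<star> (mset_dsum N' \<star> isoclass \<C> Q')" by (simp only: 1(6) 2(6))
    also have "\<dots> = mset_dsum (N + N') \<star> isoclass \<C> T"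
      unfolding mset_dsum_union[OF 2(2)] c[symmetric] by (simp only: dsum_set_ac)
    finally have "mset_dsum (M + M') \<star> isoclass \<C> S = mset_dsum (N + N') \<star> isoclass \<C> T" .
    moreover have "projective \<C> \<E> S" "projective \<C> \<E> T" using projective_dsum ST 1 2 by blast+
    moreover have "h + h' = mset_frag (M + M') - mset_frag (N + N')" using 1(3) 2(3) by simp
    moreover have "set_mset (M + M') \<subseteq> isoclasses" "set_mset (N + N') \<subseteq> isoclasses" using 1 2 by simp_all
    ultimately show ?thesis by blast
  qed
  from assms have "x \<in> generate (isoclass_group \<C>) (K_relations \<C> \<E>)" by (simp add: K_subgroup_def)
  then show ?thesis
  proof induction
    case one
    show ?case using Zp by (intro exI[of _ "{#}"]) (auto intro!: exI[of _ Z])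
  next
    case (incl h)
    then show ?case by (rule rel)
  next
    case (inv h)
    then have "h \<in> carrier (isoclass_group \<C>)" using K_relations_carrier by blast
    then have "Poly_Mapping.keys h \<subseteq> isoclasses" by simp
    then show ?case using neg[OF rel[OF inv]] by (simp only: isoclass_group_inv)
  next
    case (eng h1 h2)
    then show ?case using add by (simp only: isoclass_group_simps)
  qed
qed

text \<open>
  If \<open>[U] - [V]\<close> is a relation, then \<open>U \<oplus> N\<close> and \<open>V \<oplus> M\<close> agree, where \<open>M\<close> and \<open>N\<close> are isomorphic after
  adding projective objects. Their common part cancels.
\<close>

lemma K_class_eq_iff:
  assumes "U \<in> Obj \<C>" "V \<in> Obj \<C>"
  shows "K_class \<C> \<E> U = K_class \<C> \<E> V \<longleftrightarrow> stably_iso U V"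
proof
  assume "stably_iso U V"
  then obtain P Q S where *: "is_dsum \<C> U P S" "is_dsum \<C> V Q S" "projective \<C> \<E> P" "projective \<C> \<E> Q"
    by (rule stably_isoE)
  then show "K_class \<C> \<E> U = K_class \<C> \<E> V"
    using K_class_dsum[OF *(1)] K_class_dsum[OF *(2)] K_class_projective assms by simp
next
  let ?u = "isoclass \<C> U" and ?v = "isoclass \<C> V"
  assume "K_class \<C> \<E> U = K_class \<C> \<E> V"
  then have "frag_of ?u - frag_of ?v \<in> K_subgroup \<C> \<E>"
    using K_coset_eq_iff[of "frag_of ?u" "frag_of ?v"] assms by (simp add: K_class_coset)
  then obtain M N P Q where *: "set_mset M \<subseteq> isoclasses" "set_mset N \<subseteq> isoclasses"
    "frag_of ?u - frag_of ?v = mset_frag M - mset_frag N"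
    "projective \<C> \<E> P" "projective \<C> \<E> Q" "mset_dsum M \<star> isoclass \<C> P = mset_dsum N \<star> isoclass \<C> Q"
    using K_subgroup_stably_iso by metis
  have "mset_frag (add_mset ?u N) = mset_frag (add_mset ?v M)"
    using *(3) by (simp add: algebra_simps)
  then have "mset_dsum (add_mset ?u N) = mset_dsum (add_mset ?v M)" using mset_frag_inj by metis
  then have e: "?u \<star> mset_dsum N = ?v \<star> mset_dsum M" by simp
  obtain W where W: "W \<in> Obj \<C>" "mset_dsum N = isoclass \<C> W" by (rule mset_dsum_isoclass[OF *(2)])
  have "isoclass \<C> W \<star> (?u \<star> isoclass \<C> P) = (?u \<star> mset_dsum N) \<star> isoclass \<C> P"
    unfolding W(2) by (simp only: dsum_set_ac)
  also have "\<dots> = ?v \<star> (mset_dsum M \<star> isoclass \<C> P)" unfolding e by (simp only: dsum_set_assoc)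
  also have "\<dots> = isoclass \<C> W \<star> (?v \<star> isoclass \<C> Q)" unfolding *(6) W(2) by (simp only: dsum_set_ac)
  finally have "isoclass \<C> W \<star> (?u \<star> isoclass \<C> P) = isoclass \<C> W \<star> (?v \<star> isoclass \<C> Q)" .
  moreover obtain S T where ST: "is_dsum \<C> U P S" "is_dsum \<C> V Q T" using ex_dsum projective_obj assms *(4,5) by metis
  ultimately have "isoclass \<C> W \<star> isoclass \<C> S = isoclass \<C> W \<star> isoclass \<C> T" by (simp add: isoclass_dsum)
  then have "isoclass \<C> S = isoclass \<C> T" using dsum_cancel W(1) is_dsum_obj ST by blast
  then have "?u \<star> isoclass \<C> P = ?v \<star> isoclass \<C> Q" using ST by (simp add: isoclass_dsum)
  then show "stably_iso U V" unfolding stably_iso_def using assms *(4,5) by blast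
qed

text \<open>
  The syzygy endomorphism exists: extended linearly to the free abelian group, the assignment \<open>[M] \<mapsto> [\<Omega> M]\<close> respects the
  relations, because syzygies are unique up to stable isomorphism and additive.
\<close>

lemma K_syzygy_hom: "K_syzygy \<C> \<E> \<in> hom (K_group \<C> \<E>) (K_group \<C> \<E>)"
  and K_syzygy_class: "M \<in> Obj \<C> \<Longrightarrow> K_syzygy \<C> \<E> (K_class \<C> \<E> M) = K_class \<C> \<E> (syzygy \<C> \<E> M)"
proof -
  define s where "s c = isoclass \<C> (syzygy \<C> \<E> (SOME X. X \<in> c))" for c
  define \<sigma> where "\<sigma> = frag_extend (\<lambda>c. frag_of (s c))"
  have some: "isomorphic X (SOME Y. Y \<in> isoclass \<C> X)" if "X \<in> Obj \<C>" for X
    using someI[of "\<lambda>Y. Y \<in> isoclass \<C> X", OF self_mem_isoclass[OF that]] by (simp add: mem_isoclass)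
  have s_in: "s c \<in> isoclasses" if c: "c \<in> isoclasses" for c
  proof -
    obtain X where X: "X \<in> Obj \<C>" "c = isoclass \<C> X" using c by blast
    have "(SOME Y. Y \<in> c) \<in> Obj \<C>" using some[OF X(1)] X(2) isomorphic_obj by blast
    then show ?thesis unfolding s_def using is_syzygy_obj[OF is_syzygy_syzygy] by blast
  qed
  have \<sigma>_in: "Poly_Mapping.keys (\<sigma> x) \<subseteq> isoclasses" if x: "Poly_Mapping.keys x \<subseteq> isoclasses" for x
  proof -
    have "Poly_Mapping.keys (\<sigma> x) \<subseteq> (\<Union>c \<in> Poly_Mapping.keys x. Poly_Mapping.keys (frag_of (s c)))"
      unfolding \<sigma>_def by (rule keys_frag_extend)
    also have "\<dots> \<subseteq> isoclasses"
    proof (rule UN_least)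
      fix c assume "c \<in> Poly_Mapping.keys x"
      then have "s c \<in> isoclasses" using x s_in by blast
      then show "Poly_Mapping.keys (frag_of (s c)) \<subseteq> isoclasses" by simp
    qed
    finally show ?thesis .
  qed
  have \<sigma>_K: "K_coset (\<sigma> (frag_of (isoclass \<C> X))) = K_class \<C> \<E> (syzygy \<C> \<E> X)" if X: "X \<in> Obj \<C>" for X
  proof -
    let ?Y = "SOME Y. Y \<in> isoclass \<C> X"
    have Y: "?Y \<in> Obj \<C>" using some[OF X] isomorphic_obj by blast
    have "stably_iso ?Y X" using some[OF X] isomorphic_stably_iso stably_iso_sym by blast
    then have "stably_iso (syzygy \<C> \<E> ?Y) (syzygy \<C> \<E> X)"
      by (rule syzygy_stably_iso[OF _ is_syzygy_syzygy[OF Y] is_syzygy_syzygy[OF X]])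
    then have "K_class \<C> \<E> (syzygy \<C> \<E> ?Y) = K_class \<C> \<E> (syzygy \<C> \<E> X)"
      using K_class_eq_iff is_syzygy_obj is_syzygy_syzygy X Y by blast
    then show ?thesis by (simp add: \<sigma>_def s_def K_class_coset)
  qed
  have hom: "(\<lambda>x. K_coset (\<sigma> x)) \<in> hom (isoclass_group \<C>) (K_group \<C> \<E>)"
  proof (rule homI)
    fix x y assume "x \<in> carrier (isoclass_group \<C>)" "y \<in> carrier (isoclass_group \<C>)"
    then show "K_coset (\<sigma> (x \<otimes>\<^bsub>isoclass_group \<C>\<^esub> y)) = K_coset (\<sigma> x) \<otimes>\<^bsub>K_group \<C> \<E>\<^esub> K_coset (\<sigma> y)"
      using K_coset.hom_mult[of "\<sigma> x" "\<sigma> y"] \<sigma>_in by (simp add: \<sigma>_def frag_extend_add)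
  qed (use \<sigma>_in in \<open>simp add: K_group_carrier\<close>)
  interpret h: group_hom "isoclass_group \<C>" "K_group \<C> \<E>" "\<lambda>x. K_coset (\<sigma> x)"
    by unfold_locales (rule hom)
  have "K_relations \<C> \<E> \<subseteq> kernel (isoclass_group \<C>) (K_group \<C> \<E>) (\<lambda>x. K_coset (\<sigma> x))"
  proof
    fix x assume x: "x \<in> K_relations \<C> \<E>"
    then have xc: "x \<in> carrier (isoclass_group \<C>)" using K_relations_carrier by blast
    from x consider N S T where "x = frag_of (isoclass \<C> N) - frag_of (isoclass \<C> S) - frag_of (isoclass \<C> T)" "is_dsum \<C> S T N"
      | P where "x = frag_of (isoclass \<C> P)" "projective \<C> \<E> P"
      unfolding K_relations_def by blast
    then have "K_coset (\<sigma> x) = \<one>\<^bsub>K_group \<C> \<E>\<^esub>"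
    proof cases
      case 1
      have O: "S \<in> Obj \<C>" "T \<in> Obj \<C>" "N \<in> Obj \<C>" using is_dsum_obj 1 by blast+
      let ?s = "syzygy \<C> \<E> S" and ?t = "syzygy \<C> \<E> T" and ?n = "syzygy \<C> \<E> N"
      note syz = is_syzygy_syzygy[OF O(1)] is_syzygy_syzygy[OF O(2)] is_syzygy_syzygy[OF O(3)]
      have O': "?s \<in> Obj \<C>" "?t \<in> Obj \<C>" "?n \<in> Obj \<C>" using is_syzygy_obj syz by blast+
      obtain L where L: "is_dsum \<C> ?s ?t L" using ex_dsum O' by blast
      then have "is_syzygy \<C> \<E> N L" using syzygy_dsum syz 1(2) by blast
      then have "stably_iso ?n L" using schanuel syz by blast
      then have "K_class \<C> \<E> ?n = K_class \<C> \<E> L" using K_class_eq_iff O' is_dsum_obj L by blast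
      also have "\<dots> = K_class \<C> \<E> ?s \<otimes>\<^bsub>K_group \<C> \<E>\<^esub> K_class \<C> \<E> ?t" by (rule K_class_dsum[OF L])
      finally have n: "K_class \<C> \<E> ?n = K_class \<C> \<E> ?s \<otimes>\<^bsub>K_group \<C> \<E>\<^esub> K_class \<C> \<E> ?t" .
      have "frag_of (isoclass \<C> N) = x + (frag_of (isoclass \<C> S) + frag_of (isoclass \<C> T))" using 1(1) by simp
      then have "K_coset (\<sigma> (frag_of (isoclass \<C> N))) = K_coset (\<sigma> x) \<otimes>\<^bsub>K_group \<C> \<E>\<^esub>
          (K_coset (\<sigma> (frag_of (isoclass \<C> S))) \<otimes>\<^bsub>K_group \<C> \<E>\<^esub> K_coset (\<sigma> (frag_of (isoclass \<C> T))))"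
        using h.hom_mult[of x "frag_of (isoclass \<C> S) + frag_of (isoclass \<C> T)"]
          h.hom_mult[of "frag_of (isoclass \<C> S)" "frag_of (isoclass \<C> T)"] O xc
          keys_add_subset[of "frag_of (isoclass \<C> S)" isoclasses "frag_of (isoclass \<C> T)"] by simp
      then have "K_class \<C> \<E> ?n = K_coset (\<sigma> x) \<otimes>\<^bsub>K_group \<C> \<E>\<^esub> K_class \<C> \<E> ?n"
        using \<sigma>_K O n by simp
      then show ?thesis using K.r_cancel_one'[of "K_class \<C> \<E> ?n" "K_coset (\<sigma> x)"] h.hom_closed[OF xc] O' by simp
    next
      case 2
      have P: "P \<in> Obj \<C>" using projective_obj 2 by blast
      have "projective \<C> \<E> (syzygy \<C> \<E> P)" using syzygy_of_projective is_syzygy_syzygy P 2 by blast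
      then show ?thesis using \<sigma>_K[OF P] 2(1) K_class_projective by simp
    qed
    then show "x \<in> kernel (isoclass_group \<C>) (K_group \<C> \<E>) (\<lambda>x. K_coset (\<sigma> x))" using xc by (simp add: kernel_def)
  qed
  then have ker: "K_subgroup \<C> \<E> \<subseteq> kernel (isoclass_group \<C>) (K_group \<C> \<E>) (\<lambda>x. K_coset (\<sigma> x))"
    unfolding K_subgroup_def by (rule G.generate_subgroup_incl[OF _ h.subgroup_kernel])
  have eq: "K_coset (\<sigma> x) = K_coset (\<sigma> y)"
    if xy: "x \<in> carrier (isoclass_group \<C>)" "y \<in> carrier (isoclass_group \<C>)"
      "K_subgroup \<C> \<E> #>\<^bsub>isoclass_group \<C>\<^esub> x = K_subgroup \<C> \<E> #>\<^bsub>isoclass_group \<C>\<^esub> y" for x y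
  proof -
    have d: "x - y \<in> K_subgroup \<C> \<E>" using xy K_coset_eq_iff[of x y] by (simp add: K_coset_def)
    have dc: "x - y \<in> carrier (isoclass_group \<C>)" using xy keys_diff_subset by simp
    have "K_coset (\<sigma> ((x - y) \<otimes>\<^bsub>isoclass_group \<C>\<^esub> y)) = K_coset (\<sigma> (x - y)) \<otimes>\<^bsub>K_group \<C> \<E>\<^esub> K_coset (\<sigma> y)"
      by (rule h.hom_mult[OF dc xy(2)])
    moreover have "K_coset (\<sigma> (x - y)) = \<one>\<^bsub>K_group \<C> \<E>\<^esub>" using ker d by (auto simp: kernel_def)
    ultimately show ?thesis using h.hom_closed[OF xy(2)] by simp
  qed
  obtain h where h: "h \<in> hom (K_group \<C> \<E>) (K_group \<C> \<E>)"
    "\<And>x. x \<in> carrier (isoclass_group \<C>) \<Longrightarrow> h (K_coset x) = K_coset (\<sigma> x)"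
    using FactGroup_universal[OF hom K_subgroup_normal eq] unfolding K_group_def K_coset_def by blast
  have "\<exists>h. h \<in> hom (K_group \<C> \<E>) (K_group \<C> \<E>) \<and>
     (\<forall>M \<in> Obj \<C>. h (K_class \<C> \<E> M) = K_class \<C> \<E> (syzygy \<C> \<E> M))"
    using h \<sigma>_K by (intro exI[of _ h]) (simp add: K_class_coset)
  from someI_ex[OF this] show "K_syzygy \<C> \<E> \<in> hom (K_group \<C> \<E>) (K_group \<C> \<E>)"
    "M \<in> Obj \<C> \<Longrightarrow> K_syzygy \<C> \<E> (K_class \<C> \<E> M) = K_class \<C> \<E> (syzygy \<C> \<E> M)"
    unfolding K_syzygy_def by blast+
qed

lemma K_syzygy_funpow_class:
  assumes "nth_syzygy n M L"
  shows "(K_syzygy \<C> \<E> ^^ n) (K_class \<C> \<E> M) = K_class \<C> \<E> L"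
  using assms
proof (induction n arbitrary: M)
  case (Suc n)
  then obtain K where K: "is_syzygy \<C> \<E> M K" "nth_syzygy n K L" by auto
  then have O: "M \<in> Obj \<C>" "K \<in> Obj \<C>" using is_syzygy_obj by blast+
  have "stably_iso (syzygy \<C> \<E> M) K" using schanuel is_syzygy_syzygy O K by blast
  then have "K_class \<C> \<E> (syzygy \<C> \<E> M) = K_class \<C> \<E> K"
    using K_class_eq_iff is_syzygy_obj is_syzygy_syzygy O by blast
  then show ?case using Suc.IH[OF K(2)] K_syzygy_class O by (simp add: funpow_Suc_right del: funpow.simps)
qed simp

lemma K_syzygy_funpow_hom: "K_syzygy \<C> \<E> ^^ n \<in> hom (K_group \<C> \<E>) (K_group \<C> \<E>)"
proof (induction n)
  case 0
  show ?case by (simp add: hom_def id_def)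
next
  case (Suc n)
  then show ?case using hom_compose[OF Suc K_syzygy_hom] by (simp add: comp_def)
qed

end

section \<open>The stable category\<close>

context exact_category
begin

lemma proj_mapsE:
  assumes "h \<in> proj_maps \<C> \<E> X Y"
  obtains u v P where "h = v \<bullet> u" "projective \<C> \<E> P" "u \<in> Mor \<C>" "Src \<C> u = X" "Tgt \<C> u = P"
    "v \<in> Mor \<C>" "Src \<C> v = P" "Tgt \<C> v = Y"
  using assms by (auto simp: proj_maps_def Hom_iff)

lemma proj_mapsI:
  "projective \<C> \<E> (Tgt \<C> u) \<Longrightarrow> u \<in> Mor \<C> \<Longrightarrow> v \<in> Mor \<C> \<Longrightarrow> Src \<C> v = Tgt \<C> u \<Longrightarrow> Src \<C> u = X \<Longrightarrow> Tgt \<C> v = Y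
    \<Longrightarrow> v \<bullet> u \<in> proj_maps \<C> \<E> X Y"
  by (auto simp: proj_maps_def Hom_iff)

lemma proj_maps_arr:
  assumes "h \<in> proj_maps \<C> \<E> X Y"
  shows "h \<in> Mor \<C>" "Src \<C> h = X" "Tgt \<C> h = Y"
  using assms by (auto elim!: proj_mapsE)

lemma proj_maps_cmp_left:
  assumes "h \<in> proj_maps \<C> \<E> X Y" "g \<in> Mor \<C>" "Src \<C> g = Y" "Tgt \<C> g = Z"
  shows "g \<bullet> h \<in> proj_maps \<C> \<E> X Z"
proof -
  obtain u v P where *: "h = v \<bullet> u" "projective \<C> \<E> P" "u \<in> Mor \<C>" "Src \<C> u = X" "Tgt \<C> u = P"
    "v \<in> Mor \<C>" "Src \<C> v = P" "Tgt \<C> v = Y"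
    using assms(1) by (rule proj_mapsE)
  have "(g \<bullet> v) \<bullet> u \<in> proj_maps \<C> \<E> X Z" by (rule proj_mapsI) (use * assms in simp_all)
  then show ?thesis using * assms by simp
qed

lemma proj_maps_cmp_right:
  assumes "h \<in> proj_maps \<C> \<E> X Y" "f \<in> Mor \<C>" "Src \<C> f = W" "Tgt \<C> f = X"
  shows "h \<bullet> f \<in> proj_maps \<C> \<E> W Y"
proof -
  obtain u v P where *: "h = v \<bullet> u" "projective \<C> \<E> P" "u \<in> Mor \<C>" "Src \<C> u = X" "Tgt \<C> u = P"
    "v \<in> Mor \<C>" "Src \<C> v = P" "Tgt \<C> v = Y"
    using assms(1) by (rule proj_mapsE)
  have "v \<bullet> (u \<bullet> f) \<in> proj_maps \<C> \<E> W Y" by (rule proj_mapsI) (use * assms in simp_all)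
  then show ?thesis using * assms by simp
qed

lemma proj_maps_add:
  assumes "h \<in> proj_maps \<C> \<E> X Y" "h' \<in> proj_maps \<C> \<E> X Y"
  shows "h \<boxplus> h' \<in> proj_maps \<C> \<E> X Y"
proof -
  obtain u v P where 1: "h = v \<bullet> u" "projective \<C> \<E> P" "u \<in> Mor \<C>" "Src \<C> u = X" "Tgt \<C> u = P"
    "v \<in> Mor \<C>" "Src \<C> v = P" "Tgt \<C> v = Y"
    using assms(1) by (rule proj_mapsE)
  obtain u' v' P' where 2: "h' = v' \<bullet> u'" "projective \<C> \<E> P'" "u' \<in> Mor \<C>" "Src \<C> u' = X" "Tgt \<C> u' = P'"
    "v' \<in> Mor \<C>" "Src \<C> v' = P'" "Tgt \<C> v' = Y"
    using assms(2) by (rule proj_mapsE)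
  obtain S where S: "is_dsum \<C> P P' S" using ex_dsum projective_obj 1(2) 2(2) by blast
  then obtain i1 i2 p1 p2 where bp: "biproduct \<C> P P' S i1 i2 p1 p2" by (rule is_dsumE)
  note B = biprodD[OF bp]
  have "X \<in> Obj \<C>" using src_obj[OF 1(3)] 1(4) by simp
  have "(v \<bullet> p1 \<boxplus> v' \<bullet> p2) \<bullet> (i1 \<bullet> u \<boxplus> i2 \<bullet> u') \<in> proj_maps \<C> \<E> X Y"
    by (rule proj_mapsI) (use 1(3-) 2(3-) projective_dsum[OF 1(2) 2(2) S] in \<open>simp_all add: B\<close>)
  moreover have "(v \<bullet> p1 \<boxplus> v' \<bullet> p2) \<bullet> (i1 \<bullet> u \<boxplus> i2 \<bullet> u') = h \<boxplus> h'"
    unfolding 1(1) 2(1) using 1(3-) 2(3-) \<open>X \<in> Obj \<C>\<close> by (simp add: B)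
  ultimately show ?thesis by simp
qed

lemma proj_maps_neg:
  assumes "h \<in> proj_maps \<C> \<E> X Y"
  shows "neg h \<in> proj_maps \<C> \<E> X Y"
proof -
  obtain u v P where *: "h = v \<bullet> u" "projective \<C> \<E> P" "u \<in> Mor \<C>" "Src \<C> u = X" "Tgt \<C> u = P"
    "v \<in> Mor \<C>" "Src \<C> v = P" "Tgt \<C> v = Y"
    using assms(1) by (rule proj_mapsE)
  have "neg v \<bullet> u \<in> proj_maps \<C> \<E> X Y" by (rule proj_mapsI) (use * in simp_all)
  then show ?thesis using * by simp
qed

lemma proj_maps_nul:
  assumes "X \<in> Obj \<C>" "Y \<in> Obj \<C>"
  shows "Nul \<C> X Y \<in> proj_maps \<C> \<E> X Y"
proof -
  obtain Z where Z: "zero_object \<C> Z" using ex_zero_object by blast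
  then have "Z \<in> Obj \<C>" by (simp add: zero_object_def)
  then have "Nul \<C> Z Y \<bullet> Nul \<C> X Z \<in> proj_maps \<C> \<E> X Y"
    by (intro proj_mapsI) (use assms projective_zero[OF Z] in simp_all)
  then show ?thesis using assms \<open>Z \<in> Obj \<C>\<close> by simp
qed

lemma proj_maps_subgroup:
  assumes "X \<in> Obj \<C>" "Y \<in> Obj \<C>"
  shows "subgroup (proj_maps \<C> \<E> X Y) (hom_group \<C> X Y)"
proof -
  interpret comm_group "hom_group \<C> X Y" using hom_comm_group assms by blast
  show ?thesis
  proof (rule subgroupI)
    show "proj_maps \<C> \<E> X Y \<noteq> {}" using proj_maps_nul[OF assms] by blast
    fix a assume a: "a \<in> proj_maps \<C> \<E> X Y"
    have "neg a = inv\<^bsub>hom_group \<C> X Y\<^esub> a" using proj_maps_arr[OF a] by (simp add: neg_def)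
    then show "inv\<^bsub>hom_group \<C> X Y\<^esub> a \<in> proj_maps \<C> \<E> X Y" using proj_maps_neg[OF a] by simp
  next
    fix a b assume "a \<in> proj_maps \<C> \<E> X Y" "b \<in> proj_maps \<C> \<E> X Y"
    then show "a \<otimes>\<^bsub>hom_group \<C> X Y\<^esub> b \<in> proj_maps \<C> \<E> X Y" by (simp add: proj_maps_add)
  qed (auto dest: proj_maps_arr simp: Hom_iff)
qed

text \<open>Equality of the residue classes of two arrows in the stable category.\<close>

definition stable_eq where
  "stable_eq f g \<longleftrightarrow> f \<in> Mor \<C> \<and> g \<in> Mor \<C> \<and> Src \<C> f = Src \<C> g \<and> Tgt \<C> f = Tgt \<C> g \<and>
     f \<boxplus> neg g \<in> proj_maps \<C> \<E> (Src \<C> g) (Tgt \<C> g)"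

lemma stable_eq_arr:
  "stable_eq f g \<Longrightarrow> f \<in> Mor \<C> \<and> g \<in> Mor \<C> \<and> Src \<C> f = Src \<C> g \<and> Tgt \<C> f = Tgt \<C> g"
  by (simp add: stable_eq_def)

lemma stable_eq_iff_class:
  assumes "f \<in> Hom \<C> X Y" "g \<in> Hom \<C> X Y"
  shows "stable_class \<C> \<E> f = stable_class \<C> \<E> g \<longleftrightarrow> stable_eq f g"
proof -
  have T: "f \<in> Mor \<C>" "Src \<C> f = X" "Tgt \<C> f = Y" "g \<in> Mor \<C>" "Src \<C> g = X" "Tgt \<C> g = Y"
    "X \<in> Obj \<C>" "Y \<in> Obj \<C>"
    using assms hom_obj[OF assms(1)] by (simp_all add: Hom_iff)
  interpret comm_group "hom_group \<C> X Y" using hom_comm_group T(7,8) by blast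
  note S = proj_maps_subgroup[OF T(7,8)]
  have "stable_class \<C> \<E> f = stable_class \<C> \<E> g \<longleftrightarrow> f \<in> stable_class \<C> \<E> g"
  proof
    assume "stable_class \<C> \<E> f = stable_class \<C> \<E> g"
    moreover have "f \<in> stable_class \<C> \<E> f" unfolding stable_class_def T by (rule rcos_self[OF _ S]) (simp add: assms)
    ultimately show "f \<in> stable_class \<C> \<E> g" by simp
  next
    assume "f \<in> stable_class \<C> \<E> g"
    then show "stable_class \<C> \<E> f = stable_class \<C> \<E> g"
      unfolding stable_class_def T by (rule repr_independence[OF _ _ S, symmetric]) (simp add: assms)
  qed
  also have "\<dots> \<longleftrightarrow> (\<exists>h\<in>proj_maps \<C> \<E> X Y. f = h \<boxplus> g)"
    unfolding stable_class_def T r_coset_def by simp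
  also have "\<dots> \<longleftrightarrow> f \<boxplus> neg g \<in> proj_maps \<C> \<E> X Y"
  proof
    assume "\<exists>h\<in>proj_maps \<C> \<E> X Y. f = h \<boxplus> g"
    then obtain h where h: "h \<in> proj_maps \<C> \<E> X Y" "f = h \<boxplus> g" by blast
    then have "f \<boxplus> neg g = h" using proj_maps_arr[OF h(1)] T by simp
    then show "f \<boxplus> neg g \<in> proj_maps \<C> \<E> X Y" using h(1) by simp
  next
    assume *: "f \<boxplus> neg g \<in> proj_maps \<C> \<E> X Y"
    have "f = (f \<boxplus> neg g) \<boxplus> g" using T by simp
    with * show "\<exists>h\<in>proj_maps \<C> \<E> X Y. f = h \<boxplus> g" by blast
  qed
  finally show ?thesis using T by (simp add: stable_eq_def)
qed

lemma stable_eq_refl: "f \<in> Mor \<C> \<Longrightarrow> stable_eq f f"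
  by (simp add: stable_eq_def proj_maps_nul)

lemma stable_eq_sym:
  assumes "stable_eq f g"
  shows "stable_eq g f"
proof -
  have H: "f \<in> Hom \<C> (Src \<C> g) (Tgt \<C> g)" "g \<in> Hom \<C> (Src \<C> g) (Tgt \<C> g)"
    using stable_eq_arr[OF assms] by (simp_all add: Hom_iff)
  show ?thesis using stable_eq_iff_class[OF H] stable_eq_iff_class[OF H(2,1)] assms by simp
qed

lemma stable_eq_trans:
  assumes "stable_eq f g" "stable_eq g h"
  shows "stable_eq f h"
proof -
  have H: "f \<in> Hom \<C> (Src \<C> g) (Tgt \<C> g)" "g \<in> Hom \<C> (Src \<C> g) (Tgt \<C> g)" "h \<in> Hom \<C> (Src \<C> g) (Tgt \<C> g)"
    using stable_eq_arr[OF assms(1)] stable_eq_arr[OF assms(2)] by (simp_all add: Hom_iff)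
  show ?thesis
    using stable_eq_iff_class[OF H(1,2)] stable_eq_iff_class[OF H(2,3)] stable_eq_iff_class[OF H(1,3)] assms by simp
qed

lemma stable_eq_cmp_left:
  assumes "stable_eq f g" "h \<in> Mor \<C>" "Src \<C> h = Tgt \<C> g"
  shows "stable_eq (h \<bullet> f) (h \<bullet> g)"
  using assms proj_maps_cmp_left[of "f \<boxplus> neg g" "Src \<C> g" "Tgt \<C> g" h "Tgt \<C> h"]
  by (auto simp: stable_eq_def)

lemma stable_eq_cmp_right:
  assumes "stable_eq f g" "h \<in> Mor \<C>" "Tgt \<C> h = Src \<C> g"
  shows "stable_eq (f \<bullet> h) (g \<bullet> h)"
  using assms proj_maps_cmp_right[of "f \<boxplus> neg g" "Src \<C> g" "Tgt \<C> g" h "Src \<C> h"]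
  by (auto simp: stable_eq_def)

lemma stable_eq_add:
  assumes "stable_eq f f'" "stable_eq g g'" "Src \<C> f = Src \<C> g" "Tgt \<C> f = Tgt \<C> g"
  shows "stable_eq (f \<boxplus> g) (f' \<boxplus> g')"
proof -
  have T: "f \<in> Mor \<C>" "f' \<in> Mor \<C>" "g \<in> Mor \<C>" "g' \<in> Mor \<C>" "Src \<C> f = Src \<C> g'" "Tgt \<C> f = Tgt \<C> g'"
    "Src \<C> f' = Src \<C> g'" "Tgt \<C> f' = Tgt \<C> g'" "Src \<C> g = Src \<C> g'" "Tgt \<C> g = Tgt \<C> g'"
    using assms by (auto simp: stable_eq_def)
  have "(f \<boxplus> neg f') \<boxplus> (g \<boxplus> neg g') \<in> proj_maps \<C> \<E> (Src \<C> g') (Tgt \<C> g')"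
    by (rule proj_maps_add) (use assms T in \<open>simp_all add: stable_eq_def\<close>)
  also have "(f \<boxplus> neg f') \<boxplus> (g \<boxplus> neg g') = (f \<boxplus> g) \<boxplus> neg (f' \<boxplus> g')"
    using T by (simp add: add_left_comm[of "neg f'" g])
  finally show ?thesis unfolding stable_eq_def using T by simp
qed

lemma rep_stable_class:
  assumes "f \<in> Mor \<C>"
  shows "stable_eq (rep (stable_class \<C> \<E> f)) f"
proof -
  interpret comm_group "hom_group \<C> (Src \<C> f) (Tgt \<C> f)" using hom_comm_group assms by simp
  have "f \<in> stable_class \<C> \<E> f"
    unfolding stable_class_def using rcos_self[OF _ proj_maps_subgroup, of f] assms by (simp add: Hom_iff)
  then have r: "rep (stable_class \<C> \<E> f) \<in> stable_class \<C> \<E> f" unfolding rep_def by (rule someI)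
  then obtain h where h: "h \<in> proj_maps \<C> \<E> (Src \<C> f) (Tgt \<C> f)" "rep (stable_class \<C> \<E> f) = h \<boxplus> f"
    unfolding stable_class_def r_coset_def by auto
  then show ?thesis using proj_maps_arr[OF h(1)] assms by (simp add: stable_eq_def)
qed

lemma stable_hom_iff:
  assumes "X \<in> Obj \<C>" "Y \<in> Obj \<C>"
  shows "c \<in> Hom (stable_cat \<C> \<E>) X Y \<longleftrightarrow> (\<exists>f \<in> Hom \<C> X Y. c = stable_class \<C> \<E> f)"
proof
  assume "c \<in> Hom (stable_cat \<C> \<E>) X Y"
  then obtain X' Y' where *: "X' \<in> Obj \<C>" "Y' \<in> Obj \<C>" "c \<in> carrier (hom_group \<C> X' Y' Mod proj_maps \<C> \<E> X' Y')"
    and c: "Src \<C> (rep c) = X" "Tgt \<C> (rep c) = Y"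
    by (auto simp: Hom_iff stable_cat_def)
  then obtain f where f: "f \<in> Hom \<C> X' Y'" "c = stable_class \<C> \<E> f"
    by (auto simp: FactGroup_def RCOSETS_def stable_class_def Hom_iff)
  have "X' = X" "Y' = Y" using c rep_stable_class[of f] f by (auto simp: stable_eq_def Hom_iff)
  with f show "\<exists>f \<in> Hom \<C> X Y. c = stable_class \<C> \<E> f" by blast
next
  assume "\<exists>f \<in> Hom \<C> X Y. c = stable_class \<C> \<E> f"
  then obtain f where f: "f \<in> Hom \<C> X Y" "c = stable_class \<C> \<E> f" by blast
  then have "c \<in> carrier (hom_group \<C> X Y Mod proj_maps \<C> \<E> X Y)"
    by (auto simp: FactGroup_def RCOSETS_def stable_class_def Hom_iff)
  then have "c \<in> Mor (stable_cat \<C> \<E>)" using assms by (auto simp: stable_cat_def)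
  then show "c \<in> Hom (stable_cat \<C> \<E>) X Y"
    using rep_stable_class[of f] f by (auto simp: stable_eq_def Hom_iff stable_cat_def)
qed

lemma stable_cmp:
  assumes "f \<in> Hom \<C> X Y" "g \<in> Hom \<C> Y Z"
  shows "Cmp (stable_cat \<C> \<E>) (stable_class \<C> \<E> g) (stable_class \<C> \<E> f) = stable_class \<C> \<E> (g \<bullet> f)"
proof -
  let ?f = "rep (stable_class \<C> \<E> f)" and ?g = "rep (stable_class \<C> \<E> g)"
  have T: "f \<in> Mor \<C>" "Src \<C> f = X" "Tgt \<C> f = Y" "g \<in> Mor \<C>" "Src \<C> g = Y" "Tgt \<C> g = Z"
    using assms by (simp_all add: Hom_iff)
  have r: "stable_eq ?f f" "stable_eq ?g g" using rep_stable_class T by blast+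
  have R: "?f \<in> Mor \<C>" "Src \<C> ?f = X" "Tgt \<C> ?f = Y" "?g \<in> Mor \<C>" "Src \<C> ?g = Y" "Tgt \<C> ?g = Z"
    using stable_eq_arr[OF r(1)] stable_eq_arr[OF r(2)] T by simp_all
  have "stable_eq (?g \<bullet> ?f) (?g \<bullet> f)" by (rule stable_eq_cmp_left[OF r(1)]) (use R T in simp_all)
  moreover have "stable_eq (?g \<bullet> f) (g \<bullet> f)" by (rule stable_eq_cmp_right[OF r(2)]) (use R T in simp_all)
  ultimately have "stable_eq (?g \<bullet> ?f) (g \<bullet> f)" by (rule stable_eq_trans)
  then have "stable_class \<C> \<E> (?g \<bullet> ?f) = stable_class \<C> \<E> (g \<bullet> f)"
    using stable_eq_iff_class[of "?g \<bullet> ?f" X Z "g \<bullet> f"] R T by (simp add: Hom_iff)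
  then show ?thesis by (simp add: stable_cat_def)
qed

lemma stable_add:
  assumes "f \<in> Hom \<C> X Y" "g \<in> Hom \<C> X Y"
  shows "Add (stable_cat \<C> \<E>) (stable_class \<C> \<E> f) (stable_class \<C> \<E> g) = stable_class \<C> \<E> (f \<boxplus> g)"
proof -
  let ?f = "rep (stable_class \<C> \<E> f)" and ?g = "rep (stable_class \<C> \<E> g)"
  have T: "f \<in> Mor \<C>" "Src \<C> f = X" "Tgt \<C> f = Y" "g \<in> Mor \<C>" "Src \<C> g = X" "Tgt \<C> g = Y"
    using assms by (simp_all add: Hom_iff)
  have r: "stable_eq ?f f" "stable_eq ?g g" using rep_stable_class T by blast+
  have R: "?f \<in> Mor \<C>" "Src \<C> ?f = X" "Tgt \<C> ?f = Y" "?g \<in> Mor \<C>" "Src \<C> ?g = X" "Tgt \<C> ?g = Y"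
    using stable_eq_arr[OF r(1)] stable_eq_arr[OF r(2)] T by simp_all
  have "stable_eq (?f \<boxplus> ?g) (f \<boxplus> g)" by (rule stable_eq_add[OF r]) (use R in simp_all)
  then have "stable_class \<C> \<E> (?f \<boxplus> ?g) = stable_class \<C> \<E> (f \<boxplus> g)"
    using stable_eq_iff_class[of "?f \<boxplus> ?g" X Y "f \<boxplus> g"] R T by (simp add: Hom_iff)
  then show ?thesis by (simp add: stable_cat_def)
qed

lemma stable_idn: "Idn (stable_cat \<C> \<E>) X = stable_class \<C> \<E> (Idn \<C> X)"
  by (simp add: stable_cat_def)

lemma stable_nul:
  assumes "X \<in> Obj \<C>" "Y \<in> Obj \<C>"
  shows "Nul (stable_cat \<C> \<E>) X Y = stable_class \<C> \<E> (Nul \<C> X Y)"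
proof -
  interpret comm_group "hom_group \<C> X Y" using hom_comm_group assms by blast
  have "proj_maps \<C> \<E> X Y #>\<^bsub>hom_group \<C> X Y\<^esub> Nul \<C> X Y = proj_maps \<C> \<E> X Y"
    using coset_mult_one[of "proj_maps \<C> \<E> X Y"] subgroup.subset[OF proj_maps_subgroup[OF assms]] by simp
  then show ?thesis using assms by (simp add: stable_cat_def stable_class_def)
qed

lemma stable_obj [simp]: "Obj (stable_cat \<C> \<E>) = Obj \<C>"
  by (simp add: stable_cat_def)

lemma direct_summand_stable:
  assumes "is_dsum \<C> X Y S"
  shows "direct_summand (stable_cat \<C> \<E>) X S"
proof -
  obtain i1 i2 p1 p2 where bp: "biproduct \<C> X Y S i1 i2 p1 p2" using assms by (rule is_dsumE)
  note B = biprodD[OF bp]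
  have H: "i1 \<in> Hom \<C> X S" "i2 \<in> Hom \<C> Y S" "p1 \<in> Hom \<C> S X" "p2 \<in> Hom \<C> S Y"
    by (simp_all add: Hom_iff B)
  have "i1 \<bullet> p1 \<in> Hom \<C> S S" "i2 \<bullet> p2 \<in> Hom \<C> S S" by (simp_all add: Hom_iff B)
  note A = stable_add[OF this]
  have "biproduct (stable_cat \<C> \<E>) X Y S (stable_class \<C> \<E> i1) (stable_class \<C> \<E> i2) (stable_class \<C> \<E> p1) (stable_class \<C> \<E> p2)"
    unfolding biproduct_def stable_obj stable_cmp[OF H(1,3)] stable_cmp[OF H(2,4)] stable_cmp[OF H(1,4)]
      stable_cmp[OF H(2,3)] stable_cmp[OF H(3,1)] stable_cmp[OF H(4,2)] A stable_idn
      stable_nul[OF B(1,2)] stable_nul[OF B(2,1)]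
    using H by (auto simp: B stable_hom_iff)
  then show ?thesis unfolding direct_summand_def is_dsum_def by blast
qed

lemma stable_zero_iff:
  assumes "X \<in> Obj \<C>"
  shows "zero_object (stable_cat \<C> \<E>) X \<longleftrightarrow> stable_eq (Idn \<C> X) (Nul \<C> X X)"
proof
  assume "zero_object (stable_cat \<C> \<E>) X"
  then have "\<exists>!f. f \<in> Hom (stable_cat \<C> \<E>) X X" using assms by (simp add: zero_object_def)
  moreover have *: "Idn \<C> X \<in> Hom \<C> X X" "Nul \<C> X X \<in> Hom \<C> X X" using assms by (simp_all add: Hom_iff)
  ultimately have "stable_class \<C> \<E> (Idn \<C> X) = stable_class \<C> \<E> (Nul \<C> X X)"
    using stable_hom_iff[OF assms assms] by blast
  then show "stable_eq (Idn \<C> X) (Nul \<C> X X)" using stable_eq_iff_class[OF *] by simp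
next
  assume e: "stable_eq (Idn \<C> X) (Nul \<C> X X)"
  have 1: "stable_class \<C> \<E> f = stable_class \<C> \<E> (Nul \<C> X Y)" if f: "f \<in> Hom \<C> X Y" for f Y
  proof -
    have T: "f \<in> Mor \<C>" "Src \<C> f = X" "Tgt \<C> f = Y" "Y \<in> Obj \<C>"
      using f hom_obj[OF f] by (simp_all add: Hom_iff)
    have "stable_eq (f \<bullet> Idn \<C> X) (f \<bullet> Nul \<C> X X)" by (rule stable_eq_cmp_left[OF e]) (use T assms in simp_all)
    then show ?thesis using stable_eq_iff_class[of f X Y "Nul \<C> X Y"] T assms by (simp add: Hom_iff)
  qed
  have 2: "stable_class \<C> \<E> f = stable_class \<C> \<E> (Nul \<C> Y X)" if f: "f \<in> Hom \<C> Y X" for f Y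
  proof -
    have T: "f \<in> Mor \<C>" "Src \<C> f = Y" "Tgt \<C> f = X" "Y \<in> Obj \<C>"
      using f hom_obj[OF f] by (simp_all add: Hom_iff)
    have "stable_eq (Idn \<C> X \<bullet> f) (Nul \<C> X X \<bullet> f)" by (rule stable_eq_cmp_right[OF e]) (use T assms in simp_all)
    then show ?thesis using stable_eq_iff_class[of f Y X "Nul \<C> Y X"] T assms by (simp add: Hom_iff)
  qed
  show "zero_object (stable_cat \<C> \<E>) X"
    unfolding zero_object_def stable_obj
  proof (intro conjI ballI)
    fix Y assume Y: "Y \<in> Obj \<C>"
    have "Nul \<C> X Y \<in> Hom \<C> X Y" "Nul \<C> Y X \<in> Hom \<C> Y X" using assms Y by (simp_all add: Hom_iff)
    then show "\<exists>!f. f \<in> Hom (stable_cat \<C> \<E>) Y X" "\<exists>!f. f \<in> Hom (stable_cat \<C> \<E>) X Y"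
      unfolding stable_hom_iff[OF assms Y] stable_hom_iff[OF Y assms] using 1 2 by metis+
  qed (rule assms)
qed

lemma stably_zero_projective:
  assumes "X \<in> Obj \<C>" "stable_eq (Idn \<C> X) (Nul \<C> X X)"
  shows "projective \<C> \<E> X"
proof -
  have "Idn \<C> X \<in> proj_maps \<C> \<E> X X" using assms by (simp add: stable_eq_def)
  then obtain u v P where "Idn \<C> X = v \<bullet> u" "projective \<C> \<E> P" "u \<in> Mor \<C>" "Src \<C> u = X" "Tgt \<C> u = P"
    "v \<in> Mor \<C>" "Src \<C> v = P" "Tgt \<C> v = X"
    by (rule proj_mapsE)
  then show ?thesis using projective_retract retractI by metis
qed

lemma stable_dsumE:
  assumes "is_dsum (stable_cat \<C> \<E>) X Y S"
  obtains i1 i2 p1 p2 where "i1 \<in> Hom \<C> X S" "i2 \<in> Hom \<C> Y S" "p1 \<in> Hom \<C> S X" "p2 \<in> Hom \<C> S Y"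
    "stable_eq (p1 \<bullet> i1) (Idn \<C> X)" "stable_eq (p2 \<bullet> i2) (Idn \<C> Y)" "stable_eq (p2 \<bullet> i1) (Nul \<C> X Y)"
proof -
  obtain c1 c2 d1 d2 where bp: "biproduct (stable_cat \<C> \<E>) X Y S c1 c2 d1 d2"
    using assms by (auto simp: is_dsum_def)
  then have O: "X \<in> Obj \<C>" "Y \<in> Obj \<C>" "S \<in> Obj \<C>" by (simp_all add: biproduct_def)
  obtain i1 i2 p1 p2 where H: "i1 \<in> Hom \<C> X S" "i2 \<in> Hom \<C> Y S" "p1 \<in> Hom \<C> S X" "p2 \<in> Hom \<C> S Y"
    and c: "c1 = stable_class \<C> \<E> i1" "c2 = stable_class \<C> \<E> i2" "d1 = stable_class \<C> \<E> p1" "d2 = stable_class \<C> \<E> p2"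
    using bp unfolding biproduct_def by (auto simp: stable_hom_iff O)
  have "stable_class \<C> \<E> (p1 \<bullet> i1) = stable_class \<C> \<E> (Idn \<C> X)"
    "stable_class \<C> \<E> (p2 \<bullet> i2) = stable_class \<C> \<E> (Idn \<C> Y)"
    "stable_class \<C> \<E> (p2 \<bullet> i1) = stable_class \<C> \<E> (Nul \<C> X Y)"
    using bp unfolding biproduct_def c stable_cmp[OF H(1,3)] stable_cmp[OF H(2,4)] stable_cmp[OF H(1,4)]
      stable_idn stable_nul[OF O(1,2)] by simp_all
  moreover have "p1 \<bullet> i1 \<in> Hom \<C> X X" "p2 \<bullet> i2 \<in> Hom \<C> Y Y" "p2 \<bullet> i1 \<in> Hom \<C> X Y"
    "Idn \<C> X \<in> Hom \<C> X X" "Idn \<C> Y \<in> Hom \<C> Y Y" "Nul \<C> X Y \<in> Hom \<C> X Y"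
    using H O by (simp_all add: Hom_iff)
  ultimately have "stable_eq (p1 \<bullet> i1) (Idn \<C> X)" "stable_eq (p2 \<bullet> i2) (Idn \<C> Y)" "stable_eq (p2 \<bullet> i1) (Nul \<C> X Y)"
    using stable_eq_iff_class by blast+
  with H show thesis by (rule that)
qed

text \<open>
  A stable decomposition of \<open>Y\<close> provides a stable idempotent \<open>e = i\<^sub>1 p\<^sub>1\<close>. Since \<open>e\<close> or \<open>1 - e\<close> is invertible,
  one of the two summands is stably zero.
\<close>

lemma local_object_stably_indecomposable:
  assumes "local_object Y" "\<not> projective \<C> \<E> Y"
  shows "indecomposable (stable_cat \<C> \<E>) Y"
  unfolding indecomposable_def stable_obj
proof (intro conjI allI impI)
  show Y: "Y \<in> Obj \<C>" using assms(1) by (simp add: local_object_def)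
  show "\<not> zero_object (stable_cat \<C> \<E>) Y" using stable_zero_iff[OF Y] stably_zero_projective[OF Y] assms(2) by blast
  fix S T assume "is_dsum (stable_cat \<C> \<E>) S T Y"
  then obtain i1 i2 p1 p2 where H: "i1 \<in> Hom \<C> S Y" "i2 \<in> Hom \<C> T Y" "p1 \<in> Hom \<C> Y S" "p2 \<in> Hom \<C> Y T"
    and e11: "stable_eq (p1 \<bullet> i1) (Idn \<C> S)" and e22: "stable_eq (p2 \<bullet> i2) (Idn \<C> T)"
    and e21: "stable_eq (p2 \<bullet> i1) (Nul \<C> S T)"
    by (rule stable_dsumE)
  have O: "S \<in> Obj \<C>" "T \<in> Obj \<C>" using hom_obj H by blast+
  have M: "i1 \<in> Mor \<C>" "Src \<C> i1 = S" "Tgt \<C> i1 = Y" "i2 \<in> Mor \<C>" "Src \<C> i2 = T" "Tgt \<C> i2 = Y"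
    "p1 \<in> Mor \<C>" "Src \<C> p1 = Y" "Tgt \<C> p1 = S" "p2 \<in> Mor \<C>" "Src \<C> p2 = Y" "Tgt \<C> p2 = T"
    using H by (simp_all add: Hom_iff)
  have sq: "stable_eq ((p \<bullet> i) \<bullet> (p \<bullet> i)) (Idn \<C> X)"
    if "stable_eq (p \<bullet> i) (Idn \<C> X)" "i \<in> Hom \<C> X Y" "p \<in> Hom \<C> Y X" "X \<in> Obj \<C>" for i p X
  proof -
    have "stable_eq ((p \<bullet> i) \<bullet> (p \<bullet> i)) ((p \<bullet> i) \<bullet> Idn \<C> X)"
      by (rule stable_eq_cmp_left[OF that(1)]) (use that in \<open>simp_all add: Hom_iff\<close>)
    moreover have "(p \<bullet> i) \<bullet> Idn \<C> X = p \<bullet> i" using that by (simp add: Hom_iff)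
    ultimately show ?thesis using stable_eq_trans[OF _ that(1)] by simp
  qed
  let ?e = "i1 \<bullet> p1" and ?e' = "Idn \<C> Y \<boxplus> neg (i1 \<bullet> p1)"
  have "?e \<boxplus> ?e' = ?e' \<boxplus> ?e" by (rule add_comm) (simp_all add: M Y)
  also have "\<dots> = Idn \<C> Y" by (simp add: M Y)
  finally have "iso_arrow \<C> ?e \<or> iso_arrow \<C> ?e'"
    by (intro local_object_sum_idn[OF assms(1)]) (simp_all add: M Y Hom_iff)
  then show "zero_object (stable_cat \<C> \<E>) S \<or> zero_object (stable_cat \<C> \<E>) T"
  proof
    assume "iso_arrow \<C> ?e"
    then obtain a where a: "inverse_arrows ?e a" by (auto simp: iso_arrow_iff)
    note A = inverse_arrowsD(2-6)[OF a]
    have aM: "a \<in> Mor \<C>" "Src \<C> a = Y" "Tgt \<C> a = Y" "i1 \<bullet> (p1 \<bullet> a) = Idn \<C> Y"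
      using A M by simp_all
    let ?x = "p1 \<bullet> (a \<bullet> i2)"
    have "stable_eq ((p2 \<bullet> i1) \<bullet> ?x) (Nul \<C> S T \<bullet> ?x)"
      by (rule stable_eq_cmp_right[OF e21]) (simp_all add: M aM O)
    moreover have "(p2 \<bullet> i1) \<bullet> ?x = p2 \<bullet> i2"
    proof -
      have "(p2 \<bullet> i1) \<bullet> ?x = p2 \<bullet> ((i1 \<bullet> (p1 \<bullet> a)) \<bullet> i2)" using M aM(1-3) by simp
      also have "\<dots> = p2 \<bullet> i2" unfolding aM(4) using M by simp
      finally show ?thesis .
    qed
    ultimately have "stable_eq (p2 \<bullet> i2) (Nul \<C> T T)" using M aM O by simp
    then have "stable_eq (Idn \<C> T) (Nul \<C> T T)" using e22 stable_eq_sym stable_eq_trans by blast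
    then show ?thesis using stable_zero_iff[OF O(2)] by blast
  next
    assume "iso_arrow \<C> ?e'"
    then obtain a where a: "inverse_arrows ?e' a" by (auto simp: iso_arrow_iff)
    note A = inverse_arrowsD(2-5)[OF a]
    have aM: "a \<in> Mor \<C>" "Src \<C> a = Y" "Tgt \<C> a = Y" "a \<boxplus> neg (a \<bullet> (i1 \<bullet> p1)) = Idn \<C> Y"
      using A M Y by simp_all
    let ?x = "p1 \<bullet> i1" and ?y = "p1 \<bullet> (a \<bullet> i1)"
    have yM: "?y \<in> Mor \<C>" "Src \<C> ?y = S" "Tgt \<C> ?y = S" using M aM by simp_all
    have "stable_eq (?y \<bullet> ?x) (?y \<bullet> Idn \<C> S)"
      by (rule stable_eq_cmp_left[OF e11]) (use yM O in simp_all)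
    then have "stable_eq (?y \<bullet> ?x) ?y" using yM by simp
    moreover have "stable_eq (neg (?y \<bullet> ?x)) (neg (?y \<bullet> ?x))" using yM M by (intro stable_eq_refl) simp
    ultimately have "stable_eq (?y \<bullet> ?x \<boxplus> neg (?y \<bullet> ?x)) (?y \<boxplus> neg (?y \<bullet> ?x))"
      by (rule stable_eq_add) (use yM M in simp_all)
    moreover have "?y \<bullet> ?x \<boxplus> neg (?y \<bullet> ?x) = Nul \<C> S S" using yM M O by (subst add_neg) simp_all
    moreover have "?y \<boxplus> neg (?y \<bullet> ?x) = p1 \<bullet> i1"
    proof -
      have "?y \<boxplus> neg (?y \<bullet> ?x) = p1 \<bullet> ((a \<boxplus> neg (a \<bullet> (i1 \<bullet> p1))) \<bullet> i1)" using M aM(1-3) by simp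
      also have "\<dots> = p1 \<bullet> i1" unfolding aM(4) using M by simp
      finally show ?thesis .
    qed
    ultimately have "stable_eq (Nul \<C> S S) (p1 \<bullet> i1)" by simp
    then have "stable_eq (Idn \<C> S) (Nul \<C> S S)" using e11 stable_eq_sym stable_eq_trans by blast
    then show ?thesis using stable_zero_iff[OF O(1)] by blast
  qed
qed

end

section \<open>Existence of the Igusa--Todorov function\<close>

text \<open>
  Finitely generated free abelian groups are Noetherian. A chain of subgroups of \<open>\<int>\<close> stops once it contains the least positive
  integer that ever occurs. In general a chain stops when both its projections to one coordinate and
  the kernels of these projections do.
\<close>

lemma int_diff_closed_mult:
  fixes J :: "int set"
  assumes "0 \<in> J" "\<And>x y. x \<in> J \<Longrightarrow> y \<in> J \<Longrightarrow> x - y \<in> J" "d \<in> J"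
  shows "q * d \<in> J"
proof -
  have nat: "int n * d \<in> J" for n
  proof (induction n)
    case (Suc n)
    have "- d \<in> J" using assms(2)[OF assms(1,3)] by simp
    from assms(2)[OF Suc this] show ?case by (simp add: algebra_simps)
  qed (simp add: assms(1))
  show ?thesis
  proof (cases "0 \<le> q")
    case True
    then show ?thesis using nat[of "nat q"] by simp
  next
    case False
    then show ?thesis using assms(2)[OF assms(1) nat[of "nat (- q)"]] by simp
  qed
qed

lemma int_subgroup_chain:
  fixes J :: "nat \<Rightarrow> int set"
  assumes mono: "\<And>m. J m \<subseteq> J (Suc m)" and zero: "\<And>m. 0 \<in> J m"
    and diff: "\<And>m x y. x \<in> J m \<Longrightarrow> y \<in> J m \<Longrightarrow> x - y \<in> J m"
  shows "\<exists>k. \<forall>m\<ge>k. J m = J k"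
proof (cases "\<exists>m. J m \<noteq> {0}")
  case False
  then show ?thesis by blast
next
  case True
  have le: "J m \<subseteq> J n" if "m \<le> n" for m n using lift_Suc_mono_le[of J, OF mono that] .
  from True zero obtain m x where x: "x \<in> J m" "x \<noteq> 0" by blast
  have "0 - x \<in> J m" using diff zero x by blast
  then have "\<bar>x\<bar> \<in> J m" using x by (cases "0 \<le> x") auto
  then have ex: "\<exists>n>0. \<exists>m. int n \<in> J m" using x(2) by (intro exI[of _ "nat \<bar>x\<bar>"]) auto
  define d where "d = (LEAST n. n > 0 \<and> (\<exists>m. int n \<in> J m))"
  have "d > 0 \<and> (\<exists>m. int d \<in> J m)" unfolding d_def by (rule LeastI_ex) (use ex in blast)
  then obtain k where d: "d > 0" "int d \<in> J k" by blast
  have min: "d \<le> n" if "n > 0" "int n \<in> J m" for n m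
    unfolding d_def by (rule Least_le) (use that in blast)
  have "J m \<subseteq> J k" if m: "k \<le> m" for m
  proof
    fix x assume x: "x \<in> J m"
    have "(x div int d) * int d \<in> J m"
      by (rule int_diff_closed_mult) (use zero diff le[OF m] d(2) in auto)
    then have "x - (x div int d) * int d \<in> J m" using diff x by blast
    then have r: "x mod int d \<in> J m" by (simp add: minus_div_mult_eq_mod)
    have "x mod int d = 0"
    proof (rule ccontr)
      assume "x mod int d \<noteq> 0"
      then have "nat (x mod int d) > 0" 
        using d(1) pos_mod_sign[of "int d" x] by linarith
      moreover have "int (nat (x mod int d)) \<in> J m" using r d(1) by simp
      ultimately have "d \<le> nat (x mod int d)" by (rule min)
      then show False using pos_mod_bound[of "int d" x] d(1) by linarith
    qed
    then have "x = (x div int d) * int d" using div_mult_mod_eq[of x "int d"] by simp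
    also have "\<dots> \<in> J k" by (rule int_diff_closed_mult) (use zero diff d(2) in auto)
    finally show "x \<in> J k" .
  qed
  then show ?thesis using le by blast
qed

lemma frag_subgroup_chain:
  fixes H :: "nat \<Rightarrow> ('c \<Rightarrow>\<^sub>0 int) set"
  assumes "finite F" "\<And>m x. x \<in> H m \<Longrightarrow> Poly_Mapping.keys x \<subseteq> F" "\<And>m. H m \<subseteq> H (Suc m)" "\<And>m. 0 \<in> H m"
    "\<And>m x y. x \<in> H m \<Longrightarrow> y \<in> H m \<Longrightarrow> x - y \<in> H m"
  shows "\<exists>k. \<forall>m\<ge>k. H m = H k"
  using assms
proof (induction F arbitrary: H rule: finite_induct)
  case empty
  have "H m = {0}" for m
  proof
    show "H m \<subseteq> {0}" using empty(1) by auto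
  qed (use empty(3) in simp)
  then show ?case by blast
next
  case (insert a F)
  have le: "H m \<subseteq> H n" if "m \<le> n" for m n using lift_Suc_mono_le[of H, OF insert.prems(2) that] .
  define H' where "H' m = {x \<in> H m. Poly_Mapping.lookup x a = 0}" for m
  have "\<exists>k. \<forall>m\<ge>k. H' m = H' k"
  proof (rule insert.IH)
    fix m x assume x: "x \<in> H' m"
    then have "x \<in> H m" "a \<notin> Poly_Mapping.keys x" by (simp_all add: H'_def in_keys_iff)
    then show "Poly_Mapping.keys x \<subseteq> F" using insert.prems(1) by blast
  next
    fix m show "H' m \<subseteq> H' (Suc m)" "0 \<in> H' m" using insert.prems(2,3) by (auto simp: H'_def)
  next
    fix m x y assume "x \<in> H' m" "y \<in> H' m"
    then show "x - y \<in> H' m" using insert.prems(4) by (simp add: H'_def Poly_Mapping.lookup_minus)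
  qed
  then obtain k1 where k1: "\<forall>m\<ge>k1. H' m = H' k1" by blast
  have "\<exists>k. \<forall>m\<ge>k. (\<lambda>x. Poly_Mapping.lookup x a) ` H m = (\<lambda>x. Poly_Mapping.lookup x a) ` H k"
  proof (rule int_subgroup_chain)
    fix m
    show "(\<lambda>x. Poly_Mapping.lookup x a) ` H m \<subseteq> (\<lambda>x. Poly_Mapping.lookup x a) ` H (Suc m)"
      using insert.prems(2) by blast
    show "0 \<in> (\<lambda>x. Poly_Mapping.lookup x a) ` H m"
      by (rule image_eqI[of _ _ 0]) (simp_all add: insert.prems(3))
    fix u v assume "u \<in> (\<lambda>x. Poly_Mapping.lookup x a) ` H m" "v \<in> (\<lambda>x. Poly_Mapping.lookup x a) ` H m"
    then obtain x y where "x \<in> H m" "y \<in> H m" "u = Poly_Mapping.lookup x a" "v = Poly_Mapping.lookup y a" by blast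
    then show "u - v \<in> (\<lambda>x. Poly_Mapping.lookup x a) ` H m"
      by (intro image_eqI[of _ _ "x - y"]) (simp_all add: insert.prems(4) Poly_Mapping.lookup_minus)
  qed
  then obtain k2 where k2: "\<forall>m\<ge>k2. (\<lambda>x. Poly_Mapping.lookup x a) ` H m = (\<lambda>x. Poly_Mapping.lookup x a) ` H k2"
    by blast
  let ?k = "max k1 k2"
  have "H m \<subseteq> H ?k" if m: "?k \<le> m" for m
  proof
    fix x assume x: "x \<in> H m"
    have "(\<lambda>x. Poly_Mapping.lookup x a) ` H m = (\<lambda>x. Poly_Mapping.lookup x a) ` H ?k"
      using k2 m by (metis max.bounded_iff max.cobounded2)
    with x obtain y where y: "y \<in> H ?k" "Poly_Mapping.lookup x a = Poly_Mapping.lookup y a" by blast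
    then have "x - y \<in> H m" using insert.prems(4) x le[OF m] by blast
    then have "x - y \<in> H' m" using y(2) by (simp add: H'_def Poly_Mapping.lookup_minus)
    also have "H' m = H' ?k" using k1 m by (metis max.bounded_iff max.cobounded1)
    finally have "x - y \<in> H ?k" by (simp add: H'_def)
    moreover have "0 - y \<in> H ?k" using insert.prems(3,4) y by blast
    ultimately have "(x - y) - (0 - y) \<in> H ?k" using insert.prems(4) by blast
    then show "x \<in> H ?k" by simp
  qed
  then show ?case using le by blast
qed

context strong_exact_IT_context
begin

definition stable_retract where
  "stable_retract Y X \<longleftrightarrow> (\<exists>i \<in> Hom \<C> Y X. \<exists>p \<in> Hom \<C> X Y. stable_eq (p \<bullet> i) (Idn \<C> Y))"

lemma stable_retract_trans:
  assumes "retract Z Y" "stable_retract Y X"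
  shows "stable_retract Z X"
proof -
  obtain j q where *: "j \<in> Mor \<C>" "q \<in> Mor \<C>" "Src \<C> j = Z" "Tgt \<C> j = Y" "Src \<C> q = Y" "Tgt \<C> q = Z"
    "q \<bullet> j = Idn \<C> Z" "Y \<in> Obj \<C>"
    using assms(1) by (rule retractE)
  obtain i p where H: "i \<in> Hom \<C> Y X" "p \<in> Hom \<C> X Y" and e: "stable_eq (p \<bullet> i) (Idn \<C> Y)"
    using assms(2) by (auto simp: stable_retract_def)
  have T: "i \<in> Mor \<C>" "Src \<C> i = Y" "Tgt \<C> i = X" "p \<in> Mor \<C>" "Src \<C> p = X" "Tgt \<C> p = Y"
    using H by (simp_all add: Hom_iff)
  have "stable_eq (q \<bullet> (p \<bullet> i)) (q \<bullet> Idn \<C> Y)" by (rule stable_eq_cmp_left[OF e]) (use * in simp_all)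
  then have "stable_eq (q \<bullet> (p \<bullet> i) \<bullet> j) (q \<bullet> Idn \<C> Y \<bullet> j)" by (rule stable_eq_cmp_right) (use * in simp_all)
  moreover have "q \<bullet> (p \<bullet> i) \<bullet> j = (q \<bullet> p) \<bullet> (i \<bullet> j)" "q \<bullet> Idn \<C> Y \<bullet> j = Idn \<C> Z" using * T by simp_all
  ultimately have "stable_eq ((q \<bullet> p) \<bullet> (i \<bullet> j)) (Idn \<C> Z)" by simp
  moreover have "i \<bullet> j \<in> Hom \<C> Z X" "q \<bullet> p \<in> Hom \<C> X Z" using * T by (simp_all add: Hom_iff)
  ultimately show ?thesis unfolding stable_retract_def by blast
qed

text \<open>
  The composite \<open>p i\<close> differs from the identity of \<open>L\<close> by an endomorphism that factors through a projective object. The latter is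
  not invertible, for otherwise \<open>L\<close> would be projective; so \<open>p i\<close> is invertible.
\<close>

lemma local_stable_retract:
  assumes "local_object L" "\<not> projective \<C> \<E> L" "stable_retract L X"
  shows "retract L X"
proof -
  obtain i p where H: "i \<in> Hom \<C> L X" "p \<in> Hom \<C> X L" and e: "stable_eq (p \<bullet> i) (Idn \<C> L)"
    using assms(3) by (auto simp: stable_retract_def)
  have T: "i \<in> Mor \<C>" "Src \<C> i = L" "Tgt \<C> i = X" "p \<in> Mor \<C>" "Src \<C> p = X" "Tgt \<C> p = L"
    using H by (simp_all add: Hom_iff)
  have L: "L \<in> Obj \<C>" using assms(1) by (simp add: local_object_def)
  have "p \<bullet> i \<boxplus> neg (Idn \<C> L) \<in> proj_maps \<C> \<E> L L" using e L by (simp add: stable_eq_def)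
  from proj_maps_neg[OF this] have n: "neg (p \<bullet> i) \<boxplus> Idn \<C> L \<in> proj_maps \<C> \<E> L L" using T L by simp
  have "p \<bullet> i \<boxplus> (neg (p \<bullet> i) \<boxplus> Idn \<C> L) = Idn \<C> L" using T L by simp
  then have "iso_arrow \<C> (p \<bullet> i) \<or> iso_arrow \<C> (neg (p \<bullet> i) \<boxplus> Idn \<C> L)"
    by (intro local_object_sum_idn[OF assms(1)]) (use T L in \<open>simp_all add: Hom_iff\<close>)
  then show ?thesis
  proof
    assume "iso_arrow \<C> (p \<bullet> i)"
    then show ?thesis by (rule iso_cmp_retract) (use T in simp_all)
  next
    assume iso: "iso_arrow \<C> (neg (p \<bullet> i) \<boxplus> Idn \<C> L)"
    from n obtain u v P where uv: "neg (p \<bullet> i) \<boxplus> Idn \<C> L = v \<bullet> u" "projective \<C> \<E> P" "u \<in> Mor \<C>"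
      "Src \<C> u = L" "Tgt \<C> u = P" "v \<in> Mor \<C>" "Src \<C> v = P" "Tgt \<C> v = L"
      by (rule proj_mapsE)
    have "retract L P" by (rule iso_cmp_retract[OF iso[unfolded uv(1)]]) (use uv in simp_all)
    then show ?thesis using projective_retract[OF uv(2)] assms(2) by blast
  qed
qed

lemma retract_zero:
  assumes "retract Y Z" "zero_object \<C> Z"
  shows "zero_object \<C> Y"
proof -
  obtain i p where *: "i \<in> Mor \<C>" "p \<in> Mor \<C>" "Src \<C> i = Y" "Tgt \<C> i = Z" "Src \<C> p = Z" "Tgt \<C> p = Y"
    "p \<bullet> i = Idn \<C> Y" "Y \<in> Obj \<C>" "Z \<in> Obj \<C>"
    using assms(1) by (rule retractE)
  have "p = Nul \<C> Z Y" using zero_object_arrow(1)[OF assms(2) *(2,5)] *(6) by simp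
  then have "p \<bullet> i = Nul \<C> Y Y" using * by simp
  then show ?thesis using * by (simp add: zero_object_iff)
qed

text \<open>
  A local retract of \<open>X \<oplus> M\<close> is one of \<open>X\<close> or of \<open>M\<close>, and a local retract of a local object \<open>M\<close> is \<open>M\<close> itself.
\<close>

lemma finite_local_retracts:
  assumes "X \<in> Obj \<C>"
  shows "\<exists>F. finite F \<and> F \<subseteq> isoclasses \<and> (\<forall>L. local_object L \<longrightarrow> retract L X \<longrightarrow> isoclass \<C> L \<in> F)"
  using assms
proof (induction rule: local_sum_induct)
  case (zero Z)
  then have "\<not> retract L Z" if "local_object L" for L
    using retract_zero local_object_nonzero that by blast
  then show ?case by blast
next
  case (step X M S)
  obtain F where F: "finite F" "F \<subseteq> isoclasses" "\<And>L. local_object L \<Longrightarrow> retract L X \<Longrightarrow> isoclass \<C> L \<in> F"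
    using step.IH by blast
  have M: "M \<in> Obj \<C>" using step(2) by (simp add: local_object_def)
  have "isoclass \<C> L \<in> insert (isoclass \<C> M) F" if L: "local_object L" "retract L S" for L
  proof -
    obtain i1 i2 p1 p2 where bp: "biproduct \<C> X M S i1 i2 p1 p2" using step(3) by (rule is_dsumE)
    obtain i p where "i \<in> Hom \<C> L S" "p \<in> Hom \<C> S L" "p \<bullet> i = Idn \<C> L" using L(2) by (auto simp: retract_def)
    from local_retract_sum[OF L(1) bp this] show ?thesis
    proof
      assume "retract L X"
      then show ?thesis using F(3) L(1) by blast
    next
      assume "retract L M"
      then obtain j q where jq: "j \<in> Hom \<C> L M" "q \<in> Hom \<C> M L" "q \<bullet> j = Idn \<C> L" by (auto simp: retract_def)
      have "inverse_arrows j q" by (rule retract_of_local[OF step(2) local_object_nonzero[OF L(1)] jq])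
      then have "isomorphic L M" by (rule isomorphicI) (use jq in \<open>simp_all add: Hom_iff\<close>)
      then show ?thesis using isoclass_eq L(1) by (simp add: local_object_def)
    qed
  qed
  then show ?case using F(1,2) M by (intro exI[of _ "insert (isoclass \<C> M) F"]) blast
qed

lemma K_coset_img_mult:
  assumes "F \<subseteq> isoclasses" "x \<in> K_coset ` {x. Poly_Mapping.keys x \<subseteq> F}" "y \<in> K_coset ` {x. Poly_Mapping.keys x \<subseteq> F}"
  shows "x \<otimes>\<^bsub>K_group \<C> \<E>\<^esub> y \<in> K_coset ` {x. Poly_Mapping.keys x \<subseteq> F}"
proof -
  obtain a b where *: "Poly_Mapping.keys a \<subseteq> F" "Poly_Mapping.keys b \<subseteq> F" "x = K_coset a" "y = K_coset b"
    using assms by blast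
  have "x \<otimes>\<^bsub>K_group \<C> \<E>\<^esub> y = K_coset (a + b)"
    using K_coset.hom_mult[of a b] * assms(1) by simp
  then show ?thesis using keys_add_subset[OF *(1,2)] by blast
qed

text \<open>
  The class of a stable summand \<open>N\<close> of \<open>X\<close> is the sum of the classes of its local summands, which are projective or
  retracts of \<open>X\<close>.
\<close>

lemma K_span_finitely_generated:
  assumes "X \<in> Obj \<C>"
  obtains F where "finite F" "F \<subseteq> isoclasses" "K_span \<C> \<E> X \<subseteq> K_coset ` {x. Poly_Mapping.keys x \<subseteq> F}"
proof -
  obtain F where F: "finite F" "F \<subseteq> isoclasses" "\<And>L. local_object L \<Longrightarrow> retract L X \<Longrightarrow> isoclass \<C> L \<in> F"
    using finite_local_retracts[OF assms] by blast
  let ?I = "K_coset ` {x. Poly_Mapping.keys x \<subseteq> F}"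
  have one: "\<one>\<^bsub>K_group \<C> \<E>\<^esub> \<in> ?I"
  proof (rule image_eqI[of _ _ 0])
    show "\<one>\<^bsub>K_group \<C> \<E>\<^esub> = K_coset 0" using K_coset.hom_one by simp
  qed simp
  have cls: "K_class \<C> \<E> N \<in> ?I" if "stable_retract N X" "N \<in> Obj \<C>" for N
    using that(2,1)
  proof (induction rule: local_sum_induct)
    case (zero Z)
    then show ?case using one K_class_projective[OF projective_zero] by simp
  next
    case (step N L S)
    have "stable_retract N X" "stable_retract L X"
      using stable_retract_trans[OF _ step(4)] dsum_retract[OF step(3)] by blast+
    then have N: "K_class \<C> \<E> N \<in> ?I" and L: "stable_retract L X" using step.IH by blast+
    have "K_class \<C> \<E> L \<in> ?I"
    proof (cases "projective \<C> \<E> L")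
      case True
      then show ?thesis using one K_class_projective by simp
    next
      case False
      then have "isoclass \<C> L \<in> F" using F(3) local_stable_retract step(2) L by blast
      then show ?thesis unfolding K_class_coset by (intro imageI) simp
    qed
    then show ?case using K_coset_img_mult[OF F(2) N] K_class_dsum[OF step(3)] by simp
  qed
  let ?Fs = "{x :: 'a set \<Rightarrow>\<^sub>0 int. Poly_Mapping.keys x \<subseteq> F}"
  have "subgroup ?Fs (isoclass_group \<C>)"
  proof (rule G.subgroupI)
    show "?Fs \<subseteq> carrier (isoclass_group \<C>)" using F(2) by auto
    have "0 \<in> ?Fs" by simp
    then show "?Fs \<noteq> {}" by blast
  next
    fix a assume "a \<in> ?Fs"
    then have "Poly_Mapping.keys a \<subseteq> F" by simp
    then show "inv\<^bsub>isoclass_group \<C>\<^esub> a \<in> ?Fs"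
      using isoclass_group_inv[of a] order_trans[OF _ F(2)] by simp
  next
    fix a b assume "a \<in> ?Fs" "b \<in> ?Fs"
    then show "a \<otimes>\<^bsub>isoclass_group \<C>\<^esub> b \<in> ?Fs" using keys_add_subset[of a F b] by simp
  qed
  then have sub: "subgroup ?I (K_group \<C> \<E>)" by (rule K_coset.subgroup_img_is_subgroup)
  have "{K_class \<C> \<E> N | N. indecomposable (stable_cat \<C> \<E>) N \<and> direct_summand (stable_cat \<C> \<E>) N X} \<subseteq> ?I"
  proof
    fix c assume "c \<in> {K_class \<C> \<E> N | N. indecomposable (stable_cat \<C> \<E>) N \<and> direct_summand (stable_cat \<C> \<E>) N X}"
    then obtain N M where N: "c = K_class \<C> \<E> N" "is_dsum (stable_cat \<C> \<E>) N M X"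
      by (auto simp: direct_summand_def)
    from N(2) obtain i1 i2 p1 p2 where H: "i1 \<in> Hom \<C> N X" "p1 \<in> Hom \<C> X N" "stable_eq (p1 \<bullet> i1) (Idn \<C> N)"
      by (rule stable_dsumE)
    then have "stable_retract N X" unfolding stable_retract_def by blast
    moreover have "N \<in> Obj \<C>" using hom_obj[OF H(1)] by simp
    ultimately show "c \<in> ?I" using cls N(1) by blast
  qed
  then have "K_span \<C> \<E> X \<subseteq> ?I" unfolding K_span_def by (rule K.generate_subgroup_incl[OF _ sub])
  with F(1,2) show thesis by (rule that)
qed

lemma K_span_subgroup: "subgroup (K_span \<C> \<E> X) (K_group \<C> \<E>)"
proof -
  have "N \<in> Obj \<C>" if "indecomposable (stable_cat \<C> \<E>) N" for N
    using that by (simp add: indecomposable_def)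
  then show ?thesis unfolding K_span_def by (intro K.generate_is_subgroup) auto
qed

text \<open>
  The local summands of \<open>Y\<close> are projective, or else stably indecomposable summands of \<open>X\<close>.
\<close>

lemma retract_K_span:
  assumes "Y \<in> Obj \<C>" "retract Y X"
  shows "K_class \<C> \<E> Y \<in> K_span \<C> \<E> X"
  using assms
proof (induction rule: local_sum_induct)
  case (zero Z)
  then show ?case using subgroup.one_closed[OF K_span_subgroup] K_class_projective[OF projective_zero] by simp
next
  case (step Y L S)
  have r: "retract Y X" "retract L X" using retract_trans[OF _ step(4)] dsum_retract[OF step(3)] by blast+
  have "K_class \<C> \<E> L \<in> K_span \<C> \<E> X"
  proof (cases "projective \<C> \<E> L")
    case True
    then show ?thesis using subgroup.one_closed[OF K_span_subgroup] K_class_projective by simp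
  next
    case False
    obtain Z where "is_dsum \<C> L Z X" using retract_direct_summand[OF r(2)] by blast
    then have "direct_summand (stable_cat \<C> \<E>) L X" by (rule direct_summand_stable)
    then show ?thesis unfolding K_span_def
      using local_object_stably_indecomposable[OF step(2) False] by (intro generate.incl) blast
  qed
  then show ?case
    using subgroup.m_closed[OF K_span_subgroup] step.IH[OF r(1)] K_class_dsum[OF step(3)] by simp
qed

text \<open>
  The kernels of the powers of the syzygy endomorphism on a finitely generated subgroup form an
  ascending chain, which stops; from then on the endomorphism is injective on the images.
\<close>

lemma IT_Phi_iso:
  assumes "X \<in> Obj \<C>" "IT_Phi \<C> \<E> X \<le> m"
  shows "K_syzygy \<C> \<E> \<in>
     iso ((K_group \<C> \<E>)\<lparr>carrier := (K_syzygy \<C> \<E> ^^ m) ` K_span \<C> \<E> X\<rparr>)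
         ((K_group \<C> \<E>)\<lparr>carrier := (K_syzygy \<C> \<E> ^^ Suc m) ` K_span \<C> \<E> X\<rparr>)"
proof -
  let ?L = "K_syzygy \<C> \<E>" and ?S = "K_span \<C> \<E> X"
  let ?P = "\<lambda>k. \<forall>m\<ge>k. ?L \<in> iso ((K_group \<C> \<E>)\<lparr>carrier := (?L ^^ m) ` ?S\<rparr>) ((K_group \<C> \<E>)\<lparr>carrier := (?L ^^ Suc m) ` ?S\<rparr>)"
  obtain F where F: "finite F" "F \<subseteq> isoclasses" "?S \<subseteq> K_coset ` {x. Poly_Mapping.keys x \<subseteq> F}"
    by (rule K_span_finitely_generated[OF assms(1)])
  interpret L: group_hom "K_group \<C> \<E>" "K_group \<C> \<E>" ?L by unfold_locales (rule K_syzygy_hom)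
  have Ln: "group_hom (K_group \<C> \<E>) (K_group \<C> \<E>) (?L ^^ n)" for n
    by unfold_locales (rule K_syzygy_funpow_hom)
  have S: "?S \<subseteq> carrier (K_group \<C> \<E>)" by (rule subgroup.subset[OF K_span_subgroup])
  define H where "H m = {x. Poly_Mapping.keys x \<subseteq> F \<and> (?L ^^ m) (K_coset x) = \<one>\<^bsub>K_group \<C> \<E>\<^esub>}" for m
  have diff: "(?L ^^ m) (K_coset (x - y)) \<otimes>\<^bsub>K_group \<C> \<E>\<^esub> (?L ^^ m) (K_coset y) = (?L ^^ m) (K_coset x)"
    and carr: "(?L ^^ m) (K_coset x) \<in> carrier (K_group \<C> \<E>)"
    if "Poly_Mapping.keys x \<subseteq> F" "Poly_Mapping.keys y \<subseteq> F" for x y m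
  proof -
    have k: "Poly_Mapping.keys x \<subseteq> isoclasses" "Poly_Mapping.keys y \<subseteq> isoclasses" using that F(2) by blast+
    then have kd: "Poly_Mapping.keys (x - y) \<subseteq> isoclasses" by (rule keys_diff_subset)
    have c: "K_coset x \<in> carrier (K_group \<C> \<E>)" "K_coset y \<in> carrier (K_group \<C> \<E>)" "K_coset (x - y) \<in> carrier (K_group \<C> \<E>)"
      using k kd by (simp_all add: K_group_carrier)
    have "K_coset x = K_coset (x - y) \<otimes>\<^bsub>K_group \<C> \<E>\<^esub> K_coset y" using K_coset.hom_mult[of "x - y" y] k kd by simp
    then show "(?L ^^ m) (K_coset (x - y)) \<otimes>\<^bsub>K_group \<C> \<E>\<^esub> (?L ^^ m) (K_coset y) = (?L ^^ m) (K_coset x)"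
      using group_hom.hom_mult[OF Ln c(3,2)] by simp
    show "(?L ^^ m) (K_coset x) \<in> carrier (K_group \<C> \<E>)" using group_hom.hom_closed[OF Ln c(1)] .
  qed
  have "\<exists>k. \<forall>m\<ge>k. H m = H k"
  proof (rule frag_subgroup_chain[OF F(1)])
    fix m
    show "Poly_Mapping.keys x \<subseteq> F" if "x \<in> H m" for x using that by (simp add: H_def)
    show "H m \<subseteq> H (Suc m)" using L.hom_one by (auto simp: H_def)
    show "0 \<in> H m" using K_coset.hom_one group_hom.hom_one[OF Ln] by (simp add: H_def)
    fix x y assume "x \<in> H m" "y \<in> H m"
    then have *: "Poly_Mapping.keys x \<subseteq> F" "Poly_Mapping.keys y \<subseteq> F"
      "(?L ^^ m) (K_coset x) = \<one>\<^bsub>K_group \<C> \<E>\<^esub>" "(?L ^^ m) (K_coset y) = \<one>\<^bsub>K_group \<C> \<E>\<^esub>"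
      by (simp_all add: H_def)
    have d: "Poly_Mapping.keys (x - y) \<subseteq> F" by (rule keys_diff_subset[OF *(1,2)])
    then have "(?L ^^ m) (K_coset (x - y)) = \<one>\<^bsub>K_group \<C> \<E>\<^esub>"
      using diff[OF *(1,2), of m] carr[OF d *(1), of m] unfolding *(3,4) by simp
    with d show "x - y \<in> H m" by (simp add: H_def)
  qed
  then obtain k where k: "\<forall>m\<ge>k. H m = H k" by blast
  have "?L \<in> iso ((K_group \<C> \<E>)\<lparr>carrier := (?L ^^ m) ` ?S\<rparr>) ((K_group \<C> \<E>)\<lparr>carrier := (?L ^^ Suc m) ` ?S\<rparr>)"
    if m: "k \<le> m" for m
  proof -
    have sub: "(?L ^^ m) ` ?S \<subseteq> carrier (K_group \<C> \<E>)" using S group_hom.hom_closed[OF Ln] by blast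
    have hom: "?L \<in> hom ((K_group \<C> \<E>)\<lparr>carrier := (?L ^^ m) ` ?S\<rparr>) ((K_group \<C> \<E>)\<lparr>carrier := (?L ^^ Suc m) ` ?S\<rparr>)"
    proof (rule homI)
      fix x y assume "x \<in> carrier ((K_group \<C> \<E>)\<lparr>carrier := (?L ^^ m) ` ?S\<rparr>)" "y \<in> carrier ((K_group \<C> \<E>)\<lparr>carrier := (?L ^^ m) ` ?S\<rparr>)"
      then have "x \<in> carrier (K_group \<C> \<E>)" "y \<in> carrier (K_group \<C> \<E>)" using sub by auto
      from L.hom_mult[OF this] show "?L (x \<otimes>\<^bsub>(K_group \<C> \<E>)\<lparr>carrier := (?L ^^ m) ` ?S\<rparr>\<^esub> y)
        = ?L x \<otimes>\<^bsub>(K_group \<C> \<E>)\<lparr>carrier := (?L ^^ Suc m) ` ?S\<rparr>\<^esub> ?L y" by simp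
    next
      fix x assume "x \<in> carrier ((K_group \<C> \<E>)\<lparr>carrier := (?L ^^ m) ` ?S\<rparr>)"
      then obtain z where z: "z \<in> ?S" "x = (?L ^^ m) z" by auto
      then have "?L x = (?L ^^ Suc m) z" by simp
      with z(1) have "?L x \<in> (?L ^^ Suc m) ` ?S" by (rule rev_image_eqI)
      then show "?L x \<in> carrier ((K_group \<C> \<E>)\<lparr>carrier := (?L ^^ Suc m) ` ?S\<rparr>)" by simp
    qed
    have "inj_on ?L ((?L ^^ m) ` ?S)"
    proof (rule inj_onI)
      fix a b assume "a \<in> (?L ^^ m) ` ?S" "b \<in> (?L ^^ m) ` ?S" and eq: "?L a = ?L b"
      then obtain u v where "u \<in> ?S" "v \<in> ?S" and uv: "a = (?L ^^ m) u" "b = (?L ^^ m) v" by blast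
      then have "u \<in> K_coset ` {x. Poly_Mapping.keys x \<subseteq> F}" "v \<in> K_coset ` {x. Poly_Mapping.keys x \<subseteq> F}"
        using F(3) by blast+
      with uv obtain x y where xy: "Poly_Mapping.keys x \<subseteq> F" "Poly_Mapping.keys y \<subseteq> F"
        "a = (?L ^^ m) (K_coset x)" "b = (?L ^^ m) (K_coset y)"
        by blast
      have d: "Poly_Mapping.keys (x - y) \<subseteq> F" by (rule keys_diff_subset[OF xy(1,2)])
      have "(?L ^^ Suc m) (K_coset (x - y)) \<otimes>\<^bsub>K_group \<C> \<E>\<^esub> (?L ^^ Suc m) (K_coset y) = (?L ^^ Suc m) (K_coset y)"
        using diff[OF xy(1,2), of "Suc m"] eq xy(3,4) by simp
      then have "(?L ^^ Suc m) (K_coset (x - y)) = \<one>\<^bsub>K_group \<C> \<E>\<^esub>"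
        using K.r_cancel_one[OF carr[OF xy(2,2)] carr[OF d d]] by blast
      then have "x - y \<in> H (Suc m)" using d by (simp add: H_def)
      also have "H (Suc m) = H m" using k m by (metis le_SucI)
      finally have "(?L ^^ m) (K_coset (x - y)) = \<one>\<^bsub>K_group \<C> \<E>\<^esub>" by (simp add: H_def)
      then show "a = b" using diff[OF xy(1,2), of m] carr[OF xy(2,2)] xy(3,4) by simp
    qed
    moreover have "?L ` ((?L ^^ m) ` ?S) = (?L ^^ Suc m) ` ?S" by (simp add: image_comp)
    ultimately show ?thesis using hom by (simp add: iso_def bij_betw_def)
  qed
  then have "\<exists>k. ?P k" by blast
  then have "?P (LEAST k. ?P k)" by (rule LeastI_ex)
  then show ?thesis using assms(2) unfolding IT_Phi_def by blast
qed

text \<open>At or above the level \<open>\<Phi>\<close>, injectivity cancels the syzygy endomorphism one factor at a time.\<close>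

lemma IT_Phi_K_class_eq:
  assumes "X \<in> Obj \<C>" "x \<in> K_span \<C> \<E> X" "y \<in> K_span \<C> \<E> X" "IT_Phi \<C> \<E> X \<le> m"
    "(K_syzygy \<C> \<E> ^^ m) x = (K_syzygy \<C> \<E> ^^ m) y"
  shows "(K_syzygy \<C> \<E> ^^ IT_Phi \<C> \<E> X) x = (K_syzygy \<C> \<E> ^^ IT_Phi \<C> \<E> X) y"
  using assms(4,5)
proof (induction m rule: dec_induct)
  case (step m)
  have "inj_on (K_syzygy \<C> \<E>) ((K_syzygy \<C> \<E> ^^ m) ` K_span \<C> \<E> X)"
    using IT_Phi_iso[OF assms(1) step(1)] by (simp add: iso_def bij_betw_def)
  then have "(K_syzygy \<C> \<E> ^^ m) x = (K_syzygy \<C> \<E> ^^ m) y"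
    by (rule inj_onD) (use step(4) assms(2,3) in auto)
  then show ?case by (rule step.IH)
qed simp

end

section \<open>The bound\<close>

context strong_exact_IT_context
begin

text \<open>
  Let \<open>h : Z \<rightarrow> T\<close> be an admissible monic with cokernel of projective dimension at most \<open>r\<close>, let \<open>Z\<close> be a retract of
  \<open>T\<close>, and suppose that the component \<open>\<alpha>\<close> of \<open>h\<close> on \<open>Z\<close> is nilpotent. Pushing \<open>h\<close> out along the section of a
  retraction and composing, one obtains admissible monics out of \<open>Z\<close> with component \<open>\<alpha>\<^sup>n\<close> whose cokernels are
  iterated extensions of that of \<open>h\<close>. Once \<open>\<alpha>\<^sup>n = 0\<close>, the retraction factors through the cokernel,
  so that \<open>Z\<close> is a retract of an object of projective dimension at most \<open>r\<close>.
\<close>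

lemma proj_dim_le_nilpotent:
  assumes "(h, e) \<in> \<E>" "h \<in> Hom \<C> Z T" "s \<in> Hom \<C> Z T" "\<pi> \<in> Hom \<C> T Z" "\<pi> \<bullet> s = Idn \<C> Z" "\<pi> \<bullet> h = \<alpha>"
    "\<alpha> [^]\<^bsub>end_ring \<C> Z\<^esub> (N::nat) = Nul \<C> Z Z" "proj_dim_le r (Tgt \<C> e)"
  shows "proj_dim_le r Z"
proof -
  have M: "h \<in> Mor \<C>" "Src \<C> h = Z" "Tgt \<C> h = T" "s \<in> Mor \<C>" "Src \<C> s = Z" "Tgt \<C> s = T"
    "\<pi> \<in> Mor \<C>" "Src \<C> \<pi> = T" "Tgt \<C> \<pi> = Z" "Z \<in> Obj \<C>"
    using assms(2-4) hom_obj[OF assms(2)] by (simp_all add: Hom_iff)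
  have \<alpha>: "\<alpha> \<in> Mor \<C>" "Src \<C> \<alpha> = Z" "Tgt \<C> \<alpha> = Z" unfolding assms(6)[symmetric] using M by simp_all
  interpret End: monoid "end_ring \<C> Z" by (rule monoid_end_ring[OF M(10)])
  have "\<exists>h e s \<pi> T. (h, e) \<in> \<E> \<and> h \<in> Hom \<C> Z T \<and> s \<in> Hom \<C> Z T \<and> \<pi> \<in> Hom \<C> T Z \<and> \<pi> \<bullet> s = Idn \<C> Z
    \<and> \<pi> \<bullet> h = \<alpha> [^]\<^bsub>end_ring \<C> Z\<^esub> n \<and> proj_dim_le r (Tgt \<C> e)" for n :: nat
  proof (induction n)
    case 0
    obtain e' where e': "(Idn \<C> Z, e') \<in> \<E>" using idn_monic[OF M(10)] by (auto simp: admissible_monic_def)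
    have "proj_dim_le r (Tgt \<C> e')"
      using proj_dim_le_mono[OF proj_dim_le_0[OF projective_zero[OF cokernel_idn_zero[OF e' M(10)]]]] by simp
    moreover have "Idn \<C> Z \<in> Hom \<C> Z Z" "Idn \<C> Z \<bullet> Idn \<C> Z = Idn \<C> Z" using M(10) by (simp_all add: Hom_iff)
    moreover have "\<alpha> [^]\<^bsub>end_ring \<C> Z\<^esub> (0::nat) = Idn \<C> Z" by simp
    ultimately show ?case using e' by metis
  next
    case (Suc n)
    then obtain hn en sn \<pi>n Tn where n: "(hn, en) \<in> \<E>" "hn \<in> Hom \<C> Z Tn" "sn \<in> Hom \<C> Z Tn" "\<pi>n \<in> Hom \<C> Tn Z"
      "\<pi>n \<bullet> sn = Idn \<C> Z" "\<pi>n \<bullet> hn = \<alpha> [^]\<^bsub>end_ring \<C> Z\<^esub> n" "proj_dim_le r (Tgt \<C> en)"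
      by blast
    have Mn: "hn \<in> Mor \<C>" "Src \<C> hn = Z" "Tgt \<C> hn = Tn" "sn \<in> Mor \<C>" "Src \<C> sn = Z" "Tgt \<C> sn = Tn"
      "\<pi>n \<in> Mor \<C>" "Src \<C> \<pi>n = Tn" "Tgt \<C> \<pi>n = Z"
      using n(2-4) by (simp_all add: Hom_iff)
    obtain b h' where P: "is_pushout \<C> h sn b h'"
      by (rule ex_pushout[OF assms(1), of sn]) (use M Mn in simp_all)
    note PD = is_pushoutD(3,4,6-8)[OF P]
    obtain q where q: "(h', q) \<in> \<E>" "Tgt \<C> q = Tgt \<C> e" using pushout_exact[OF P assms(1)] by metis
    obtain b' j q' where c: "(h' \<bullet> hn, b') \<in> \<E>" "(j, q') \<in> \<E>" "j \<in> Hom \<C> (Tgt \<C> en) (Tgt \<C> b')"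
      "q' \<in> Hom \<C> (Tgt \<C> b') (Tgt \<C> q)"
      by (rule exact_cmp_monic[OF n(1) q(1)]) (use PD Mn in simp_all)
    have "proj_dim_le r (Src \<C> q')"
      by (rule proj_dim_le_extension[OF c(2)]) (use c(3,4) n(7) q(2) assms(8) in \<open>simp_all add: Hom_iff\<close>)
    then have d: "proj_dim_le r (Tgt \<C> b')" using c(4) by (simp add: Hom_iff)
    have "\<pi> \<bullet> h = \<alpha> \<bullet> \<pi>n \<bullet> sn" using assms(6) n(5) \<alpha> Mn by simp
    then obtain w where w: "w \<in> Mor \<C>" "Src \<C> w = Tgt \<C> h'" "Tgt \<C> w = Z" "w \<bullet> b = \<pi>" "w \<bullet> h' = \<alpha> \<bullet> \<pi>n"
      using pushout_lift[OF P, of \<pi> "\<alpha> \<bullet> \<pi>n"] M Mn \<alpha> by auto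
    have "w \<bullet> (b \<bullet> s) = (w \<bullet> b) \<bullet> s" using w(1-3) PD M by simp
    then have 1: "w \<bullet> (b \<bullet> s) = Idn \<C> Z" unfolding w(4) assms(5) .
    have "w \<bullet> (h' \<bullet> hn) = (w \<bullet> h') \<bullet> hn" using w(1-3) PD Mn by simp
    also have "\<dots> = \<alpha> \<bullet> (\<pi>n \<bullet> hn)" unfolding w(5) using \<alpha> Mn by simp
    also have "\<dots> = \<alpha> [^]\<^bsub>end_ring \<C> Z\<^esub> Suc n"
      unfolding n(6) using End.nat_pow_Suc2[of \<alpha> n] \<alpha> by (simp add: Hom_iff)
    finally have 2: "w \<bullet> (h' \<bullet> hn) = \<alpha> [^]\<^bsub>end_ring \<C> Z\<^esub> Suc n" .
    have "h' \<bullet> hn \<in> Hom \<C> Z (Tgt \<C> h')" "b \<bullet> s \<in> Hom \<C> Z (Tgt \<C> h')" "w \<in> Hom \<C> (Tgt \<C> h') Z"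
      using w(1-3) PD M Mn by (simp_all add: Hom_iff)
    with c(1) d 1 2 show ?case by blast
  qed
  from this[of N] obtain h e s \<pi> T where n: "(h, e) \<in> \<E>" "h \<in> Hom \<C> Z T" "s \<in> Hom \<C> Z T" "\<pi> \<in> Hom \<C> T Z"
      "\<pi> \<bullet> s = Idn \<C> Z" "\<pi> \<bullet> h = Nul \<C> Z Z" "proj_dim_le r (Tgt \<C> e)"
    unfolding assms(7) by blast
  note K = exactD(1-3)[OF n(1)]
  have Mn: "Src \<C> h = Z" "Tgt \<C> h = T" "s \<in> Mor \<C>" "Src \<C> s = Z" "Tgt \<C> s = T"
      "\<pi> \<in> Mor \<C>" "Src \<C> \<pi> = T" "Tgt \<C> \<pi> = Z" "Src \<C> e = T"
    using n(2-4) K(3) by (simp_all add: Hom_iff)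
  obtain u where u: "u \<in> Mor \<C>" "Src \<C> u = Tgt \<C> e" "Tgt \<C> u = Z" "u \<bullet> e = \<pi>"
    using cokernel_lift[OF exact_cokernel[OF n(1)], of \<pi>] Mn n(6) by auto
  have "u \<bullet> (e \<bullet> s) = (u \<bullet> e) \<bullet> s" using u(1-3) Mn K by simp
  then have us: "u \<bullet> (e \<bullet> s) = Idn \<C> Z" unfolding u(4) n(5) .
  have "retract Z (Tgt \<C> e)" by (rule retractI[OF _ u(1) _ _ u(2,3) us]) (use Mn K in simp_all)
  then obtain Y where "is_dsum \<C> Z Y (Tgt \<C> e)" by (rule retract_direct_summand)
  then show ?thesis using proj_dim_le_dsum_iff n(7) by blast
qed

text \<open>
  If the first two terms of a short exact sequence are stably isomorphic, then after adding projective objects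
  the monic is an endomorphism of one object \<open>X\<close> up to projective summands. By Fitting's property
  \<open>X = Y \<oplus> Z\<close>, with this endomorphism invertible on \<open>Y\<close> and nilpotent on \<open>Z\<close>. Cancelling \<open>Y\<close> leaves a
  sequence \<open>Z \<oplus> Q \<rightarrow> Z \<oplus> P \<rightarrow> C\<close>. The cokernel of its restriction to \<open>Z\<close> is an extension of \<open>C\<close> by \<open>Q\<close>.
\<close>

lemma stably_iso_reduction:
  assumes "(f, g) \<in> \<E>" "stably_iso (Src \<C> f) (Src \<C> g)" "proj_dim_le r (Tgt \<C> g)"
  obtains Z P X where "projective \<C> \<E> P" "is_dsum \<C> (Src \<C> f) P X" "retract Z X" "proj_dim_le r Z"
    "\<And>d. proj_dim_le d Z \<Longrightarrow> proj_dim_le (Suc d) (Tgt \<C> g)"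
proof -
  let ?A = "Src \<C> f" and ?B = "Src \<C> g"
  obtain P Q X where PQ: "is_dsum \<C> ?A P X" "is_dsum \<C> ?B Q X" "projective \<C> \<E> P" "projective \<C> \<E> Q"
    using assms(2) by (rule stably_isoE)
  have O: "?A \<in> Obj \<C>" "?B \<in> Obj \<C>" "P \<in> Obj \<C>" "Q \<in> Obj \<C>" "X \<in> Obj \<C>"
    using is_dsum_obj[OF PQ(1)] is_dsum_obj[OF PQ(2)] by simp_all
  obtain R where R: "is_dsum \<C> P Q R" using ex_dsum O by blast
  have RO: "R \<in> Obj \<C>" using is_dsum_obj[OF R] by simp
  obtain V where V: "is_dsum \<C> ?A R V" using ex_dsum O RO by blast
  obtain W where W: "is_dsum \<C> ?B R W" using ex_dsum O RO by blast
  obtain a1 a2 a1' a2' where bV: "biproduct \<C> ?A R V a1 a2 a1' a2'" using V by (rule is_dsumE)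
  obtain b1 b2 b1' b2' where bW: "biproduct \<C> ?B R W b1 b2 b1' b2'" using W by (rule is_dsumE)
  note K = exactD(1-3)[OF assms(1)]
  have E1: "(b1 \<bullet> f \<bullet> a1' \<boxplus> b2 \<bullet> a2', g \<bullet> b1') \<in> \<E>"
    by (rule exact_add_idn_monic[OF bV bW assms(1)]) (use K in \<open>simp add: Hom_iff\<close>)
  define f1 where "f1 = b1 \<bullet> f \<bullet> a1' \<boxplus> b2 \<bullet> a2'"
  define g1 where "g1 = g \<bullet> b1'"
  have E1: "(f1, g1) \<in> \<E>" using E1 by (simp add: f1_def g1_def)
  have f1: "f1 \<in> Mor \<C>" "Src \<C> f1 = V" "Tgt \<C> f1 = W" and g1: "Src \<C> g1 = W" "Tgt \<C> g1 = Tgt \<C> g"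
    unfolding f1_def g1_def using K biprodD(4,6,7,9-15)[OF bV] biprodD(4-15)[OF bW]
    by simp_all
  have "isoclass \<C> V = isoclass \<C> X \<star> isoclass \<C> Q"
    unfolding isoclass_dsum[OF V, symmetric] isoclass_dsum[OF R, symmetric] isoclass_dsum[OF PQ(1), symmetric]
    by (simp only: dsum_set_assoc)
  then have "is_dsum \<C> X Q V" using is_dsum_iff[OF O(5,4)] is_dsum_obj[OF V] by blast
  then obtain i1 i2 p1 p2 where dV: "biproduct \<C> X Q V i1 i2 p1 p2" by (rule is_dsumE)
  have "isoclass \<C> W = isoclass \<C> X \<star> isoclass \<C> P"
    unfolding isoclass_dsum[OF W, symmetric] isoclass_dsum[OF R, symmetric] isoclass_dsum[OF PQ(2), symmetric]
    by (simp only: dsum_set_ac)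
  then have "is_dsum \<C> X P W" using is_dsum_iff[OF O(5,3)] is_dsum_obj[OF W] by blast
  then obtain j1 j2 q1 q2 where dW: "biproduct \<C> X P W j1 j2 q1 q2" by (rule is_dsumE)
  note B = biprodD[OF dV] biprodD[OF dW]
  have "q1 \<bullet> (f1 \<bullet> i1) \<in> Hom \<C> X X" using f1 by (simp add: Hom_iff B)
  from fitting[OF this] obtain Y Z y z y' z' \<theta> \<alpha> N where dX: "biproduct \<C> Y Z X y z y' z'"
    and \<theta>: "\<theta> \<in> Hom \<C> Y Y" "iso_arrow \<C> \<theta>" and \<alpha>: "\<alpha> \<in> Hom \<C> Z Z" "\<alpha> [^]\<^bsub>end_ring \<C> Z\<^esub> (N::nat) = Nul \<C> Z Z"
    and \<phi>: "q1 \<bullet> (f1 \<bullet> i1) = y \<bullet> \<theta> \<bullet> y' \<boxplus> z \<bullet> \<alpha> \<bullet> z'"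
    by blast
  note BX = biprodD[OF dX]
  have M: "\<theta> \<in> Mor \<C>" "Src \<C> \<theta> = Y" "Tgt \<C> \<theta> = Y" "\<alpha> \<in> Mor \<C>" "Src \<C> \<alpha> = Z" "Tgt \<C> \<alpha> = Z"
    using \<theta>(1) \<alpha>(1) by (simp_all add: Hom_iff)
  have \<phi>': "q1 \<bullet> (f1 \<bullet> (i1 \<bullet> h)) = y \<bullet> (\<theta> \<bullet> (y' \<bullet> h)) \<boxplus> z \<bullet> (\<alpha> \<bullet> (z' \<bullet> h))" if "h \<in> Mor \<C>" "Tgt \<C> h = X" for h
    using arg_cong[OF \<phi>, of "\<lambda>x. x \<bullet> h"] that f1 M by (simp add: B BX)
  obtain V1 where "is_dsum \<C> Z Q V1" using ex_dsum BX(2) O by blast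
  then obtain k1 k2 r1 r2 where dV1: "biproduct \<C> Z Q V1 k1 k2 r1 r2" by (rule is_dsumE)
  obtain W1 where "is_dsum \<C> Z P W1" using ex_dsum BX(2) O by blast
  then obtain l1 l2 s1 s2 where dW1: "biproduct \<C> Z P W1 l1 l2 s1 s2" by (rule is_dsumE)
  note B1 = biprodD[OF dV1] biprodD[OF dW1]
  define c where "c = i1 \<bullet> z \<bullet> r1 \<boxplus> i2 \<bullet> r2"
  define d where "d = l1 \<bullet> z' \<bullet> q1 \<boxplus> l2 \<bullet> q2"
  have c: "c \<in> Mor \<C>" "Src \<C> c = V1" "Tgt \<C> c = V" "c \<bullet> k1 = i1 \<bullet> z"
    unfolding c_def by (simp_all add: B BX B1)
  have d: "d \<in> Mor \<C>" "Src \<C> d = W" "Tgt \<C> d = W1" "s1 \<bullet> d = z' \<bullet> q1"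
    unfolding d_def by (simp_all add: B BX B1)
  have sd: "s1 \<bullet> (d \<bullet> h) = z' \<bullet> (q1 \<bullet> h)" if "h \<in> Mor \<C>" "Tgt \<C> h = W" for h
    using arg_cong[OF d(4), of "\<lambda>x. x \<bullet> h"] that d(1-3) by (simp add: B BX B1)
  have aV: "biproduct \<C> Y V1 (Src \<C> f1) (i1 \<bullet> y) c (y' \<bullet> p1) (k1 \<bullet> z' \<bullet> p1 \<boxplus> k2 \<bullet> p2)"
    unfolding f1(2) c_def by (rule biproduct_assoc[OF dV dX dV1])
  have aW: "biproduct \<C> Y W1 (Src \<C> g1) (j1 \<bullet> y) (j1 \<bullet> z \<bullet> s1 \<boxplus> j2 \<bullet> s2) (y' \<bullet> q1) d"
    unfolding g1(1) d_def by (rule biproduct_assoc[OF dW dX dW1])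
  have comp: "(y' \<bullet> q1) \<bullet> f1 \<bullet> (i1 \<bullet> y) = \<theta>" using f1 M by (simp add: B BX \<phi>')
  obtain \<theta>' where th: "inverse_arrows \<theta> \<theta>'" using \<theta>(2) by (auto simp: iso_arrow_iff)
  then have inv: "inverse_arrows ((y' \<bullet> q1) \<bullet> f1 \<bullet> (i1 \<bullet> y)) \<theta>'" by (simp only: comp)
  have M': "\<theta>' \<in> Mor \<C>" "Src \<C> \<theta>' = Y" "Tgt \<C> \<theta>' = Y" using inverse_arrowsD[OF th] M by simp_all
  obtain f2 g2 where E2: "(f2, g2) \<in> \<E>" "f2 \<in> Hom \<C> V1 W1" "Tgt \<C> g2 = Tgt \<C> g1"
    and f2: "f2 = d \<bullet> f1 \<bullet> c \<boxplus> neg (d \<bullet> f1 \<bullet> (i1 \<bullet> y) \<bullet> \<theta>' \<bullet> (y' \<bullet> q1) \<bullet> f1 \<bullet> c)"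
    by (rule exact_gauss[OF E1 aV aW inv])
  have M2: "f2 \<in> Mor \<C>" "Src \<C> f2 = V1" "Tgt \<C> f2 = W1" using E2(2) by (simp_all add: Hom_iff)
  have \<alpha>2: "s1 \<bullet> (f2 \<bullet> k1) = \<alpha>"
    unfolding f2 using f1 M M' c d(1-3) by (simp add: B(1-15,25-39) BX B1(1-15,25-39) \<phi>' sd)
  have "(k1, r2) \<in> \<E>" by (rule dsum_exact[OF dV1])
  then obtain b j q where b: "(f2 \<bullet> k1, b) \<in> \<E>" "(j, q) \<in> \<E>" "j \<in> Hom \<C> (Tgt \<C> r2) (Tgt \<C> b)" "q \<in> Hom \<C> (Tgt \<C> b) (Tgt \<C> g2)"
    by (rule exact_cmp_monic[OF _ E2(1)]) (use M2 in \<open>simp add: B1\<close>)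
  have pQ: "proj_dim_le n Q" "proj_dim_le n P" for n
    using proj_dim_le_mono[OF proj_dim_le_0] PQ(3,4) by blast+
  have "proj_dim_le r (Src \<C> q)"
    by (rule proj_dim_le_extension[OF b(2)])
      (use b(3,4) pQ(1) assms(3) E2(3) g1(2) in \<open>simp_all add: Hom_iff B1\<close>)
  then have "proj_dim_le r (Tgt \<C> b)" using b(4) by (simp add: Hom_iff)
  then have Z: "proj_dim_le r Z"
    by (intro proj_dim_le_nilpotent[OF b(1) _ _ _ _ \<alpha>2 \<alpha>(2), of W1 l1]) (use M2 in \<open>simp_all add: Hom_iff B1\<close>)
  have step: "proj_dim_le (Suc n) (Tgt \<C> g)" if n: "proj_dim_le n Z" for n
  proof -
    have "proj_dim_le n V1" "proj_dim_le n W1"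
      using proj_dim_le_dsum_iff is_dsumI[OF dV1] is_dsumI[OF dW1] n pQ by blast+
    moreover have "Src \<C> f2 = V1" "Src \<C> g2 = W1" using M2 exactD(3)[OF E2(1)] by simp_all
    ultimately have "proj_dim_le (Suc n) (Tgt \<C> g2)" using proj_dim_le_quotient[OF E2(1)] by simp
    then show ?thesis using E2(3) g1(2) by simp
  qed
  have "retract Z X" using dsum_retract(2)[OF is_dsumI[OF dX]] .
  from that[OF PQ(3,1) this Z step] show thesis by blast
qed

lemma retract_add_closure:
  assumes "retract L U"
  shows "L \<in> add_closure \<C> U"
proof -
  have U: "U \<in> Obj \<C>" using assms by (rule retractE)
  interpret comm_group "hom_group \<C> U U" by (rule hom_comm_group[OF U U])
  have I: "Idn \<C> U \<in> Hom \<C> U U" using U by (simp add: Hom_iff)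
  have "finprod (hom_group \<C> U U) (\<lambda>k. Idn \<C> U \<bullet> Idn \<C> U) {..<1::nat} = Idn \<C> U"
    using U I finprod_insert[of "{}" "0::nat" "\<lambda>k. Idn \<C> U \<bullet> Idn \<C> U"] by (simp add: lessThan_Suc)
  then have "is_finite_dsum \<C> 1 (\<lambda>_. U) U"
    unfolding is_finite_dsum_def using U I
    by (intro conjI allI impI exI[of _ "\<lambda>_. Idn \<C> U"]) simp_all
  moreover obtain M where "is_dsum \<C> L M U" using assms by (rule retract_direct_summand)
  ultimately show ?thesis unfolding add_closure_def direct_summand_def by blast
qed

text \<open>
  Local summands of \<open>U \<oplus> P\<close> are projective or lie in \<open>add U\<close>, so the supremum defining \<open>fpd\<close> also bounds the
  projective dimension of every retract of \<open>U \<oplus> P\<close>, as soon as it is finite.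
\<close>

lemma proj_dim_le_fpd:
  assumes "Z \<in> Obj \<C>" "retract Z S" "proj_dim_le r Z" "is_dsum \<C> U P S" "projective \<C> \<E> P"
    "fpd \<C> \<E> (add_closure \<C> U) \<le> enat d"
  shows "proj_dim_le d Z"
  using assms(1-3)
proof (induction rule: local_sum_induct)
  case (zero Z)
  show ?case using proj_dim_le_mono[OF proj_dim_le_0[OF projective_zero[OF zero(1)]]] by simp
next
  case (step Z L X)
  have r: "retract Z S" "retract L S" using retract_trans[OF _ step(4)] dsum_retract[OF step(3)] by blast+
  have f: "proj_dim_le r Z" "proj_dim_le r L" using proj_dim_le_dsum_iff[OF step(3)] step(5) by blast+
  obtain i1 i2 p1 p2 where bp: "biproduct \<C> U P S i1 i2 p1 p2" using assms(4) by (rule is_dsumE)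
  obtain i p where "i \<in> Hom \<C> L S" "p \<in> Hom \<C> S L" "p \<bullet> i = Idn \<C> L" using r(2) by (auto simp: retract_def)
  from local_retract_sum[OF step(2) bp this] have "proj_dim_le d L"
  proof
    assume "retract L P"
    then show ?thesis using proj_dim_le_mono[OF proj_dim_le_0] projective_retract[OF assms(5)] by blast
  next
    assume "retract L U"
    then have "L \<in> add_closure \<C> U" by (rule retract_add_closure)
    moreover have L: "L \<in> Obj \<C>" using step(2) by (simp add: local_object_def)
    moreover have "pd \<C> \<E> L < \<infinity>" using pd_finite_iff[OF L] f(2) by blast
    ultimately have "pd \<C> \<E> L \<le> fpd \<C> \<E> (add_closure \<C> U)" unfolding fpd_def by (intro SUP_upper) simp
    also note assms(6)
    finally show ?thesis using pd_le_iff[OF L] by blast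
  qed
  then show ?case using proj_dim_le_dsum_iff[OF step(3)] step.IH[OF r(1) f(1)] by blast
qed

text \<open>
  At a level beyond \<open>r\<close> the sequence of syzygies ends in a projective object and splits, so the classes of its first two
  terms agree there, and therefore already at the level \<open>\<Phi>(S)\<close>.
\<close>

lemma nth_syzygies_stably_iso:
  assumes "(f, g) \<in> \<E>" "is_dsum \<C> (Src \<C> f) (Src \<C> g) S" "proj_dim_le r (Tgt \<C> g)"
    "nth_syzygy (IT_Phi \<C> \<E> S) (Src \<C> f) A" "nth_syzygy (IT_Phi \<C> \<E> S) (Src \<C> g) B"
  shows "stably_iso A B"
proof -
  let ?n = "IT_Phi \<C> \<E> S" and ?L = "K_syzygy \<C> \<E>"
  let ?a = "K_class \<C> \<E> (Src \<C> f)" and ?b = "K_class \<C> \<E> (Src \<C> g)"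
  obtain f' g' where *: "(f', g') \<in> \<E>" "nth_syzygy (max ?n r) (Src \<C> f) (Src \<C> f')"
    "nth_syzygy (max ?n r) (Src \<C> g) (Src \<C> g')" "nth_syzygy (max ?n r) (Tgt \<C> g) (Tgt \<C> g')"
    by (rule nth_horseshoe[OF assms(1)])
  have p: "projective \<C> \<E> (Tgt \<C> g')"
    using proj_dim_leD[OF proj_dim_le_mono[OF assms(3)] *(4)] by simp
  obtain s t where "biproduct \<C> (Src \<C> f') (Tgt \<C> g') (Src \<C> g') f' s t g'" by (rule projective_split[OF *(1) p])
  then have "is_dsum \<C> (Src \<C> f') (Tgt \<C> g') (Src \<C> g')" by (rule is_dsumI)
  then have "K_class \<C> \<E> (Src \<C> g') = K_class \<C> \<E> (Src \<C> f')"
    using K_class_dsum K_class_projective[OF p] exactD(1)[OF *(1)] by simp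
  then have eq: "(?L ^^ max ?n r) ?a = (?L ^^ max ?n r) ?b"
    using K_syzygy_funpow_class[OF *(2)] K_syzygy_funpow_class[OF *(3)] by simp
  have O: "Src \<C> f \<in> Obj \<C>" "Src \<C> g \<in> Obj \<C>" "S \<in> Obj \<C>" using is_dsum_obj[OF assms(2)] by simp_all
  have span: "?a \<in> K_span \<C> \<E> S" "?b \<in> K_span \<C> \<E> S"
    using retract_K_span[OF O(1)] retract_K_span[OF O(2)] dsum_retract[OF assms(2)] by simp_all
  have "(?L ^^ ?n) ?a = (?L ^^ ?n) ?b" by (rule IT_Phi_K_class_eq[OF O(3) span _ eq]) simp
  then have "K_class \<C> \<E> A = K_class \<C> \<E> B"
    using K_syzygy_funpow_class[OF assms(4)] K_syzygy_funpow_class[OF assms(5)] by simp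
  then show ?thesis using K_class_eq_iff nth_syzygy_obj assms(4,5) by blast
qed

theorem pd_le_IT_Psi:
  assumes "(f, g) \<in> \<E>" "is_dsum \<C> (Src \<C> f) (Src \<C> g) S" "pd \<C> \<E> (Tgt \<C> g) < \<infinity>"
  shows "pd \<C> \<E> (Tgt \<C> g) \<le> IT_Psi \<C> \<E> S + 1"
proof -
  let ?n = "IT_Phi \<C> \<E> S"
  let ?U = "(syzygy \<C> \<E> ^^ ?n) S"
  have C: "Tgt \<C> g \<in> Obj \<C>" using exactD(2)[OF assms(1)] by simp
  have S: "S \<in> Obj \<C>" using is_dsum_obj[OF assms(2)] by simp
  obtain r where r: "proj_dim_le r (Tgt \<C> g)" using pd_finite_iff[OF C] assms(3) by blast
  obtain f' g' where *: "(f', g') \<in> \<E>" "nth_syzygy ?n (Src \<C> f) (Src \<C> f')"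
    "nth_syzygy ?n (Src \<C> g) (Src \<C> g')" "nth_syzygy ?n (Tgt \<C> g) (Tgt \<C> g')"
    by (rule nth_horseshoe[OF assms(1)])
  have "proj_dim_le (?n + r) (Tgt \<C> g)" by (rule proj_dim_le_mono[OF r]) simp
  then have r': "proj_dim_le r (Tgt \<C> g')" using proj_dim_le_shift[OF *(4)] by blast
  have AB: "stably_iso (Src \<C> f') (Src \<C> g')" by (rule nth_syzygies_stably_iso[OF assms(1,2) r *(2,3)])
  obtain Z P X where Z: "projective \<C> \<E> P" "is_dsum \<C> (Src \<C> f') P X" "retract Z X" "proj_dim_le r Z"
    and bound: "\<And>d. proj_dim_le d Z \<Longrightarrow> proj_dim_le (Suc d) (Tgt \<C> g')"
    using stably_iso_reduction[OF *(1) AB r'] by metis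
  (* Z is a retract of the direct sum of ?U and a projective object, since Src f' is a summand of M and M is
     another syzygy of S at the same level, hence stably isomorphic to ?U. *)
  obtain M where M: "nth_syzygy ?n S M" "is_dsum \<C> (Src \<C> f') (Src \<C> g') M"
    using nth_syzygy_dsum[OF *(2,3) assms(2)] by blast
  have "stably_iso S S" using isomorphic_stably_iso[OF isomorphic_refl[OF S]] .
  then have "stably_iso ?U M" using nth_syzygy_stably_iso nth_syzygy_syzygy[OF S] M(1) by blast
  then obtain P1 P2 T where T: "is_dsum \<C> ?U P1 T" "is_dsum \<C> M P2 T" "projective \<C> \<E> P1" by (rule stably_isoE)
  have "retract (Src \<C> f') T" using retract_trans dsum_retract(1) M(2) T(2) by blast
  then obtain A' where A': "is_dsum \<C> (Src \<C> f') A' T" by (rule retract_direct_summand)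
  obtain R where R: "is_dsum \<C> P1 P R" using ex_dsum projective_obj T(3) Z(1) by blast
  have pR: "projective \<C> \<E> R" by (rule projective_dsum[OF T(3) Z(1) R])
  have UO: "?U \<in> Obj \<C>" "R \<in> Obj \<C>" using is_dsum_obj[OF T(1)] is_dsum_obj[OF R] by simp_all
  obtain S' where S': "is_dsum \<C> ?U R S'" using ex_dsum UO by blast
  have "isoclass \<C> S' = isoclass \<C> ?U \<star> isoclass \<C> P1 \<star> isoclass \<C> P"
    unfolding isoclass_dsum[OF S', symmetric] isoclass_dsum[OF R, symmetric] by (simp only: dsum_set_assoc)
  also have "\<dots> = isoclass \<C> (Src \<C> f') \<star> isoclass \<C> A' \<star> isoclass \<C> P"
    unfolding isoclass_dsum[OF T(1)] isoclass_dsum[OF A'] by simp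
  also have "\<dots> = isoclass \<C> X \<star> isoclass \<C> A'"
    unfolding isoclass_dsum[OF Z(2), symmetric] by (simp only: dsum_set_ac)
  finally have "is_dsum \<C> X A' S'" using is_dsum_iff is_dsum_obj Z(2) A' S' by blast
  then have ZS: "retract Z S'" using retract_trans[OF Z(3)] dsum_retract(1) by blast
  show ?thesis
  proof (cases "fpd \<C> \<E> (add_closure \<C> ?U)")
    case infinity
    then show ?thesis by (simp add: IT_Psi_def)
  next
    case (enat d)
    have "proj_dim_le d Z"
      by (rule proj_dim_le_fpd[OF proj_dim_le_obj[OF Z(4)] ZS Z(4) S' pR]) (simp add: enat)
    then have "proj_dim_le (?n + Suc d) (Tgt \<C> g)" using bound proj_dim_le_shift[OF *(4)] by blast
    then have "pd \<C> \<E> (Tgt \<C> g) \<le> enat (?n + Suc d)" using pd_le_iff[OF C] by blast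
    also have "\<dots> = IT_Psi \<C> \<E> S + 1" by (simp add: IT_Psi_def enat one_enat_def)
    finally show ?thesis .
  qed
qed

end

theorem theorem2p14:
  fixes \<C> :: "('o, 'm) acat" and \<E> :: "('m \<times> 'm) set"
    and A B C S :: 'o and f g :: 'm
  assumes "strong_exact_IT_context \<C> \<E>"
    and "(f, g) \<in> \<E>" and "f \<in> Hom \<C> A B" and "g \<in> Hom \<C> B C"
    and "is_dsum \<C> A B S"
    and "pd \<C> \<E> C < \<infinity>"
  shows "pd \<C> \<E> C \<le> IT_Psi \<C> \<E> S + 1"
proof -
  interpret strong_exact_IT_context \<C> \<E> by fact
  have "Src \<C> f = A" "Src \<C> g = B" "Tgt \<C> g = C" using assms(3,4) by (simp_all add: Hom_iff)
  then show ?thesis using pd_le_IT_Psi[OF assms(2)] assms(5,6) by simp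
qed

end
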